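(* Let $1<p<\infty$. Suppose that $I$ is an ideal in $H^\infty$ such that for every nonzero $f\in I$ the inner factor of $f$ also belongs to $I$. Then $I$ is the trace of an ideal $J$ in $N^p$, i.e. $I=J\cap H^\infty$, and $J=IN^p$.
   Context: $D$ is the open unit disk in $\mathbb{C}$. $H^\infty$ is the ring of bounded holomorphic functions on $D$. For $1<p<\infty$, $N^p$ is the ring (under pointwise operations) of holomorphic $f$ on $D$ with $\sup_{0<r<1}\int_0^{2\pi}\big(\log^+|f(re^{i\theta})|\big)^p\,\frac{d\theta}{2\pi}<\infty$, where $\log^+ x=\max(\log x,0)$ for $x\ge 0$ (so $\log^+0=0$); it contains $H^\infty$. Every nonzero $f\in H^\infty$ has the canonical factorization $f=BSF$ with $B$ the Blaschke product of the zeros of $f$, $S$ a singular inner function, and $F$ an outer function; the inner factor of $f$ is $BS$. $IN^p$ denotes the ideal of $N^p$ generated by $I$. *)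

theory Defs
  imports "HOL-Complex_Analysis.Complex_Analysis" "HOL-Algebra.Ideal"
begin

abbreviation disk :: "complex set" (\<open>\<D>\<close>)
  where "\<D> \<equiv> ball 0 1"

text \<open>
  A function on the disk is represented by an element of \<^term>\<open>extensional \<D>\<close>, so that
  equality of ring elements is equality of functions on \<^term>\<open>\<D>\<close>.
\<close>

definition pointwise_ring :: "(complex \<Rightarrow> complex) set \<Rightarrow> (complex \<Rightarrow> complex) ring" where
  "pointwise_ring A =
     \<lparr>carrier = A,
      mult = (\<lambda>f g. \<lambda>z\<in>\<D>. f z * g z),
      one = (\<lambda>z\<in>\<D>. 1),
      zero = (\<lambda>z\<in>\<D>. 0),
      add = (\<lambda>f g. \<lambda>z\<in>\<D>. f z + g z)\<rparr>"

definition Hinf :: "(complex \<Rightarrow> complex) ring" where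
  "Hinf = pointwise_ring {f \<in> extensional \<D>. f holomorphic_on \<D> \<and> bounded (f ` \<D>)}"

definition log_plus :: "real \<Rightarrow> real" where
  "log_plus x = (if x = 0 then 0 else max (ln x) 0)"

text \<open>
  For holomorphic \<open>f\<close> the integrand below is continuous on \<open>[0, 2\<pi>]\<close>, so the integral is
  a genuine one for every \<open>r < 1\<close>.
\<close>

definition Np :: "real \<Rightarrow> (complex \<Rightarrow> complex) ring" where
  "Np p = pointwise_ring
     {f \<in> extensional \<D>. f holomorphic_on \<D> \<and>
        bdd_above ((\<lambda>r. (LINT t:{0..2*pi}|lborel.
                           log_plus (cmod (f (of_real r * cis t))) powr p) / (2*pi)) ` {0<..<1})}"

definition herglotz_kernel :: "complex \<Rightarrow> real \<Rightarrow> complex" where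
  "herglotz_kernel z t = (cis t + z) / (cis t - z)"

definition blaschke_factor :: "complex \<Rightarrow> complex \<Rightarrow> complex" where
  "blaschke_factor a z = (of_real (cmod a) / a) * ((a - z) / (1 - cnj a * z))"

text \<open>
  The product runs over the set of distinct nonzero zeros, each factor being raised to the
  multiplicity of the zero; it is the unconditional limit of the finite subproducts.
  The order at the origin is 0 if \<open>f 0 \<noteq> 0\<close>.
\<close>

definition blaschke_product :: "(complex \<Rightarrow> complex) \<Rightarrow> complex \<Rightarrow> complex" where
  "blaschke_product f z =
     z ^ nat (zorder f 0) *
     Lim (finite_subsets_at_top {a \<in> \<D>. a \<noteq> 0 \<and> f a = 0})
       (\<lambda>A. \<Prod>a\<in>A. blaschke_factor a z ^ nat (zorder f a))"

text \<open>
  Measures on the circle are given as Borel measures on the line carried by the parameter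
  interval \<open>[0, 2\<pi>]\<close>. The set \<open>N\<close> witnesses both this and singularity with respect to
  arc length. The zero measure is allowed and gives the constant 1.
\<close>

definition singular_inner :: "(complex \<Rightarrow> complex) \<Rightarrow> bool" where
  "singular_inner S \<longleftrightarrow>
     (\<exists>\<mu> :: real measure.
        finite_measure \<mu> \<and> sets \<mu> = sets borel \<and>
        (\<exists>N \<in> sets borel. N \<subseteq> {0..2*pi} \<and> emeasure lborel N = 0 \<and> emeasure \<mu> (- N) = 0) \<and>
        (\<forall>z\<in>\<D>. S z = exp (- (LINT t|\<mu>. herglotz_kernel z t))))"

text \<open>
  Since \<open>ln k\<close> is integrable, \<open>k\<close> is positive almost everywhere; changing it on a null set we
  may take it positive everywhere.
\<close>

definition outer :: "(complex \<Rightarrow> complex) \<Rightarrow> bool" where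
  "outer F \<longleftrightarrow>
     (\<exists>(k :: real \<Rightarrow> real) \<omega>.
        cmod \<omega> = 1 \<and> (\<forall>t. k t > 0) \<and>
        set_integrable lborel {0..2*pi} (\<lambda>t. ln (k t)) \<and>
        (\<forall>z\<in>\<D>. F z = \<omega> * exp ((LINT t:{0..2*pi}|lborel.
                                    herglotz_kernel z t * of_real (ln (k t))) / (2 * pi))))"

definition canonical_factorization ::
  "(complex \<Rightarrow> complex) \<Rightarrow> (complex \<Rightarrow> complex) \<Rightarrow> (complex \<Rightarrow> complex) \<Rightarrow> (complex \<Rightarrow> complex) \<Rightarrow> bool"
  where
  "canonical_factorization f B S F \<longleftrightarrow>
     (\<forall>z\<in>\<D>. B z = blaschke_product f z) \<and> singular_inner S \<and> outer F \<and>
     (\<forall>z\<in>\<D>. f z = B z * S z * F z)"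

text \<open>
  For nonzero \<open>f\<close> in \<open>H\<^sup>\<infinity>\<close> there is exactly one \<open>g\<close> with this property.
\<close>

definition is_inner_factor :: "(complex \<Rightarrow> complex) \<Rightarrow> (complex \<Rightarrow> complex) \<Rightarrow> bool" where
  "is_inner_factor g f \<longleftrightarrow>
     (\<exists>B S F. canonical_factorization f B S F \<and> g = (\<lambda>z\<in>\<D>. B z * S z))"

end

theory Submission
  imports Defs "HOL-Probability.Helly_Selection"
begin

text \<open>
  The whole argument is division by outer functions. Two facts carry it.

  \<^item> Every \<open>g \<in> N\<^sup>p\<close> with \<open>p > 1\<close> is a quotient \<open>a / b\<close> of functions of \<open>H\<^sup>\<infinity>\<close> with
    \<open>b\<close> outer (\<open>bounded_outer_denominator\<close>, \<open>Np_quotient\<close>).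
  \<^item> If \<open>h \<in> H\<^sup>\<infinity>\<close>, \<open>b\<close> is outer and \<open>b h \<in> I\<close>, then \<open>h \<in> I\<close> (\<open>cancel_outer_factor\<close>): \<open>b h\<close>
    and \<open>h\<close> have the same inner factor \<open>u\<close>, the hypothesis on \<open>I\<close> puts \<open>u\<close> into \<open>I\<close>, and
    \<open>h = u F\<close> with \<open>F\<close> bounded.

  By the first fact, the set \<open>K\<close> of all \<open>h \<in> N\<^sup>p\<close> for which some bounded outer \<open>b\<close> has
  \<open>b h \<in> I\<close> absorbs multiplication by \<open>N\<^sup>p\<close>; so \<open>K\<close> is an ideal of \<open>N\<^sup>p\<close> that contains \<open>I\<close>
  (\<open>ideal_of_outer_fractions\<close>), and \<open>I N\<^sup>p \<subseteq> K\<close>. By the second fact, \<open>K \<inter> H\<^sup>\<infinity> \<subseteq> I\<close>.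

  Both facts rest on the representation of functions on the disk by measures on the circle,
  which come from one compactness principle (\<open>arc_measure_weak_limit\<close>): densities of bounded
  mass have a weakly convergent subsequence.

  For the quotient, the densities are \<open>log\<^sup>+ \<bar>g\<bar>\<close> on circles of radius \<open>r < 1\<close>. Their Poisson
  integrals dominate \<open>log \<bar>g\<bar>\<close> inside (\<open>poisson_majorant\<close>), and their bounded \<open>p\<close>-th means,
  \<open>p > 1\<close>, make them uniformly integrable, so that the limit measure is absolutely continuous
  (\<open>weak_limit_absolutely_continuous\<close>), say with density \<open>v\<close>. The outer function \<open>b\<close> with
  \<open>log \<bar>b\<bar> = - P[v]\<close>, \<open>P\<close> being the Poisson integral, then satisfies \<open>\<bar>b\<bar> \<le> 1\<close> and \<open>\<bar>b g\<bar> \<le> 1\<close>.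

  For the cancellation one needs that a function \<open>f\<close> bounded by \<open>M\<close> has a canonical
  factorization with outer factor bounded by \<open>M\<close> (\<open>canonical_factorization_exists\<close>).
  Dividing \<open>f\<close> by finite Blaschke products never increases the bound, which gives both the
  convergence of the full product and, in the limit, a zero-free quotient \<open>G\<close>
  (\<open>blaschke_quotient\<close>). The nonnegative harmonic function \<open>log M - log \<bar>G\<bar>\<close> is the Poisson
  integral of a measure (\<open>herglotz_representation\<close>), whose singular part yields the singular
  inner factor and whose absolutely continuous part yields the outer factor.
\<close>

section \<open>The Herglotz kernel\<close>

lemma arc_set_integrable:
  fixes f :: "real \<Rightarrow> 'a::euclidean_space"
  assumes "continuous_on {0..2*pi} f"
  shows "set_integrable lborel {0..2*pi} f"
  by (rule borel_integrable_atLeastAtMost') (rule assms)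

lemma continuous_on_circle:
  assumes "f holomorphic_on ball 0 R" "R > 1"
  shows "continuous_on A (\<lambda>t. f (cis t))"
  by (rule continuous_on_compose2[OF holomorphic_on_imp_continuous_on[OF assms(1)]])
    (use assms(2) in \<open>auto intro: continuous_intros\<close>)

lemma circle_mean_value:
  fixes f :: "complex \<Rightarrow> complex"
  assumes hol: "f holomorphic_on ball 0 R" and R: "R > 1"
  shows "(LINT t:{0..2*pi}|lborel. f (cis t)) = 2 * pi * f 0"
proof -
  have hol1: "f holomorphic_on cball 0 1"
    by (rule holomorphic_on_subset[OF hol]) (use R in auto)
  have "((\<lambda>u. f u / (u - 0)) has_contour_integral (2 * of_real pi * \<i> * f 0)) (circlepath 0 1)"
    by (rule Cauchy_integral_circlepath_simple[OF hol1]) auto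
  then have "((\<lambda>t. f (cis t) / cis t * \<i> * cis t) has_integral (2 * of_real pi * \<i> * f 0)) {0..2*pi}"
    unfolding circlepath_def by (subst (asm) has_contour_integral_part_circlepath_iff) auto
  then have "((\<lambda>t. (-\<i>) * (\<i> * f (cis t))) has_integral ((-\<i>) * (2 * of_real pi * \<i> * f 0))) {0..2*pi}"
    by (intro has_integral_mult_right) (simp add: mult.commute)
  moreover have "(-\<i>) * (2 * of_real pi * \<i> * f 0) = 2 * pi * f 0"
    by (simp add: algebra_simps)
  moreover have "(\<lambda>t. (-\<i>) * (\<i> * f (cis t))) = (\<lambda>t. f (cis t))"
    by simp
  ultimately have int: "((\<lambda>t. f (cis t)) has_integral (2 * pi * f 0)) {0..2*pi}"
    by (simp only:)
  from set_borel_integral_eq_integral(2)[OF arc_set_integrable[OF continuous_on_circle[OF hol R]]] int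
  show ?thesis by (simp add: integral_unique)
qed

lemma cis_minus_nonzero: "cmod z < 1 \<Longrightarrow> cis t - z \<noteq> 0"
  using norm_cis[of t] by fastforce

lemma continuous_herglotz_kernel:
  assumes "cmod z < 1"
  shows "isCont (herglotz_kernel z) t"
proof -
  have "continuous_on UNIV (herglotz_kernel z)"
    unfolding herglotz_kernel_def using cis_minus_nonzero[OF assms] by (intro continuous_intros) auto
  then show ?thesis by (simp add: continuous_on_eq_continuous_at)
qed

lemma continuous_on_herglotz_kernel [continuous_intros]:
  "cmod z < 1 \<Longrightarrow> continuous_on A (herglotz_kernel z)"
  by (meson continuous_herglotz_kernel continuous_at_imp_continuous_on)

lemma measurable_herglotz_kernel [measurable]: "cmod z < 1 \<Longrightarrow> herglotz_kernel z \<in> borel_measurable borel"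
  by (simp add: borel_measurable_continuous_onI continuous_on_herglotz_kernel)

lemma norm_herglotz_kernel_le:
  assumes "cmod z < 1"
  shows "cmod (herglotz_kernel z t) \<le> (1 + cmod z) / (1 - cmod z)"
proof -
  have "cmod (cis t + z) \<le> 1 + cmod z" using norm_triangle_ineq[of "cis t" z] by simp
  moreover have "1 - cmod z \<le> cmod (cis t - z)" using norm_triangle_ineq2[of "cis t" z] by simp
  ultimately show ?thesis
    unfolding herglotz_kernel_def norm_divide using assms by (intro frac_le) auto
qed

lemma Re_herglotz_kernel:
  assumes "cmod z < 1"
  shows "Re (herglotz_kernel z t) = (1 - (cmod z)\<^sup>2) / (cmod (cis t - z))\<^sup>2"
proof -
  have "Re ((cis t + z) * cnj (cis t - z)) = 1 - (cmod z)\<^sup>2"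
  proof -
    have "Re ((cis t + z) * cnj (cis t - z)) = (cos t)\<^sup>2 + (sin t)\<^sup>2 - ((Re z)\<^sup>2 + (Im z)\<^sup>2)"
      by (simp add: algebra_simps power2_eq_square)
    then show ?thesis by (simp add: cmod_power2)
  qed
  moreover have "herglotz_kernel z t = (cis t + z) * cnj (cis t - z) / of_real ((cmod (cis t - z))\<^sup>2)"
    unfolding herglotz_kernel_def by (rule complex_div_cnj)
  ultimately show ?thesis by (metis Re_divide_of_real)
qed

lemma Re_herglotz_kernel_pos: "cmod z < 1 \<Longrightarrow> Re (herglotz_kernel z t) > 0"
  unfolding Re_herglotz_kernel using cis_minus_nonzero[of z t]
  by (intro divide_pos_pos) (auto simp: power_less_one_iff abs_square_less_1)

lemma cnj_herglotz_kernel: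
  "cnj (herglotz_kernel z t) = (1 + cnj z * cis t) / (1 - cnj z * cis t)"
proof -
  have "cis (-t) * cis t = 1"
    by (simp only: cis_mult) simp
  then have "(cis (-t) + cnj z) * cis t = 1 + cnj z * cis t" "(cis (-t) - cnj z) * cis t = 1 - cnj z * cis t"
    by (simp_all only: distrib_right left_diff_distrib)
  moreover have "cnj (herglotz_kernel z t) = (cis (-t) + cnj z) * cis t / ((cis (-t) - cnj z) * cis t)"
    by (simp only: herglotz_kernel_def complex_cnj_divide complex_cnj_add complex_cnj_diff cis_cnj
        mult_divide_mult_cancel_right[OF cis_neq_zero])
  ultimately show ?thesis by (simp only:)
qed

text \<open>
  At the point \<open>w = e\<^sup>i\<^sup>t\<close> of the circle the conjugate of the kernel is
  \<open>(1 + cnj z * w) / (1 - cnj z * w)\<close>, which is holomorphic beyond the closed disk and equals 1 at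
  the origin. So the conjugate of the integral is a mean value of a holomorphic function.
\<close>

lemma herglotz_formula_antiholomorphic:
  fixes f :: "complex \<Rightarrow> complex"
  assumes hol: "f holomorphic_on ball 0 R" and R: "R > 1" and z: "cmod z < 1"
  shows "(LINT t:{0..2*pi}|lborel. herglotz_kernel z t * cnj (f (cis t))) = 2 * pi * cnj (f 0)"
proof -
  \<comment> \<open>The radius \<open>1 / s\<close> is at most \<open>R\<close> and keeps clear of the pole \<open>1 / cnj z\<close>.\<close>
  define s where "s = max (cmod z) (1 / R)"
  have s: "0 < s" "s < 1" "cmod z \<le> s" "1 / s \<le> R"
  proof -
    show "0 < s" using R by (simp add: s_def less_max_iff_disj)
    show "s < 1" using R z by (simp add: s_def)
    show "cmod z \<le> s" by (simp add: s_def)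
    have "1 / R \<le> s" by (simp add: s_def)
    then show "1 / s \<le> R" using R \<open>0 < s\<close> by (simp add: field_simps)
  qed
  define R' where "R' = 1 / s"
  have R': "R' > 1" "R' \<le> R" using s by (simp_all add: R'_def)
  have nz: "1 - cnj z * w \<noteq> 0" if "w \<in> ball 0 R'" for w
  proof
    assume "1 - cnj z * w = 0"
    then have "cmod z * cmod w = 1" by (metis complex_mod_cnj eq_iff_diff_eq_0 norm_mult norm_one)
    moreover have "cmod z * cmod w \<le> s * cmod w" using s by (intro mult_right_mono) auto
    moreover have "s * cmod w < s * R'" using that s by (intro mult_strict_left_mono) auto
    ultimately show False using s by (simp add: R'_def)
  qed
  have sub: "ball 0 R' \<subseteq> (ball 0 R :: complex set)" using R' by (intro subset_ball)
  have "(\<lambda>w. f w * ((1 + cnj z * w) / (1 - cnj z * w))) holomorphic_on ball 0 R'"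
    by (intro holomorphic_on_mult holomorphic_on_divide holomorphic_on_add holomorphic_on_diff
        holomorphic_on_const holomorphic_on_ident holomorphic_on_subset[OF hol sub] nz)
  from circle_mean_value[OF this R'(1)]
  have "(LINT t:{0..2*pi}|lborel. f (cis t) * cnj (herglotz_kernel z t)) = 2 * pi * f 0"
    by (simp only: cnj_herglotz_kernel mult_zero_right add_0_right diff_zero div_by_1 mult_1_right)
  then have "(LINT t:{0..2*pi}|lborel. cnj (herglotz_kernel z t * cnj (f (cis t)))) = 2 * pi * f 0"
    by (simp only: complex_cnj_mult complex_cnj_cnj mult.commute[of "cnj (herglotz_kernel z _)"])
  moreover have "(LINT t:{0..2*pi}|lborel. cnj (herglotz_kernel z t * cnj (f (cis t)))) =
      cnj (LINT t:{0..2*pi}|lborel. herglotz_kernel z t * cnj (f (cis t)))"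
  proof -
    have "(LINT t:{0..2*pi}|lborel. cnj (herglotz_kernel z t * cnj (f (cis t)))) =
      (LINT t|lborel. cnj (indicator {0..2*pi} t *\<^sub>R (herglotz_kernel z t * cnj (f (cis t)))))"
      unfolding set_lebesgue_integral_def by (simp only: complex_cnj_scaleR)
    also have "\<dots> = cnj (LINT t:{0..2*pi}|lborel. herglotz_kernel z t * cnj (f (cis t)))"
      unfolding set_lebesgue_integral_def by (rule Bochner_Integration.integral_cnj)
    finally show ?thesis .
  qed
  ultimately have "cnj (LINT t:{0..2*pi}|lborel. herglotz_kernel z t * cnj (f (cis t))) = cnj (2 * pi * cnj (f 0))"
    by simp
  then show ?thesis by (simp only: complex_cnj_cancel_iff)
qed

lemma integral_herglotz_kernel:
  assumes "cmod z < 1"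
  shows "(LINT t:{0..2*pi}|lborel. herglotz_kernel z t) = 2 * pi"
proof -
  have "(LINT t:{0..2*pi}|lborel. herglotz_kernel z t * cnj 1) = 2 * pi * cnj 1"
    by (rule herglotz_formula_antiholomorphic[of "\<lambda>_. 1" 2 z]) (use assms in auto)
  then show ?thesis
    by (simp only: complex_cnj_one mult_1_right)
qed

text \<open>
  Subtracting \<open>f z\<close> removes the pole of the kernel at \<open>z\<close>, and the mean value property applies
  to what is left; the subtracted constant meets only the total mass of the kernel.
\<close>

lemma herglotz_formula_holomorphic:
  fixes f :: "complex \<Rightarrow> complex"
  assumes hol: "f holomorphic_on ball 0 R" and R: "R > 1" and z: "cmod z < 1"
  shows "(LINT t:{0..2*pi}|lborel. herglotz_kernel z t * f (cis t)) = 2 * pi * (2 * f z - f 0)"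
proof -
  define q where "q w = (if w = z then deriv f z else (f w - f z) / (w - z))" for w
  have "q holomorphic_on ball 0 R"
    unfolding q_def using hol z R by (intro pole_lemma_open) auto
  then have hol2: "(\<lambda>w. (w + z) * q w) holomorphic_on ball 0 R" 
    by (intro holomorphic_intros)
  have eq1: "(LINT t:{0..2*pi}|lborel. herglotz_kernel z t * (f (cis t) - f z)) = 2 * pi * (f z - f 0)"
  proof -
    have "herglotz_kernel z t * (f (cis t) - f z) = (cis t + z) * q (cis t)" for t
    proof -
      have "cis t \<noteq> z" using cis_minus_nonzero[OF z, of t] by force
      then show ?thesis by (simp add: herglotz_kernel_def q_def)
    qed
    moreover have "z * q 0 = f z - f 0"
    proof (cases "z = 0")
      case False
      then have "q 0 = (f 0 - f z) / (0 - z)" by (simp add: q_def)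
      with False show ?thesis by simp
    qed simp
    ultimately show ?thesis
      using circle_mean_value[OF hol2 R] by (simp only: add_0_left)
  qed
  have eq2: "(LINT t:{0..2*pi}|lborel. herglotz_kernel z t * f z) = 2 * pi * f z"
    using integral_herglotz_kernel[OF z] by simp
  have "(LINT t:{0..2*pi}|lborel. herglotz_kernel z t * f (cis t)) =
     (LINT t:{0..2*pi}|lborel. herglotz_kernel z t * (f (cis t) - f z) + herglotz_kernel z t * f z)"
    by (simp only: distrib_left [symmetric] diff_add_cancel)
  also have "\<dots> = (LINT t:{0..2*pi}|lborel. herglotz_kernel z t * (f (cis t) - f z))
      + (LINT t:{0..2*pi}|lborel. herglotz_kernel z t * f z)"
    by (intro set_integral_add arc_set_integrable continuous_intros continuous_on_circle[OF hol R] z)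
  also have "\<dots> = 2 * pi * (2 * f z - f 0)"
    unfolding eq1 eq2 by (simp add: algebra_simps)
  finally show ?thesis .
qed

text \<open>
  The real part is the half sum of \<open>f\<close> and its conjugate, for which the two preceding formulas
  give \<open>2 f z - f 0\<close> and \<open>cnj (f 0)\<close>.
\<close>

lemma herglotz_formula:
  fixes f :: "complex \<Rightarrow> complex"
  assumes hol: "f holomorphic_on ball 0 R" and R: "R > 1" and z: "cmod z < 1"
  shows "(LINT t:{0..2*pi}|lborel. herglotz_kernel z t * of_real (Re (f (cis t))))
           = 2 * pi * (f z - \<i> * Im (f 0))"
proof -
  note c = continuous_on_circle[OF hol R]
  have eq: "herglotz_kernel z t * of_real (Re (f (cis t))) =
      (herglotz_kernel z t * f (cis t) + herglotz_kernel z t * cnj (f (cis t))) / 2" for t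
  proof -
    have "complex_of_real (Re w) = (w + cnj w) / 2" for w
      by (simp add: complex_add_cnj)
    then show ?thesis
      by (simp only: distrib_left [symmetric] times_divide_eq_right)
  qed
  have "(LINT t:{0..2*pi}|lborel. herglotz_kernel z t * of_real (Re (f (cis t)))) =
      (LINT t:{0..2*pi}|lborel. (herglotz_kernel z t * f (cis t) + herglotz_kernel z t * cnj (f (cis t))) / 2)"
    unfolding eq ..
  also have "\<dots> = ((LINT t:{0..2*pi}|lborel. herglotz_kernel z t * f (cis t)) +
        (LINT t:{0..2*pi}|lborel. herglotz_kernel z t * cnj (f (cis t)))) / 2"
    unfolding set_integral_divide_zero using z c
    by (subst set_integral_add(2)) (intro arc_set_integrable continuous_intros | simp)+
  also have "\<dots> = 2 * pi * (f z - (f 0 - cnj (f 0)) / 2)"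
    unfolding herglotz_formula_holomorphic[OF assms] herglotz_formula_antiholomorphic[OF assms]
    by (simp add: diff_divide_distrib right_diff_distrib distrib_left add_divide_distrib)
  also have "(f 0 - cnj (f 0)) / 2 = \<i> * Im (f 0)"
    by (simp add: complex_diff_cnj)
  finally show ?thesis .
qed

text \<open>
  The kernel is \<open>2 / (1 - z e\<^sup>-\<^sup>i\<^sup>t) - 1\<close>, and integrating the geometric series term by term gives
  a power series in \<open>z\<close>. Allowing an integrable factor \<open>u\<close> covers densities that change sign.
\<close>

lemma holomorphic_herglotz_integral:
  fixes u :: "real \<Rightarrow> complex"
  assumes u: "integrable M u" and sets_M: "sets M = sets borel"
  shows "(\<lambda>z. LINT t|M. herglotz_kernel z t * u t) holomorphic_on ball 0 1"
proof -
  note [measurable_cong] = sets_M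
  have [measurable]: "u \<in> borel_measurable M" using u by simp
  define g where "g z = (LINT t|M. u t / (1 - z * cis (-t)))" for z
  have [measurable]: "cis \<in> borel_measurable borel"
    by (intro borel_measurable_continuous_onI continuous_intros)
  have bound: "cmod (cis (-t) ^ n * u t) \<le> cmod (u t)" for n t
    by (simp add: norm_mult norm_power)
  have int: "integrable M (\<lambda>t. cis (-t) ^ n * u t)" for n
    by (rule Bochner_Integration.integrable_bound[OF u]) (auto simp: bound)
  have sums: "(\<lambda>n. (LINT t|M. cis (-t) ^ n * u t) * z ^ n) sums g z \<and> integrable M (\<lambda>t. u t / (1 - z * cis (-t)))"
    if z: "cmod z < 1" for z
  proof -
    have gs: "(\<lambda>n. z ^ n * (cis (-t) ^ n * u t)) sums (u t / (1 - z * cis (-t)))" for t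
    proof -
      have "(\<lambda>n. u t * (z * cis (-t)) ^ n) sums (u t * (1 / (1 - z * cis (-t))))"
        by (intro sums_mult geometric_sums) (simp add: norm_mult z)
      then show ?thesis by (simp add: power_mult_distrib mult_ac)
    qed
    have n: "norm (z ^ n * (cis (-t) ^ n * u t)) = cmod z ^ n * cmod (u t)" for n t
      by (simp add: norm_mult norm_power)
    have s: "summable (\<lambda>n. cmod z ^ n)" using z by (intro summable_geometric) auto
    have i: "integrable M (\<lambda>t. z ^ n * (cis (-t) ^ n * u t))" for n
      using int by simp
    have ae: "AE t in M. summable (\<lambda>n. norm (z ^ n * (cis (-t) ^ n * u t)))"
      unfolding n using s by (intro AE_I2 summable_mult2)
    have s': "summable (\<lambda>n. LINT t|M. norm (z ^ n * (cis (-t) ^ n * u t)))"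
      unfolding n integral_mult_right_zero by (rule summable_mult2[OF s])
    have eq: "(\<Sum>n. z ^ n * (cis (-t) ^ n * u t)) = u t / (1 - z * cis (-t))" for t
      by (rule sums_unique[symmetric, OF gs])
    have "(\<lambda>n. LINT t|M. z ^ n * (cis (-t) ^ n * u t)) sums g z"
      using sums_integral[OF i ae s'] unfolding eq g_def .
    moreover have "(LINT t|M. z ^ n * (cis (-t) ^ n * u t)) = (LINT t|M. cis (-t) ^ n * u t) * z ^ n" for n
      by (subst integral_mult_right_zero) (rule mult.commute)
    ultimately show ?thesis using integrable_suminf[OF i ae s'] unfolding eq by (simp only: simp_thms)
  qed
  have "g holomorphic_on ball 0 1"
    by (rule power_series_holomorphic[where a="\<lambda>n. LINT t|M. cis (-t) ^ n * u t"]) (use sums in auto)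
  then have "(\<lambda>z. 2 * g z - (LINT t|M. u t)) holomorphic_on ball 0 1"
    by (intro holomorphic_intros)
  moreover have "2 * g z - (LINT t|M. u t) = (LINT t|M. herglotz_kernel z t * u t)" if "z \<in> ball 0 1" for z
  proof -
    have z: "cmod z < 1" using that by simp
    have k: "herglotz_kernel z t * u t = 2 * (u t / (1 - z * cis (-t))) - u t" for t
    proof -
      have c: "cis t * cis (-t) = 1" by (simp only: cis_mult) simp
      have "cis t - z = cis t * (1 - z * cis (-t))"
        by (simp only: right_diff_distrib mult_1_right mult.left_commute[of "cis t"] c)
      moreover have "cis t + z = cis t * (1 + z * cis (-t))"
        by (simp only: distrib_left mult_1_right mult.left_commute[of "cis t"] c)
      ultimately have k1: "herglotz_kernel z t = (1 + z * cis (-t)) / (1 - z * cis (-t))"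
        and nz: "1 - z * cis (-t) \<noteq> 0"
        using cis_minus_nonzero[OF z, of t] by (auto simp: herglotz_kernel_def)
      have "(1 + w) / (1 - w) = 2 / (1 - w) - 1" if "1 - w \<noteq> 0" for w :: complex
        using that by (simp add: divide_simps)
      from this[OF nz] have "herglotz_kernel z t = 2 / (1 - z * cis (-t)) - 1" unfolding k1 .
      then show ?thesis by (simp add: left_diff_distrib)
    qed
    show ?thesis
      unfolding k g_def using conjunct2[OF sums[OF z]] u
      by (subst Bochner_Integration.integral_diff)
        (simp_all only: integrable_mult_right integral_mult_right_zero)
  qed
  ultimately show ?thesis
    by (rule holomorphic_transform)
qed

section \<open>The Poisson majorant\<close>

text \<open>
  The Poisson kernel has mass \<open>2 \<pi>\<close>, and for \<open>z = r \<zeta>\<close> with \<open>r\<close> near 1 it is small away from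
  \<open>\<zeta>\<close>; near \<open>\<zeta>\<close> the function \<open>U\<close> is close to \<open>U \<zeta>\<close>. Uniform continuity of \<open>U\<close> makes this
  uniform in \<open>\<zeta>\<close>.
\<close>

lemma poisson_integral_approx:
  fixes U :: "complex \<Rightarrow> real"
  assumes U: "continuous_on (sphere 0 1) U" and e: "e > 0"
  shows "\<forall>\<^sub>F r in at_left 1. \<forall>\<zeta>\<in>sphere 0 1.
           2 * pi * (U \<zeta> - e) \<le> (LINT t:{0..2*pi}|lborel. Re (herglotz_kernel (of_real r * \<zeta>) t) * U (cis t))"
proof -
  obtain d where d: "d > 0" and unif: "\<And>x y. x \<in> sphere 0 1 \<Longrightarrow> y \<in> sphere 0 1 \<Longrightarrow> dist y x < d \<Longrightarrow> dist (U y) (U x) < e / 2"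
    using compact_uniformly_continuous[OF U] e unfolding uniformly_continuous_on_def
    by (metis compact_sphere half_gt_zero)
  have "bounded (U ` sphere 0 1)"
    by (intro compact_imp_bounded compact_continuous_image U) auto
  then obtain B where B: "B > 0" "\<And>x. x \<in> sphere 0 1 \<Longrightarrow> \<bar>U x\<bar> \<le> B"
    by (auto simp: bounded_pos)
  \<comment> \<open>\<open>1 - r < d / 2\<close> keeps \<open>r \<zeta>\<close> within \<open>d / 2\<close> of \<open>\<zeta>\<close>; the last bound makes the far part at most \<open>e / 2\<close>.\<close>
  define r0 where "r0 = max (1 / 2) (max (1 - d / 2) (1 - e * d\<^sup>2 / (32 * B)))"
  have r0: "r0 < 1" using d e B by (simp add: r0_def)
  have "\<forall>\<^sub>F r in at_left 1. r0 < r \<and> r < 1"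
    using r0 eventually_at_left_field by blast
  then show ?thesis
  proof eventually_elim
    case (elim r)
    then have r: "0 < r" "r < 1" "1 - r < d / 2" "1 - r < e * d\<^sup>2 / (32 * B)"
      by (auto simp: r0_def)
    have small: "(1 - r\<^sup>2) * (8 * B) \<le> e / 2 * d\<^sup>2"
    proof -
      have "1 - r\<^sup>2 = (1 - r) * (1 + r)" by (simp add: power2_eq_square algebra_simps)
      also have "\<dots> \<le> (1 - r) * 2" using r by (intro mult_left_mono) auto
      finally have "(1 - r\<^sup>2) * (8 * B) \<le> (1 - r) * 2 * (8 * B)" using B by (intro mult_right_mono) auto
      also have "\<dots> = (1 - r) * (32 * B) / 2" by simp
      also have "\<dots> \<le> e * d\<^sup>2 / 2" using r(4) B by (intro divide_right_mono) (auto simp: field_simps)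
      finally show ?thesis by simp
    qed
    show ?case
    proof
      fix \<zeta> :: complex assume \<zeta>: "\<zeta> \<in> sphere 0 1"
      define z where "z = of_real r * \<zeta>"
      have z: "cmod z = r" "cmod z < 1" using r \<zeta> by (simp_all add: z_def norm_mult)
      let ?P = "\<lambda>t. Re (herglotz_kernel z t)"
      have cP: "continuous_on A ?P" for A by (intro continuous_intros z)
      have cU: "continuous_on A (\<lambda>t. U (cis t))" for A
        by (rule continuous_on_compose2[OF U]) (auto intro: continuous_intros)
      have tot: "(LINT t:{0..2*pi}|lborel. ?P t) = 2 * pi"
      proof -
        have "(LINT t:{0..2*pi}|lborel. ?P t) = Re (LINT t:{0..2*pi}|lborel. herglotz_kernel z t)"
          unfolding set_lebesgue_integral_def
          using arc_set_integrable[OF continuous_on_herglotz_kernel[OF z(2)]]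
          by (subst integral_Re [symmetric]) (auto simp: set_integrable_def)
        also have "\<dots> = 2 * pi" by (simp only: integral_herglotz_kernel[OF z(2)] Re_complex_of_real)
        finally show ?thesis .
      qed
      have pt: "(U \<zeta> - e / 2) * ?P t - e / 2 \<le> ?P t * U (cis t)" for t
      proof (cases "dist (cis t) \<zeta> < d")
        case True
        then have "\<bar>U (cis t) - U \<zeta>\<bar> < e / 2"
          using unif[of \<zeta> "cis t"] \<zeta> unfolding dist_real_def by simp
        then have "U (cis t) \<ge> U \<zeta> - e / 2"
          unfolding abs_less_iff by linarith
        then have "(U \<zeta> - e / 2) * ?P t \<le> U (cis t) * ?P t"
          using Re_herglotz_kernel_pos[OF z(2), of t] by (intro mult_right_mono) auto
        then show ?thesis using e by (simp add: mult.commute)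
      next
        case False
        have "dist \<zeta> z = 1 - r"
        proof -
          have "\<zeta> - z = of_real (1 - r) * \<zeta>" by (simp add: z_def algebra_simps)
          then show ?thesis using \<zeta> r by (simp add: dist_norm norm_mult del: of_real_diff)
        qed
        then have far: "d / 2 \<le> cmod (cis t - z)"
          using False r dist_triangle[of "cis t" \<zeta> z] by (simp add: dist_norm norm_minus_commute)
        have "?P t \<le> (1 - r\<^sup>2) / (d / 2)\<^sup>2"
          unfolding Re_herglotz_kernel[OF z(2)] z(1) using far d r
          by (intro divide_left_mono power_mono) (auto intro!: mult_pos_pos simp: power_le_one)
        then have "?P t * (2 * B) \<le> (1 - r\<^sup>2) / (d / 2)\<^sup>2 * (2 * B)"
          using B by (intro mult_right_mono) auto
        also have "\<dots> = (1 - r\<^sup>2) * (8 * B) / d\<^sup>2" by (simp add: power_divide)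
        also have "\<dots> \<le> e / 2" using small d by (simp add: field_simps)
        finally have P: "?P t * (2 * B) \<le> e / 2" .
        have "U \<zeta> - e / 2 - U (cis t) \<le> 2 * B"
          using B(2)[of \<zeta>] B(2)[of "cis t"] \<zeta> e by auto
        then have "?P t * (U \<zeta> - e / 2 - U (cis t)) \<le> ?P t * (2 * B)"
          using Re_herglotz_kernel_pos[OF z(2), of t] by (intro mult_left_mono) auto
        then show ?thesis using P by (simp add: algebra_simps)
      qed
      have c: "(LINT t:{0..2*pi}|lborel. e / 2) = pi * e"
        by (simp add: set_lebesgue_integral_def)
      have "2 * pi * (U \<zeta> - e) = (U \<zeta> - e / 2) * (2 * pi) - (LINT t:{0..2*pi}|lborel. e / 2)"
        unfolding c by (simp add: algebra_simps)
      also have "\<dots> = (LINT t:{0..2*pi}|lborel. (U \<zeta> - e / 2) * ?P t - e / 2)"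
        by (subst set_integral_diff(2))
          (use tot in \<open>auto intro!: arc_set_integrable continuous_intros cP\<close>)
      also have "\<dots> \<le> (LINT t:{0..2*pi}|lborel. ?P t * U (cis t))"
        by (intro set_integral_mono arc_set_integrable continuous_intros cP cU pt)
      finally show "2 * pi * (U \<zeta> - e) \<le> (LINT t:{0..2*pi}|lborel. Re (herglotz_kernel (of_real r * \<zeta>) t) * U (cis t))"
        unfolding z_def .
    qed
  qed
qed

text \<open>
  If \<open>\<Phi>\<close> is the holomorphic function whose real part is the Poisson integral of \<open>U\<close>, then
  \<open>g z exp (- \<Phi> (r z))\<close> is bounded by \<open>exp e\<close> on the circle for \<open>r\<close> near 1, hence in the disk by
  the maximum principle; let \<open>r\<close> tend to 1 and \<open>e\<close> to 0. Working with \<open>exp\<close> instead of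
  logarithms, this argument is indifferent to zeros of \<open>g\<close>.
\<close>

lemma poisson_majorant:
  fixes g :: "complex \<Rightarrow> complex" and U :: "complex \<Rightarrow> real"
  assumes cont: "continuous_on (cball 0 1) g" and hol: "g holomorphic_on ball 0 1"
    and U: "continuous_on (sphere 0 1) U"
    and le: "\<And>\<zeta>. cmod \<zeta> = 1 \<Longrightarrow> cmod (g \<zeta>) \<le> exp (U \<zeta>)" and z: "cmod z < 1"
  shows "cmod (g z) \<le> exp ((LINT t:{0..2*pi}|lborel. Re (herglotz_kernel z t) * U (cis t)) / (2*pi))"
proof -
  have cU: "continuous_on A (\<lambda>t. U (cis t))" for A
    by (rule continuous_on_compose2[OF U]) (auto intro: continuous_intros)
  define \<Phi> where "\<Phi> z = (LINT t:{0..2*pi}|lborel. herglotz_kernel z t * of_real (U (cis t))) / of_real (2*pi)" for z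
  have intU: "integrable lborel (\<lambda>t. indicator {0..2*pi} t *\<^sub>R complex_of_real (U (cis t)))"
    using arc_set_integrable[of "\<lambda>t. complex_of_real (U (cis t))"] cU
    by (simp add: set_integrable_def continuous_on_of_real)
  have h\<Phi>: "\<Phi> holomorphic_on ball 0 1"
    unfolding \<Phi>_def set_lebesgue_integral_def
    using holomorphic_herglotz_integral[OF intU] by (intro holomorphic_intros) auto
  have Re\<Phi>: "Re (\<Phi> w) = (LINT t:{0..2*pi}|lborel. Re (herglotz_kernel w t) * U (cis t)) / (2*pi)"
    if w: "cmod w < 1" for w
  proof -
    have "set_integrable lborel {0..2*pi} (\<lambda>t. herglotz_kernel w t * of_real (U (cis t)))"
      by (intro arc_set_integrable continuous_intros cU w)
    then have "Re (LINT t:{0..2*pi}|lborel. herglotz_kernel w t * of_real (U (cis t))) =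
        (LINT t:{0..2*pi}|lborel. Re (herglotz_kernel w t) * U (cis t))"
      unfolding set_lebesgue_integral_def set_integrable_def by (subst integral_Re [symmetric]) auto
    then show ?thesis unfolding \<Phi>_def Re_divide_of_real by simp
  qed
  have "cmod (g z) \<le> exp (e + Re (\<Phi> z))" if e: "e > 0" for e
  proof -
    have lt1: "\<forall>\<^sub>F r::real in at_left 1. 0 < r \<and> r < 1"
      using eventually_at_left_field[of _ "1::real"] zero_less_one by blast
    have ev: "\<forall>\<^sub>F r in at_left 1. cmod (g z) \<le> exp (e + Re (\<Phi> (of_real r * z)))"
      using poisson_integral_approx[OF U e] lt1
    proof eventually_elim
      case (elim r)
      let ?h = "\<lambda>w. g w * exp (- \<Phi> (of_real r * w))"
      have in_ball: "of_real r * w \<in> ball 0 1" if "w \<in> cball 0 1" for w :: complex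
      proof -
        have "r * cmod w \<le> r * 1" using that elim by (intro mult_left_mono) auto
        then have "r * cmod w < 1" using elim by linarith
        then show ?thesis using elim by (simp add: norm_mult)
      qed
      have "cmod (?h z) \<le> exp e"
      proof (rule maximum_modulus_frontier[of ?h "cball 0 1"])
        have "(\<lambda>w. \<Phi> (of_real r * w)) holomorphic_on ball 0 1"
          by (rule holomorphic_on_compose_gen[OF _ h\<Phi>, unfolded o_def])
            (use in_ball in \<open>auto intro!: holomorphic_intros\<close>)
        then show "?h holomorphic_on interior (cball 0 1)"
          using hol by (auto intro!: holomorphic_intros)
        have "continuous_on (cball 0 1) (\<lambda>w. \<Phi> (of_real r * w))"
          by (rule continuous_on_compose2[OF holomorphic_on_imp_continuous_on[OF h\<Phi>]])
            (use in_ball in \<open>auto intro!: continuous_intros\<close>)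
        then show "continuous_on (closure (cball 0 1)) ?h"
          using cont by (auto intro!: continuous_intros)
        fix \<zeta> :: complex assume "\<zeta> \<in> frontier (cball 0 1)"
        then have \<zeta>: "cmod \<zeta> = 1" by simp
        have "2 * pi * (U \<zeta> - e) \<le> 2 * pi * Re (\<Phi> (of_real r * \<zeta>))"
          using elim(1) \<zeta> in_ball[of \<zeta>] by (subst Re\<Phi>) auto
        then have "U \<zeta> \<le> e + Re (\<Phi> (of_real r * \<zeta>))" by simp
        then have "cmod (g \<zeta>) \<le> exp (e + Re (\<Phi> (of_real r * \<zeta>)))"
          using le[OF \<zeta>] by (meson exp_le_cancel_iff order_trans)
        also have "\<dots> = exp e * exp (Re (\<Phi> (of_real r * \<zeta>)))"
          by (rule exp_add)
        finally have "cmod (g \<zeta>) / exp (Re (\<Phi> (of_real r * \<zeta>))) \<le> exp e"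
          by (simp only: pos_divide_le_eq exp_gt_zero)
        then show "cmod (?h \<zeta>) \<le> exp e"
          by (simp add: norm_mult norm_inverse exp_minus divide_inverse)
      qed (use z in auto)
      then have "cmod (g z) / exp (Re (\<Phi> (of_real r * z))) \<le> exp e"
        by (simp add: norm_mult norm_inverse exp_minus divide_inverse)
      then show ?case by (simp only: exp_add pos_divide_le_eq exp_gt_zero)
    qed
    have "((\<lambda>r. of_real r * z) \<longlongrightarrow> of_real 1 * z) (at_left (1::real))"
      by (intro tendsto_intros)
    moreover have "isCont \<Phi> z"
      using h\<Phi> z by (metis centre_in_ball continuous_on_eq_continuous_at holomorphic_on_imp_continuous_on mem_ball_0 open_ball)
    ultimately have "((\<lambda>r. \<Phi> (of_real r * z)) \<longlongrightarrow> \<Phi> z) (at_left (1::real))"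
      using isCont_tendsto_compose[of z \<Phi>] by simp
    then have "((\<lambda>r. exp (e + Re (\<Phi> (of_real r * z)))) \<longlongrightarrow> exp (e + Re (\<Phi> z))) (at_left (1::real))"
      by (intro tendsto_intros)
    from tendsto_lowerbound[OF this ev] show ?thesis by simp
  qed
  then have "\<forall>\<^sub>F e in at_right 0. cmod (g z) \<le> exp (e + Re (\<Phi> z))"
    by (intro eventually_mono[OF eventually_at_right_less[of 0]])
  moreover have "((\<lambda>e. exp (e + Re (\<Phi> z))) \<longlongrightarrow> exp (0 + Re (\<Phi> z))) (at_right 0)"
    by (intro tendsto_intros)
  ultimately have "cmod (g z) \<le> exp (0 + Re (\<Phi> z))"
    by (intro tendsto_lowerbound) auto
  then show ?thesis using Re\<Phi>[OF z] by simp
qed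

section \<open>Weak limits of densities on the circle\<close>

text \<open>
  Measures on the circle live on the parameter interval, as in the definition of singular inner
  functions. The endpoints \<open>0\<close> and \<open>2 \<pi>\<close> are kept apart, so the test functions are not required
  to be periodic.
\<close>

definition arc_weak_limit :: "(nat \<Rightarrow> real \<Rightarrow> real) \<Rightarrow> real measure \<Rightarrow> bool" where
  "arc_weak_limit w \<mu> \<longleftrightarrow>
     finite_measure \<mu> \<and> sets \<mu> = sets borel \<and> emeasure \<mu> (- {0..2*pi}) = 0 \<and>
     (\<forall>\<phi> :: real \<Rightarrow> complex. (\<forall>x. isCont \<phi> x) \<longrightarrow> bounded (range \<phi>) \<longrightarrow>
       (\<lambda>n. LINT t:{0..2*pi}|lborel. w n t *\<^sub>R \<phi> t) \<longlonglongrightarrow> (LINT t|\<mu>. \<phi> t))"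

text \<open>
  Helly's selection theorem speaks of probability measures on the line. The densities are
  therefore completed to total mass \<open>D\<close> by a uniform mass on \<open>[-2, -1]\<close>, away from
  \<open>[0, 2 \<pi>]\<close>, and divided by \<open>D\<close>; a continuous cutoff that is 0 on \<open>[-2, -1]\<close> and 1 on
  \<open>[0, 2 \<pi>]\<close> recovers the part that matters from the limit.
\<close>

lemma arc_measure_weak_limit:
  fixes w :: "nat \<Rightarrow> real \<Rightarrow> real"
  assumes int: "\<And>n. set_integrable lborel {0..2*pi} (w n)"
    and nonneg: "\<And>n t. t \<in> {0..2*pi} \<Longrightarrow> 0 \<le> w n t"
    and mass: "\<And>n. (LINT t:{0..2*pi}|lborel. w n t) \<le> C"
  shows "\<exists>s \<mu>. strict_mono s \<and> arc_weak_limit (\<lambda>n. w (s n)) \<mu>"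
proof -
  define m where "m n = (LINT t:{0..2*pi}|lborel. w n t)" for n
  define D where "D = C + 1"
  have m0: "0 \<le> m n" for n
    unfolding m_def set_lebesgue_integral_def
    by (rule Bochner_Integration.integral_nonneg) (auto simp: indicator_def nonneg)
  have D: "0 < D" "m n < D" for n
    using m0[of 0] mass[of 0] mass[of n] by (auto simp: D_def m_def)
  define u where "u n t = (indicator {0..2*pi} t * w n t + indicator {-2..-1} t * (D - m n)) / D" for n t
  have int_w: "integrable lborel (\<lambda>t. indicator {0..2*pi} t * w n t)" for n
    using int[of n] by (simp add: set_integrable_def)
  have int_u: "integrable lborel (u n)" for n
    unfolding u_def using int_w[of n] by auto
  have [measurable]: "u n \<in> borel_measurable borel" for n using int_u[of n] by auto
  have u0: "0 \<le> u n t" for n t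
    using D(1) D(2)[of n] nonneg[of t n] unfolding u_def by (auto simp: indicator_def)
  have tot: "(LINT t|lborel. u n t) = 1" for n
  proof -
    have "(LINT t|lborel. u n t) = ((LINT t|lborel. indicator {0..2*pi} t * w n t)
        + (LINT t|lborel. indicator {-2..-1::real} t * (D - m n))) / D"
      unfolding u_def using int_w[of n] by simp
    also have "\<dots> = (m n + (D - m n)) / D"
      by (simp add: m_def set_lebesgue_integral_def)
    finally show ?thesis using D by simp
  qed
  define M where "M n = density lborel (\<lambda>t. ennreal (u n t))" for n
  have sets_M [simp]: "sets (M n) = sets borel" "space (M n) = UNIV" for n by (simp_all add: M_def)
  have nn1: "(\<integral>\<^sup>+t. ennreal (u n t) \<partial>lborel) = 1" for n
    by (subst nn_integral_eq_integral) (auto simp: tot int_u u0)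
  have prob: "prob_space (M n)" for n
    by (rule prob_spaceI) (simp add: M_def emeasure_density nn1)
  have dist: "real_distribution (M n)" for n
    using prob by (simp add: real_distribution_def real_distribution_axioms_def)
  have intM: "(LINT t|M n. \<phi> t) = (LINT t|lborel. u n t *\<^sub>R \<phi> t)"
    if "\<phi> \<in> borel_measurable borel" for n and \<phi> :: "real \<Rightarrow> complex"
    unfolding M_def using that u0 by (subst integral_density) auto
  have full: "measure (M n) {-3<..2*pi+1} = 1" for n
  proof -
    have "emeasure (M n) {-3<..2*pi+1} = (\<integral>\<^sup>+t. ennreal (u n t) * indicator {-3<..2*pi+1} t \<partial>lborel)"
      by (simp add: M_def emeasure_density)
    also have "\<dots> = (\<integral>\<^sup>+t. ennreal (u n t) \<partial>lborel)"
    proof (intro nn_integral_cong)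
      fix t :: real
      have "0 < pi" by simp
      then have "t \<in> {0..2*pi} \<or> t \<in> {-2..-1} \<Longrightarrow> t \<in> {-3<..2*pi+1}"
        unfolding atLeastAtMost_iff greaterThanAtMost_iff by linarith
      then show "ennreal (u n t) * indicator {-3<..2*pi+1} t = ennreal (u n t)"
        by (cases "t \<in> {-3<..2*pi+1}") (auto simp: u_def indicator_def)
    qed
    finally show ?thesis by (simp add: nn1 measure_def)
  qed
  have "tight M"
    unfolding tight_def
  proof (intro conjI allI impI dist)
    fix e :: real assume "e > 0"
    then show "\<exists>a b. a < b \<and> (\<forall>n. 1 - e < measure (M n) {a<..b})"
      using full by (intro exI[of _ "-3"] exI[of _ "2*pi+1"]) (auto simp: add_pos_pos less_le_trans[of _ 0])
  qed
  from tight_imp_convergent_subsubsequence[OF this strict_mono_id]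
  obtain s P where s: "strict_mono s" and P: "real_distribution P" and conv: "weak_conv_m (M \<circ> s) P"
    by auto
  interpret P: real_distribution P by fact
  define h :: "real \<Rightarrow> real" where "h t = max 0 (min 1 (t + 1))" for t
  have h: "0 \<le> h t" "h t \<le> 1" for t by (auto simp: h_def)
  have [measurable]: "h \<in> borel_measurable borel" unfolding h_def by measurable
  define \<mu> where "\<mu> = density P (\<lambda>t. ennreal (D * h t))"
  have sets_\<mu>: "sets \<mu> = sets borel" by (simp add: \<mu>_def)
  have fin: "finite_measure \<mu>"
  proof (rule finite_measureI)
    have "emeasure \<mu> (space \<mu>) = (\<integral>\<^sup>+t. ennreal (D * h t) \<partial>P)"
      by (simp add: \<mu>_def emeasure_density)
    also have "\<dots> \<le> (\<integral>\<^sup>+t. ennreal D \<partial>P)"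
      using h D(1) by (intro nn_integral_mono ennreal_leI) (auto simp: mult_left_le)
    also have "\<dots> < \<infinity>" by (simp add: P.emeasure_space_1[simplified])
    finally show "emeasure \<mu> (space \<mu>) \<noteq> \<infinity>" by simp
  qed
  have lim: "(\<lambda>n. LINT t:{0..2*pi}|lborel. w (s n) t *\<^sub>R \<phi> t) \<longlonglongrightarrow> (LINT t|\<mu>. \<phi> t)"
    if cont: "\<And>x. isCont \<phi> x" and bdd: "bounded (range \<phi>)" for \<phi> :: "real \<Rightarrow> complex"
  proof -
    have [measurable]: "\<phi> \<in> borel_measurable borel"
      by (intro borel_measurable_continuous_onI continuous_at_imp_continuous_on ballI cont)
    obtain B where B: "\<And>x. norm (\<phi> x) \<le> B" using bdd by (auto simp: bounded_iff)
    define \<psi> where "\<psi> t = (D * h t) *\<^sub>R \<phi> t" for t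
    have [measurable]: "\<psi> \<in> borel_measurable borel" unfolding \<psi>_def by measurable
    have "(\<lambda>n. LINT t|(M \<circ> s) n. \<psi> t) \<longlonglongrightarrow> (LINT t|P. \<psi> t)"
    proof (rule weak_conv_imp_integral_bdd_continuous_conv[OF _ P conv])
      show "real_distribution ((M \<circ> s) n)" for n by (simp add: dist)
      show "isCont \<psi> x" for x unfolding \<psi>_def h_def by (intro continuous_intros cont)
      show "norm (\<psi> x) \<le> D * B" for x
      proof -
        have "norm (\<psi> x) = D * (h x * norm (\<phi> x))" using h[of x] D(1) by (simp add: \<psi>_def abs_mult)
        also have "\<dots> \<le> D * (1 * B)" using h[of x] D(1) B[of x]
          by (intro mult_left_mono mult_mono) auto
        finally show ?thesis by simp
      qed
    qed
    moreover have "(LINT t|(M \<circ> s) n. \<psi> t) = (LINT t:{0..2*pi}|lborel. w (s n) t *\<^sub>R \<phi> t)" for n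
    proof -
      have "u (s n) t *\<^sub>R \<psi> t = indicator {0..2*pi} t *\<^sub>R (w (s n) t *\<^sub>R \<phi> t)" for t
        using D(1) by (auto simp: u_def \<psi>_def h_def indicator_def)
      then show ?thesis by (simp add: intM set_lebesgue_integral_def)
    qed
    moreover have "(LINT t|P. \<psi> t) = (LINT t|\<mu>. \<phi> t)"
      unfolding \<mu>_def \<psi>_def using h D(1) by (subst integral_density) auto
    ultimately show ?thesis by simp
  qed
  have "emeasure \<mu> (- {0..2*pi}) = 0"
  proof -
    interpret finite_measure \<mu> by fact
    \<comment> \<open>A bounded continuous test function that vanishes exactly on the arc detects mass outside it.\<close>
    define d :: "real \<Rightarrow> real" where "d t = min 1 (infdist t {0..2*pi})" for t
    have contd: "isCont d x" for x unfolding d_def by (intro continuous_intros)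
    have [measurable]: "d \<in> borel_measurable borel"
      by (intro borel_measurable_continuous_onI continuous_at_imp_continuous_on ballI contd)
    have d01: "0 \<le> d t" "d t \<le> 1" for t by (auto simp: d_def infdist_nonneg)
    have d0: "d t = 0 \<longleftrightarrow> t \<in> {0..2*pi}" for t
    proof -
      have "t \<in> {0..2*pi} \<longleftrightarrow> infdist t {0..2*pi} = 0"
        by (rule in_closed_iff_infdist_zero) auto
      then show ?thesis unfolding d_def by (auto simp: min_def)
    qed
    have "(\<lambda>n. LINT t:{0..2*pi}|lborel. w (s n) t *\<^sub>R complex_of_real (d t)) \<longlonglongrightarrow> (LINT t|\<mu>. complex_of_real (d t))"
    proof (rule lim)
      show "isCont (\<lambda>t. complex_of_real (d t)) x" for x by (intro continuous_intros contd)
      show "bounded (range (\<lambda>t. complex_of_real (d t)))"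
        using d01 by (auto simp: bounded_iff intro!: exI[of _ 1])
    qed
    moreover have "(LINT t:{0..2*pi}|lborel. w (s n) t *\<^sub>R complex_of_real (d t)) = 0" for n
    proof -
      have "indicator {0..2*pi} t *\<^sub>R (w (s n) t *\<^sub>R complex_of_real (d t)) = 0" for t
        using d0[of t] by (simp add: indicator_def)
      then show ?thesis unfolding set_lebesgue_integral_def by (simp only: Bochner_Integration.integral_zero)
    qed
    ultimately have "(\<lambda>n. 0) \<longlonglongrightarrow> (LINT t|\<mu>. complex_of_real (d t))"
      by (simp only:)
    then have "(LINT t|\<mu>. complex_of_real (d t)) = 0"
      by (rule LIMSEQ_unique) (rule tendsto_const)
    then have "(LINT t|\<mu>. d t) = 0" by simp
    moreover have "integrable \<mu> d"
      by (rule integrable_const_bound[where B=1]) (use d01 in \<open>auto simp: sets_\<mu> cong: measurable_cong_sets\<close>)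
    ultimately have "AE t in \<mu>. d t = 0"
      by (subst (asm) integral_nonneg_eq_0_iff_AE) (use d01 in auto)
    then have "AE t in \<mu>. t \<in> {0..2*pi}" by (simp add: d0)
    then show ?thesis
      by (subst (asm) AE_iff_measurable[OF _ refl])
        (auto simp: sets_\<mu> sets_eq_imp_space_eq[OF sets_\<mu>] Compl_eq)
  qed
  with s fin sets_\<mu> lim show ?thesis unfolding arc_weak_limit_def by blast
qed

text \<open>
  Above the level \<open>K\<close> a value is controlled by its \<open>p\<close>-th power times the small factor
  \<open>K powr (1 - p)\<close>. This is the uniform integrability of \<open>L\<^sup>p\<close>-bounded families.
\<close>

lemma le_add_powr_divide:
  fixes x K p :: real
  assumes "0 \<le> x" "0 < K" "1 < p"
  shows "x \<le> K + x powr p / K powr (p - 1)"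
proof (cases "x \<le> K")
  case True
  then show ?thesis by (smt (verit) divide_nonneg_nonneg powr_ge_zero)
next
  case False
  then have "x * K powr (p - 1) \<le> x * x powr (p - 1)"
    using assms by (intro mult_left_mono powr_mono2) auto
  also have "\<dots> = x powr p" using False assms by (simp add: powr_diff)
  finally have "x \<le> x powr p / K powr (p - 1)" using assms by (simp add: pos_le_divide_eq)
  then show ?thesis using assms by simp
qed

text \<open>
  An open set \<open>U\<close> of length \<open>\<epsilon>\<close> has limit mass at most \<open>K \<epsilon> + C / K powr (p - 1)\<close> for every
  level \<open>K\<close>: test with continuous functions that increase to the indicator of \<open>U\<close>. Cover a null
  set by a short open set after choosing \<open>K\<close> large.
\<close>

lemma weak_limit_absolutely_continuous:
  fixes w :: "nat \<Rightarrow> real \<Rightarrow> real"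
  assumes cont: "\<And>n. continuous_on {0..2*pi} (w n)"
    and nonneg: "\<And>n t. 0 \<le> w n t"
    and p: "1 < p" and bdd: "\<And>n. (LINT t:{0..2*pi}|lborel. w n t powr p) \<le> C"
    and weak: "arc_weak_limit w \<mu>"
  shows "absolutely_continuous lborel \<mu>"
proof -
  have fin: "finite_measure \<mu>" and sets_\<mu>: "sets \<mu> = sets borel"
    and lim: "\<And>\<phi> :: real \<Rightarrow> complex. (\<And>x. isCont \<phi> x) \<Longrightarrow> bounded (range \<phi>) \<Longrightarrow>
       (\<lambda>n. LINT t:{0..2*pi}|lborel. w n t *\<^sub>R \<phi> t) \<longlonglongrightarrow> (LINT t|\<mu>. \<phi> t)"
    using weak unfolding arc_weak_limit_def by simp_all
  interpret finite_measure \<mu> by fact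
  note [measurable_cong] = sets_\<mu>
  have C: "0 \<le> C"
  proof -
    have "0 \<le> (LINT t:{0..2*pi}|lborel. w 0 t powr p)"
      unfolding set_lebesgue_integral_def by (rule Bochner_Integration.integral_nonneg) auto
    then show ?thesis using bdd[of 0] by linarith
  qed
  have open_bound: "measure \<mu> U \<le> K * \<epsilon> + C / K powr (p - 1)"
    if U: "open U" "emeasure lborel U \<le> ennreal \<epsilon>" "0 \<le> \<epsilon>" and K: "0 < K" for U K \<epsilon>
  proof -
    have [measurable]: "U \<in> sets borel" using U by auto
    have Ufin: "emeasure lborel U < \<infinity>" using U(2) by (simp add: le_less_trans)
    have Ule: "measure lborel U \<le> \<epsilon>"
      using U(2,3) by (simp add: measure_def enn2real_leI)
    have ne: "- U \<noteq> {}"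
    proof
      assume "- U = {}"
      then have "U = UNIV" by blast
      then show False using Ufin by simp
    qed
    define d :: "nat \<Rightarrow> real \<Rightarrow> real" where "d m t = min 1 (real m * infdist t (- U))" for m t
    have contd: "isCont (d m) x" for m x unfolding d_def by (intro continuous_intros)
    have [measurable]: "d m \<in> borel_measurable borel" for m
      by (intro borel_measurable_continuous_onI continuous_at_imp_continuous_on ballI contd)
    have d01: "0 \<le> d m t" "d m t \<le> indicator U t" "d m t \<le> 1" for m t
    proof -
      show "0 \<le> d m t" "d m t \<le> 1" by (auto simp: d_def infdist_nonneg)
      show "d m t \<le> indicator U t" by (cases "t \<in> U") (auto simp: d_def)
    qed
    have bd: "(LINT t|\<mu>. d m t) \<le> K * \<epsilon> + C / K powr (p - 1)" for m
    proof -
      have "(\<lambda>n. LINT t:{0..2*pi}|lborel. w n t *\<^sub>R complex_of_real (d m t)) \<longlonglongrightarrow> (LINT t|\<mu>. complex_of_real (d m t))"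
      proof (rule lim)
        show "isCont (\<lambda>t. complex_of_real (d m t)) x" for x by (intro continuous_intros contd)
        show "bounded (range (\<lambda>t. complex_of_real (d m t)))"
          using d01 by (auto simp: bounded_iff intro!: exI[of _ 1])
      qed
      moreover have "(LINT t:{0..2*pi}|lborel. w n t *\<^sub>R complex_of_real (d m t)) =
          complex_of_real (LINT t:{0..2*pi}|lborel. w n t * d m t)" for n
      proof -
        have "indicator {0..2*pi} t *\<^sub>R (w n t *\<^sub>R complex_of_real (d m t)) =
          complex_of_real (indicator {0..2*pi} t *\<^sub>R (w n t * d m t))" for t
          by (simp add: scaleR_conv_of_real)
        then show ?thesis unfolding set_lebesgue_integral_def by (simp only: integral_complex_of_real)
      qed
      ultimately have "(\<lambda>n. LINT t:{0..2*pi}|lborel. w n t * d m t) \<longlonglongrightarrow> (LINT t|\<mu>. d m t)"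
        by (simp add: tendsto_of_real_iff)
      moreover have "(LINT t:{0..2*pi}|lborel. w n t * d m t) \<le> K * \<epsilon> + C / K powr (p - 1)" for n
      proof -
        have cp: "continuous_on {0..2*pi} (\<lambda>t. w n t powr p)"
          using p nonneg by (intro continuous_on_powr' cont continuous_intros) auto
        have i1: "integrable lborel (\<lambda>t. indicator U t * K)" using Ufin by auto
        have i2: "integrable lborel (\<lambda>t. indicator {0..2*pi} t *\<^sub>R (w n t powr p / K powr (p - 1)))"
          using arc_set_integrable[of "\<lambda>t. w n t powr p / K powr (p - 1)"] cp K
          by (simp add: set_integrable_def continuous_on_divide)
        have "(LINT t:{0..2*pi}|lborel. w n t * d m t) \<le>
          (LINT t|lborel. indicator U t * K + indicator {0..2*pi} t *\<^sub>R (w n t powr p / K powr (p - 1)))"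
          unfolding set_lebesgue_integral_def
        proof (rule integral_mono)
          have "continuous_on {0..2*pi} (d m)" using contd by (simp add: continuous_at_imp_continuous_on)
          then show "integrable lborel (\<lambda>t. indicator {0..2*pi} t *\<^sub>R (w n t * d m t))"
            using arc_set_integrable[of "\<lambda>t. w n t * d m t"] cont
            by (simp add: set_integrable_def continuous_on_mult)
          show "indicator {0..2*pi} t *\<^sub>R (w n t * d m t) \<le>
              indicator U t * K + indicator {0..2*pi} t *\<^sub>R (w n t powr p / K powr (p - 1))" for t
          proof -
            let ?r = "w n t powr p / K powr (p - 1)"
            have r: "0 \<le> ?r" by simp
            have wd: "w n t * d m t \<le> w n t * indicator U t"
              using d01[of m t] nonneg[of n t] by (intro mult_left_mono) auto
            have "w n t \<le> K + ?r" by (rule le_add_powr_divide) (use nonneg K p in auto)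
            with wd r have "w n t * d m t \<le> indicator U t * K + ?r"
            proof (cases "t \<in> U")
              case True
              then have "indicator U t = (1::real)" by simp
              with wd r \<open>w n t \<le> K + ?r\<close> show ?thesis by simp
            next
              case False
              then have "indicator U t = (0::real)" by simp
              with wd have "w n t * d m t \<le> 0" by simp
              then have "w n t * d m t \<le> ?r" using r by (rule order_trans)
              then show ?thesis using \<open>indicator U t = 0\<close> by simp
            qed
            then show ?thesis using r K by (cases "t \<in> {0..2*pi}") (simp_all add: indicator_def)
          qed
        qed (use i1 i2 in auto)
        also have "\<dots> = measure lborel U * K + (LINT t:{0..2*pi}|lborel. w n t powr p) / K powr (p - 1)"
          by (subst Bochner_Integration.integral_add[OF i1 i2])
            (use Ufin in \<open>simp add: set_lebesgue_integral_def\<close>)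
        also have "\<dots> \<le> \<epsilon> * K + C / K powr (p - 1)"
          using Ule K bdd[of n] by (intro add_mono mult_right_mono divide_right_mono) auto
        finally show ?thesis by (simp add: mult.commute)
      qed
      ultimately show ?thesis by (intro LIMSEQ_le_const2) auto
    qed
    have "(\<lambda>m. LINT t|\<mu>. d m t) \<longlonglongrightarrow> (LINT t|\<mu>. indicator U t)"
    proof (rule integral_dominated_convergence[where w="\<lambda>_. 1"])
      show "AE t in \<mu>. (\<lambda>m. d m t) \<longlonglongrightarrow> indicator U t"
      proof (intro AE_I2)
        fix t
        show "(\<lambda>m. d m t) \<longlonglongrightarrow> indicator U t"
        proof (cases "t \<in> U")
          case False
          then show ?thesis by (simp add: d_def)
        next
          case True
          have "infdist t (- U) \<noteq> 0"
            using in_closed_iff_infdist_zero[of "- U" t] U(1) ne True by (auto simp: closed_def)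
          then have pos: "0 < infdist t (- U)" using infdist_nonneg[of t "- U"] by linarith
          then obtain m0 where m0: "1 < real m0 * infdist t (- U)"
            using reals_Archimedean3 by blast
          have "\<forall>\<^sub>F m in sequentially. d m t = 1"
            using eventually_ge_at_top[of m0]
          proof eventually_elim
            case (elim m)
            then have "real m0 * infdist t (- U) \<le> real m * infdist t (- U)"
              using pos by (intro mult_right_mono) auto
            then show ?case using m0 by (simp add: d_def)
          qed
          then show ?thesis using True by (simp add: tendsto_eventually)
        qed
      qed
    qed (use d01 in \<open>auto intro!: AE_I2\<close>)
    then have "(LINT t|\<mu>. indicator U t :: real) \<le> K * \<epsilon> + C / K powr (p - 1)"
      using bd by (intro LIMSEQ_le_const2) auto
    then show ?thesis by simp
  qed
  show ?thesis
    unfolding absolutely_continuous_def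
  proof
    fix N :: "real set" assume "N \<in> null_sets lborel"
    then have N: "N \<in> sets borel" "emeasure lborel N = 0" by auto
    have "measure \<mu> N \<le> e" if e: "e > 0" for e
    proof -
      \<comment> \<open>Chosen so that \<open>C / K powr (p - 1)\<close> is below \<open>e / 2\<close>; \<open>C + 1\<close> makes \<open>K\<close> positive.\<close>
      define K where "K = (2 * (C + 1) / e) powr (1 / (p - 1))"
      have K: "K > 0" and Kp: "K powr (p - 1) = 2 * (C + 1) / e"
        using e C p by (auto simp: K_def powr_powr)
      obtain U where U: "open U" "N \<subseteq> U" "emeasure lborel (U - N) < ennreal (e / (2 * K))"
        using outer_regular_lborel[OF N(1), of "e / (2 * K)"] e K by auto
      have "emeasure lborel U = emeasure lborel (U - N)"
        using U N by (subst emeasure_Diff_null_set) auto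
      then have "measure \<mu> U \<le> K * (e / (2 * K)) + C / K powr (p - 1)"
        using U e K by (intro open_bound) auto
      also have "C / K powr (p - 1) \<le> e / 2"
        unfolding Kp using e C by (simp add: field_simps)
      also have "K * (e / (2 * K)) = e / 2" using K by simp
      finally have "measure \<mu> U \<le> e" by simp
      moreover have "measure \<mu> N \<le> measure \<mu> U"
        using U N by (intro finite_measure_mono) (auto simp: sets_\<mu>)
      ultimately show ?thesis by linarith
    qed
    then have "measure \<mu> N \<le> 0" by (rule field_le_epsilon[of _ 0, simplified])
    then have "emeasure \<mu> N = 0" by (simp add: emeasure_eq_measure measure_nonneg order_antisym)
    then show "N \<in> null_sets \<mu>" using N by (auto simp: sets_\<mu>)
  qed
qed

lemma absolutely_continuous_density:
  assumes fin: "finite_measure \<mu>" and sets_\<mu>: "sets \<mu> = sets borel" and ac: "absolutely_continuous lborel \<mu>"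
  obtains v :: "real \<Rightarrow> real" where "\<And>t. 0 \<le> v t" "integrable lborel v" "\<mu> = density lborel (\<lambda>t. ennreal (v t))"
proof -
  obtain v where v: "v \<in> borel_measurable lborel" "AE x in lborel. RN_deriv lborel \<mu> x = ennreal (v x)" "\<And>x. 0 \<le> v x"
    using sigma_finite_measure.real_RN_deriv[OF sigma_finite_lborel fin ac] sets_\<mu>
    by (metis sets_lborel)
  have eq: "\<mu> = density lborel (\<lambda>t. ennreal (v t))"
  proof -
    have "\<mu> = density lborel (RN_deriv lborel \<mu>)"
      using sigma_finite_measure.density_RN_deriv[OF sigma_finite_lborel ac] sets_\<mu> by simp
    also have "\<dots> = density lborel (\<lambda>t. ennreal (v t))"
      by (rule density_cong) (use v in auto)
    finally show ?thesis .
  qed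
  have "(\<integral>\<^sup>+t. ennreal (v t) \<partial>lborel) = emeasure (density lborel (\<lambda>t. ennreal (v t))) UNIV"
    using v by (simp add: emeasure_density)
  also have "\<dots> = emeasure \<mu> (space \<mu>)"
    by (simp only: eq[symmetric] sets_eq_imp_space_eq[OF sets_\<mu>] space_borel)
  also have "\<dots> < \<infinity>" using finite_measure.emeasure_finite[OF fin] by (simp add: top.not_eq_extremum)
  finally have "integrable lborel v"
    using v by (intro integrableI_nonneg) auto
  with v eq show thesis by (intro that)
qed

text \<open>
  Take a null set \<open>N\<close> whose measure is maximal among null sets; it exists because null sets are
  closed under countable unions. A null set outside \<open>N\<close> of positive measure could be added to
  \<open>N\<close>, so none exists.
\<close>

lemma lebesgue_decomposition_null_set:
  fixes \<mu> :: "real measure"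
  assumes fin: "finite_measure \<mu>" and sets_\<mu>: "sets \<mu> = sets borel"
  obtains N where "N \<in> null_sets lborel" "absolutely_continuous lborel (density \<mu> (indicator (- N)))"
proof -
  interpret finite_measure \<mu> by fact
  note [measurable_cong] = sets_\<mu>
  define s where "s = (SUP N\<in>null_sets lborel. measure \<mu> N)"
  have bdd: "bdd_above (measure \<mu> ` null_sets lborel)"
    by (auto intro!: bdd_aboveI[of _ "measure \<mu> (space \<mu>)"] bounded_measure)
  have "\<exists>N\<in>null_sets lborel. s - 1 / real (Suc n) < measure \<mu> N" for n
    unfolding s_def using bdd by (subst less_cSUP_iff[symmetric]) (auto intro: exI[of _ "{}"])
  then obtain A where A: "\<And>n. A n \<in> null_sets lborel" "\<And>n. s - 1 / real (Suc n) < measure \<mu> (A n)"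
    by metis
  define N where "N = (\<Union>n. A n)"
  have N: "N \<in> null_sets lborel" unfolding N_def using A by (intro null_sets_UN) auto
  then have Nb [measurable]: "N \<in> sets borel" by auto
  have "s \<le> measure \<mu> N"
  proof (rule field_le_epsilon)
    fix e :: real assume "e > 0"
    then obtain n where n: "1 / real (Suc n) < e" using nat_approx_posE by blast
    have "measure \<mu> (A n) \<le> measure \<mu> N"
      using Nb by (intro finite_measure_mono) (auto simp: N_def sets_\<mu>)
    then show "s \<le> measure \<mu> N + e" using A(2)[of n] n by linarith
  qed
  have "absolutely_continuous lborel (density \<mu> (indicator (- N)))"
    unfolding absolutely_continuous_def
  proof
    fix E :: "real set" assume E: "E \<in> null_sets lborel"
    then have Eb [measurable]: "E \<in> sets borel" by auto
    have "measure \<mu> (N \<union> (E - N)) \<le> s"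
      unfolding s_def using N E by (intro cSUP_upper bdd) auto
    moreover have "measure \<mu> (N \<union> (E - N)) = measure \<mu> N + measure \<mu> (E - N)"
      by (rule finite_measure_Union) (auto simp: sets_\<mu>)
    ultimately have "measure \<mu> (E - N) = 0" using \<open>s \<le> measure \<mu> N\<close> measure_nonneg[of \<mu> "E - N"] by linarith
    then have "emeasure \<mu> (E - N) = 0" by (simp add: emeasure_eq_measure)
    moreover have "emeasure (density \<mu> (indicator (- N))) E = emeasure \<mu> (E - N)"
      by (subst emeasure_density) (auto simp: indicator_inter_arith[symmetric] Diff_eq Int_commute simp flip: nn_integral_indicator
          intro!: nn_integral_cong split: split_indicator)
    ultimately show "E \<in> null_sets (density \<mu> (indicator (- N)))"
      by (auto simp: sets_\<mu>)
  qed
  with N show thesis by (rule that)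
qed

lemma arc_density:
  assumes fin: "finite_measure \<mu>" and sets_\<mu>: "sets \<mu> = sets borel" and ac: "absolutely_continuous lborel \<mu>"
    and supp: "emeasure \<mu> (- {0..2*pi}) = 0"
  obtains v :: "real \<Rightarrow> real" where "\<And>t. 0 \<le> v t" "set_integrable lborel {0..2*pi} v"
    "\<And>\<phi> :: real \<Rightarrow> complex. \<phi> \<in> borel_measurable borel \<Longrightarrow>
       (LINT t|\<mu>. \<phi> t) = (LINT t:{0..2*pi}|lborel. \<phi> t * of_real (v t))"
proof -
  obtain v where v: "\<And>t. 0 \<le> v t" "integrable lborel v" "\<mu> = density lborel (\<lambda>t. ennreal (v t))"
    using absolutely_continuous_density[OF fin sets_\<mu> ac] by blast
  have [measurable]: "v \<in> borel_measurable borel" using v(2) by simp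
  have "set_integrable lborel {0..2*pi} v"
    unfolding set_integrable_def using v(2) by (intro integrable_mult_indicator) auto
  moreover have "(LINT t|\<mu>. \<phi> t) = (LINT t:{0..2*pi}|lborel. \<phi> t * of_real (v t))"
    if [measurable]: "\<phi> \<in> borel_measurable borel" for \<phi> :: "real \<Rightarrow> complex"
  proof -
    have "AE t in \<mu>. t \<in> {0..2*pi}"
      by (rule AE_I[where N = "- {0..2*pi}"]) (use supp in \<open>auto simp: sets_\<mu>\<close>)
    then have "(LINT t|\<mu>. \<phi> t) = (LINT t|\<mu>. indicator {0..2*pi} t *\<^sub>R \<phi> t)"
      by (intro integral_cong_AE) (auto simp: sets_\<mu> cong: measurable_cong_sets)
    also have "\<dots> = (LINT t|lborel. v t *\<^sub>R (indicator {0..2*pi} t *\<^sub>R \<phi> t))"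
      unfolding v(3) by (subst integral_density) (use v(1) in auto)
    also have "\<dots> = (LINT t:{0..2*pi}|lborel. \<phi> t * of_real (v t))"
      unfolding set_lebesgue_integral_def
      by (intro Bochner_Integration.integral_cong refl) (simp add: scaleR_conv_of_real mult_ac)
    finally show ?thesis .
  qed
  ultimately show thesis using that v(1) by blast
qed

section \<open>Zeros of holomorphic functions\<close>

lemma zorder_mult_nonzero:
  assumes f: "f holomorphic_on S" and g: "g holomorphic_on S" and S: "open S" "connected S" "z \<in> S"
    and nz: "\<exists>w\<in>S. f w \<noteq> 0" and gz: "g z \<noteq> 0"
  shows "zorder (\<lambda>w. f w * g w) z = zorder f z"
proof -
  note ex = zorder_exist_zero[OF f S nz]
  from conjunct2[OF ex] obtain r where r: "r > 0" "cball z r \<subseteq> S"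
      "zor_poly f z holomorphic_on cball z r"
      and eq: "\<And>w. w \<in> cball z r \<Longrightarrow> f w = zor_poly f z w * (w - z) ^ nat (zorder f z) \<and> zor_poly f z w \<noteq> 0"
    by blast
  have n: "zorder f z \<ge> 0" using conjunct1[OF ex] by (simp split: if_splits)
  show ?thesis
  proof (rule zorder_eqI[where S = "ball z r" and g = "\<lambda>w. zor_poly f z w * g w"])
    have "ball z r \<subseteq> cball z r" "ball z r \<subseteq> S" using r by auto
    then show "(\<lambda>w. zor_poly f z w * g w) holomorphic_on ball z r"
      using r(3) g by (intro holomorphic_intros) (auto intro: holomorphic_on_subset)
    show "zor_poly f z z * g z \<noteq> 0" using eq[of z] r(1) gz by auto
    show "f w * g w = zor_poly f z w * g w * (w - z) powi zorder f z" if "w \<in> ball z r" "w \<noteq> z" for w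
      using eq[of w] that n by (simp add: power_int_def)
  qed (use r in auto)
qed

lemma factor_zero_at_point:
  assumes f: "f holomorphic_on S" and S: "open S" "connected S" "z \<in> S" and nz: "\<exists>w\<in>S. f w \<noteq> 0"
  obtains h where "h holomorphic_on S" "h z \<noteq> 0" "\<And>w. w \<in> S \<Longrightarrow> f w = (w - z) ^ nat (zorder f z) * h w"
proof -
  define n where "n = nat (zorder f z)"
  from conjunct2[OF zorder_exist_zero[OF f S nz]] obtain r where r: "r > 0" "cball z r \<subseteq> S"
      "zor_poly f z holomorphic_on cball z r"
      and eq: "\<And>w. w \<in> cball z r \<Longrightarrow> f w = zor_poly f z w * (w - z) ^ n \<and> zor_poly f z w \<noteq> 0"
    unfolding n_def by blast
  define h where "h w = (if w \<in> ball z r then zor_poly f z w else f w / (w - z) ^ n)" for w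
  have h_eq: "f w = (w - z) ^ n * h w" if "w \<in> S" for w
    using eq[of w] r(1) by (cases "w = z") (auto simp: h_def)
  have "h holomorphic_on ball z r"
    by (rule holomorphic_transform[of "zor_poly f z"])
      (use r(3) in \<open>auto simp: h_def intro: holomorphic_on_subset\<close>)
  moreover have "h holomorphic_on S - {z}"
  proof (rule holomorphic_transform)
    show "(\<lambda>w. f w / (w - z) ^ n) holomorphic_on S - {z}"
      using f by (intro holomorphic_intros) (auto intro: holomorphic_on_subset)
    show "f w / (w - z) ^ n = h w" if "w \<in> S - {z}" for w
      using h_eq[of w] that by simp
  qed
  ultimately have "h holomorphic_on ball z r \<union> (S - {z})"
    using S by (intro holomorphic_on_Un) auto
  moreover have "S \<subseteq> ball z r \<union> (S - {z})" using r by auto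
  ultimately have "h holomorphic_on S" by (rule holomorphic_on_subset)
  moreover have "h z \<noteq> 0" using eq[of z] r(1) by (simp add: h_def)
  ultimately show thesis using h_eq unfolding n_def by (rule that)
qed

text \<open>
  One zero at a time: dividing by the factors already split off leaves the order at the next
  point unchanged.
\<close>

lemma factor_finite_zeros:
  assumes f: "f holomorphic_on S" and S: "open S" "connected S" and nz: "\<exists>w\<in>S. f w \<noteq> 0"
    and A: "finite A" "A \<subseteq> S"
  shows "\<exists>h. h holomorphic_on S \<and> (\<forall>a\<in>A. h a \<noteq> 0) \<and>
           (\<forall>w\<in>S. f w = (\<Prod>a\<in>A. (w - a) ^ nat (zorder f a)) * h w)"
  using A
proof (induction A rule: finite_induct)
  case empty
  then show ?case using f by (intro exI[of _ f]) auto
next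
  case (insert b A)
  then obtain h where h: "h holomorphic_on S" "\<And>a. a \<in> A \<Longrightarrow> h a \<noteq> 0"
      "\<And>w. w \<in> S \<Longrightarrow> f w = (\<Prod>a\<in>A. (w - a) ^ nat (zorder f a)) * h w"
    by auto
  have b: "b \<in> S" using insert by auto
  define Q where "Q w = (\<Prod>a\<in>A. (w - a) ^ nat (zorder f a))" for w
  have Q: "Q holomorphic_on S" unfolding Q_def by (intro holomorphic_intros)
  have Qb: "Q b \<noteq> 0" using insert by (auto simp: Q_def)
  have nzh: "\<exists>w\<in>S. h w \<noteq> 0" using nz h(3) by auto
  have "zorder h b = zorder (\<lambda>w. h w * Q w) b"
    by (rule zorder_mult_nonzero[symmetric, OF h(1) Q S b nzh Qb])
  also have "\<dots> = zorder f b"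
  proof (rule zorder_cong)
    show "\<forall>\<^sub>F w in at b. h w * Q w = f w"
      using eventually_at_in_open'[OF S(1) b] by eventually_elim (simp add: h(3) Q_def)
  qed auto
  finally have ord: "zorder h b = zorder f b" .
  obtain k where k: "k holomorphic_on S" "k b \<noteq> 0" "\<And>w. w \<in> S \<Longrightarrow> h w = (w - b) ^ nat (zorder h b) * k w"
    using factor_zero_at_point[OF h(1) S b nzh] by blast
  have "k a \<noteq> 0" if "a \<in> A" for a
    using h(2)[OF that] k(3)[of a] that insert.prems by auto
  with k insert.hyps show ?case
    by (intro exI[of _ k]) (auto simp: h(3) ord mult_ac)
qed

section \<open>Blaschke products\<close>

text \<open>
  The function \<open>G\<close> need not extend to the circle, so the maximum principle is applied on circles
  of radius close to 1, where \<open>P\<close> is close to modulus 1 by uniform continuity.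
\<close>

lemma norm_bound_of_unimodular_quotient:
  assumes P: "continuous_on (cball 0 1) P" "\<And>z. cmod z = 1 \<Longrightarrow> cmod (P z) = 1"
    and G: "G holomorphic_on ball 0 1" and le: "\<And>z. cmod z < 1 \<Longrightarrow> cmod (P z * G z) \<le> M"
    and z: "cmod z < 1"
  shows "cmod (G z) \<le> M"
proof -
  have M: "0 \<le> M" using le[OF z] norm_ge_zero order_trans by blast
  have bound: "(1 - e) * cmod (G z) \<le> M" if e: "0 < e" "e < 1" for e
  proof -
    have "uniformly_continuous_on (cball 0 1) P"
      using P(1) by (intro compact_uniformly_continuous) auto
    then obtain d where d: "d > 0" "\<And>x y. x \<in> cball 0 1 \<Longrightarrow> y \<in> cball 0 1 \<Longrightarrow> dist y x < d \<Longrightarrow> dist (P y) (P x) < e"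
      using e unfolding uniformly_continuous_on_def by metis
    define r where "r = (max (cmod z) (max (1 - d) 0) + 1) / 2"
    have r: "cmod z < r" "1 - d < r" "0 < r" "r < 1"
      using z d by (auto simp: r_def field_simps)
    have "cmod (G z) \<le> M / (1 - e)"
    proof (rule maximum_modulus_frontier[of G "cball 0 r"])
      have "cball 0 r \<subseteq> ball (0::complex) 1" "interior (cball 0 r) \<subseteq> ball (0::complex) 1" using r by auto
      then show "G holomorphic_on interior (cball 0 r)" "continuous_on (closure (cball 0 r)) G"
        using G by (auto intro: holomorphic_on_subset holomorphic_on_imp_continuous_on)
      fix x :: complex assume "x \<in> frontier (cball 0 r)"
      then have x: "cmod x = r" using r by simp
      define y where "y = x / of_real r"
      have y: "cmod y = 1" using x r by (simp add: y_def norm_divide)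
      have "dist x y < d"
      proof -
        have "x - y = of_real (r - 1) * y" using r by (simp add: y_def field_simps)
        then have "dist x y = \<bar>r - 1\<bar>" unfolding dist_norm by (simp only: norm_mult y norm_of_real mult_1_right)
        then show ?thesis using r by linarith
      qed
      then have "dist (P x) (P y) < e" using d(2)[of y x] x y r by simp
      then have "1 - e \<le> cmod (P x)"
        using P(2)[OF y] norm_triangle_ineq2[of "P y" "P x"] by (simp add: dist_norm norm_minus_commute)
      then have "(1 - e) * cmod (G x) \<le> cmod (P x) * cmod (G x)" by (intro mult_right_mono) auto
      also have "\<dots> \<le> M" using le[of x] x r by (simp add: norm_mult)
      finally show "cmod (G x) \<le> M / (1 - e)" using e by (simp add: field_simps)
    qed (use r in auto)
    then show ?thesis using e by (simp add: field_simps)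
  qed
  have "\<forall>\<^sub>F e in at_right (0::real). 0 < e \<and> e < 1"
    using eventually_at_right_field[of _ "0::real"] zero_less_one by blast
  then have "\<forall>\<^sub>F e in at_right 0. (1 - e) * cmod (G z) \<le> M"
    by eventually_elim (use bound in auto)
  moreover have "((\<lambda>e. (1 - e) * cmod (G z)) \<longlongrightarrow> (1 - 0) * cmod (G z)) (at_right 0)"
    by (intro tendsto_intros)
  ultimately show ?thesis using tendsto_upperbound[of "\<lambda>e. (1 - e) * cmod (G z)"] by force
qed

lemma one_minus_cnj_mult_nonzero:
  assumes "cmod a < 1" "cmod z \<le> 1"
  shows "1 - cnj a * z \<noteq> 0"
proof
  assume "1 - cnj a * z = 0"
  then have "cmod a * cmod z = 1" by (metis complex_mod_cnj eq_iff_diff_eq_0 norm_mult norm_one)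
  moreover have "cmod a * cmod z \<le> cmod a * 1" using assms by (intro mult_left_mono) auto
  ultimately show False using assms by linarith
qed

lemma norm_blaschke_factor_identity:
  "(cmod (1 - cnj a * z))\<^sup>2 - (cmod (a - z))\<^sup>2 = (1 - (cmod a)\<^sup>2) * (1 - (cmod z)\<^sup>2)"
  unfolding cmod_power2 by (simp add: algebra_simps power2_eq_square)

lemma norm_blaschke_factor:
  assumes "a \<noteq> 0"
  shows "cmod (blaschke_factor a z) = cmod (a - z) / cmod (1 - cnj a * z)"
  using assms by (simp add: blaschke_factor_def norm_mult norm_divide)

lemma norm_blaschke_factor_le_1:
  assumes "a \<noteq> 0" "cmod a < 1" "cmod z \<le> 1"
  shows "cmod (blaschke_factor a z) \<le> 1"
proof -
  have "0 \<le> (1 - (cmod a)\<^sup>2) * (1 - (cmod z)\<^sup>2)"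
    using assms by (intro mult_nonneg_nonneg) (auto simp: abs_square_le_1 power_le_one)
  then have "(cmod (a - z))\<^sup>2 \<le> (cmod (1 - cnj a * z))\<^sup>2"
    using norm_blaschke_factor_identity[of a z] by linarith
  then have "cmod (a - z) \<le> cmod (1 - cnj a * z)" by (rule power2_le_imp_le) simp
  then show ?thesis using assms one_minus_cnj_mult_nonzero[of a z] by (simp add: norm_blaschke_factor)
qed

lemma norm_blaschke_factor_circle:
  assumes "a \<noteq> 0" "cmod a < 1" "cmod z = 1"
  shows "cmod (blaschke_factor a z) = 1"
proof -
  have "(cmod (1 - cnj a * z))\<^sup>2 = (cmod (a - z))\<^sup>2"
    using norm_blaschke_factor_identity[of a z] assms by simp
  then have "cmod (1 - cnj a * z) = cmod (a - z)" by (rule power2_eq_imp_eq) auto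
  moreover have "cmod (1 - cnj a * z) \<noteq> 0" using assms one_minus_cnj_mult_nonzero[of a z] by simp
  ultimately show ?thesis unfolding norm_blaschke_factor[OF assms(1)] by (metis divide_self)
qed

text \<open>
  The rate \<open>1 - \<bar>a\<bar>\<close> is what turns the Blaschke condition into convergence of the product.
\<close>

lemma norm_one_minus_blaschke_factor:
  assumes a: "a \<noteq> 0" "cmod a < 1" and z: "cmod z < 1"
  shows "cmod (1 - blaschke_factor a z) \<le> 2 / (1 - cmod z) * (1 - cmod a)"
proof -
  have nz: "1 - cnj a * z \<noteq> 0" using one_minus_cnj_mult_nonzero[of a z] assms by simp
  have "a * (1 - cnj a * z) - of_real (cmod a) * (a - z) = of_real (1 - cmod a) * (a + of_real (cmod a) * z)"
  proof -
    have "a * cnj a = of_real (cmod a) * of_real (cmod a)"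
      by (metis complex_norm_square power2_eq_square of_real_mult)
    then have "a * (cnj a * z) = of_real (cmod a) * (of_real (cmod a) * z)" by (metis mult.assoc)
    then have "a * (1 - cnj a * z) = a - of_real (cmod a) * (of_real (cmod a) * z)"
      by (simp only: right_diff_distrib mult_1_right)
    then show ?thesis by (simp only:) (simp add: algebra_simps)
  qed
  then have eq: "1 - blaschke_factor a z = of_real (1 - cmod a) * (a + of_real (cmod a) * z) / (a * (1 - cnj a * z))"
    using a nz by (simp add: blaschke_factor_def divide_simps)
  have "cmod (a + of_real (cmod a) * z) \<le> cmod a + cmod a * cmod z"
    using norm_triangle_ineq[of a "of_real (cmod a) * z"] by (simp add: norm_mult)
  also have "\<dots> \<le> cmod a * 2" using z by (simp add: algebra_simps mult_left_le)
  finally have num: "cmod (a + of_real (cmod a) * z) \<le> cmod a * 2" .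
  have "cmod a * cmod z \<le> 1 * cmod z" using a by (intro mult_right_mono) auto
  then have den: "1 - cmod z \<le> cmod (1 - cnj a * z)"
    using norm_triangle_ineq2[of 1 "cnj a * z"] by (simp add: norm_mult)
  have "cmod (1 - blaschke_factor a z) = (1 - cmod a) * cmod (a + of_real (cmod a) * z) / (cmod a * cmod (1 - cnj a * z))"
    unfolding eq norm_divide norm_mult norm_of_real using a by simp
  also have "\<dots> \<le> (1 - cmod a) * (cmod a * 2) / (cmod a * (1 - cmod z))"
    using a z num den by (intro frac_le mult_left_mono mult_nonneg_nonneg mult_pos_pos) auto
  also have "\<dots> = 2 / (1 - cmod z) * (1 - cmod a)" using a by simp
  finally show ?thesis .
qed

text \<open>
  The finite subproducts in the definition of \<open>blaschke_product\<close>.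
\<close>

definition finite_blaschke :: "(complex \<Rightarrow> complex) \<Rightarrow> complex set \<Rightarrow> complex \<Rightarrow> complex" where
  "finite_blaschke f A z = (\<Prod>a\<in>A. blaschke_factor a z ^ nat (zorder f a))"

lemma norm_finite_blaschke_le_1:
  assumes "\<And>a. a \<in> A \<Longrightarrow> a \<noteq> 0 \<and> cmod a < 1" "cmod z \<le> 1"
  shows "cmod (finite_blaschke f A z) \<le> 1"
  unfolding finite_blaschke_def prod_norm[symmetric] norm_power
  by (intro prod_le_1 conjI power_le_one zero_le_power norm_ge_zero norm_blaschke_factor_le_1)
    (use assms in auto)

text \<open>
  A linear factor \<open>z - a\<close> differs from the Blaschke factor of \<open>a\<close> only by a zero-free function, so
  splitting off the zeros in \<open>A\<close> leaves a holomorphic quotient. The product has modulus 1 on the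
  circle, which is why the quotient obeys the same bound as \<open>f\<close>.
\<close>

lemma divide_by_finite_blaschke:
  assumes f: "f holomorphic_on ball 0 1" and nz: "\<exists>w\<in>ball 0 1. f w \<noteq> 0"
    and le: "\<And>z. cmod z < 1 \<Longrightarrow> cmod (f z) \<le> M"
    and A: "finite A" "\<And>a. a \<in> A \<Longrightarrow> a \<noteq> 0 \<and> cmod a < 1"
  shows "\<exists>G. G holomorphic_on ball 0 1 \<and> (\<forall>a\<in>A. G a \<noteq> 0) \<and>
    (\<forall>z. cmod z < 1 \<longrightarrow> f z = finite_blaschke f A z * G z \<and> cmod (G z) \<le> M)"
proof -
  have "A \<subseteq> ball 0 1" using A by auto
  from factor_finite_zeros[OF f _ _ nz A(1) this] obtain h where
    h: "h holomorphic_on ball 0 1" "\<And>a. a \<in> A \<Longrightarrow> h a \<noteq> 0"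
       "\<And>w. cmod w < 1 \<Longrightarrow> f w = (\<Prod>a\<in>A. (w - a) ^ nat (zorder f a)) * h w" by auto
  define q where "q z = (\<Prod>a\<in>A. ((- a / of_real (cmod a)) * (1 - cnj a * z)) ^ nat (zorder f a))" for z
  have fac: "z - a = blaschke_factor a z * ((- a / of_real (cmod a)) * (1 - cnj a * z))"
    if "a \<in> A" "cmod z \<le> 1" for a z
    using A(2)[OF that(1)] one_minus_cnj_mult_nonzero[of a z] that
    by (simp add: blaschke_factor_def)
  have eq: "f z = finite_blaschke f A z * (q z * h z)" if "cmod z < 1" for z
  proof -
    have "(\<Prod>a\<in>A. (z - a) ^ nat (zorder f a)) = finite_blaschke f A z * q z"
      unfolding finite_blaschke_def q_def prod.distrib[symmetric] power_mult_distrib[symmetric]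
      by (intro prod.cong refl arg_cong[where f="\<lambda>x. x ^ _"] fac) (use that in auto)
    then show ?thesis using h(3)[OF that] by simp
  qed
  have hol: "(\<lambda>z. q z * h z) holomorphic_on ball 0 1"
    unfolding q_def by (intro holomorphic_intros h(1))
  have "q a * h a \<noteq> 0" if "a \<in> A" for a
    using h(2)[OF that] one_minus_cnj_mult_nonzero[of _ a] A that by (fastforce simp: q_def)
  moreover have "cmod (q z * h z) \<le> M" if "cmod z < 1" for z
  proof (rule norm_bound_of_unimodular_quotient[OF _ _ hol _ that])
    show "continuous_on (cball 0 1) (finite_blaschke f A)"
      unfolding finite_blaschke_def blaschke_factor_def
      using A one_minus_cnj_mult_nonzero by (intro continuous_intros) auto
    show "cmod (finite_blaschke f A x) = 1" if "cmod x = 1" for x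
      unfolding finite_blaschke_def prod_norm[symmetric] norm_power
      using A that by (simp add: norm_blaschke_factor_circle)
    show "cmod (finite_blaschke f A x * (q x * h x)) \<le> M" if "cmod x < 1" for x
      using le[OF that] eq[OF that] by simp
  qed
  ultimately show ?thesis using hol eq by blast
qed

text \<open>
  Evaluate the division at the origin: a Blaschke factor has modulus \<open>\<bar>a\<bar> \<le> exp (- (1 - \<bar>a\<bar>))\<close>
  there, so \<open>\<bar>f 0\<bar> \<le> M exp (- s)\<close> for the sum \<open>s\<close> on the left. This replaces Jensen's formula.
\<close>

lemma blaschke_condition:
  assumes f: "f holomorphic_on ball 0 1" and f0: "f 0 \<noteq> 0"
    and le: "\<And>z. cmod z < 1 \<Longrightarrow> cmod (f z) \<le> M"
    and A: "finite A" "\<And>a. a \<in> A \<Longrightarrow> a \<noteq> 0 \<and> cmod a < 1"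
  shows "(\<Sum>a\<in>A. real (nat (zorder f a)) * (1 - cmod a)) \<le> ln (M / cmod (f 0))"
proof -
  have nz: "\<exists>w\<in>ball 0 1. f w \<noteq> 0" using f0 by (intro bexI[of _ 0]) auto
  obtain G where "\<forall>z. cmod z < 1 \<longrightarrow> f z = finite_blaschke f A z * G z \<and> cmod (G z) \<le> M"
    using divide_by_finite_blaschke[OF f nz le A] by blast
  then have G: "f 0 = finite_blaschke f A 0 * G 0" "cmod (G 0) \<le> M"
    by simp_all
  have "cmod (finite_blaschke f A 0) = (\<Prod>a\<in>A. cmod a ^ nat (zorder f a))"
    unfolding finite_blaschke_def prod_norm[symmetric] norm_power
    using A by (intro prod.cong refl) (simp add: norm_blaschke_factor)
  also have "\<dots> \<le> (\<Prod>a\<in>A. exp (- (real (nat (zorder f a)) * (1 - cmod a))))"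
  proof (intro prod_mono conjI zero_le_power norm_ge_zero)
    fix a
    have "cmod a ^ nat (zorder f a) \<le> exp (- (1 - cmod a)) ^ nat (zorder f a)"
      using exp_ge_add_one_self[of "- (1 - cmod a)"] by (intro power_mono) auto
    then show "cmod a ^ nat (zorder f a) \<le> exp (- (real (nat (zorder f a)) * (1 - cmod a)))"
      by (simp only: exp_of_nat_mult[symmetric] mult_minus_right)
  qed
  also have "\<dots> = exp (- (\<Sum>a\<in>A. real (nat (zorder f a)) * (1 - cmod a)))" (is "_ = exp (- ?s)")
    using A(1) by (simp add: exp_sum[symmetric] sum_negf)
  finally have "cmod (finite_blaschke f A 0) * cmod (G 0) \<le> exp (- ?s) * M"
    using G(2) by (intro mult_mono) auto
  then have "cmod (f 0) \<le> exp (- ?s) * M" using G(1) by (simp add: norm_mult)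
  then have "exp ?s \<le> M / cmod (f 0)" using f0 by (simp add: exp_minus field_simps)
  then show ?thesis using f0 by (meson exp_gt_zero less_le_trans ln_ge_iff)
qed

text \<open>
  All factors have modulus at most 1, so the difference is bounded by the sum of the deviations
  from 1 of the additional factors.
\<close>

lemma finite_blaschke_diff:
  assumes A: "finite A" "\<And>a. a \<in> A \<Longrightarrow> a \<noteq> 0 \<and> cmod a < 1" and S: "S \<subseteq> A" and z: "cmod z < 1"
  shows "cmod (finite_blaschke f A z - finite_blaschke f S z)
           \<le> 2 / (1 - cmod z) * (\<Sum>a\<in>A - S. real (nat (zorder f a)) * (1 - cmod a))"
proof -
  let ?b = "\<lambda>a. blaschke_factor a z" and ?m = "\<lambda>a. nat (zorder f a)"
  have b1: "cmod (?b a) \<le> 1" if "a \<in> A" for a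
    using norm_blaschke_factor_le_1[of a z] A(2)[OF that] z by simp
  have "finite_blaschke f A z = finite_blaschke f S z * finite_blaschke f (A - S) z"
    unfolding finite_blaschke_def using prod.subset_diff[OF S A(1)] by (simp add: mult.commute)
  then have "cmod (finite_blaschke f A z - finite_blaschke f S z) =
      cmod (finite_blaschke f S z) * cmod (finite_blaschke f (A - S) z - 1)"
    by (simp add: norm_mult[symmetric] algebra_simps)
  also have "\<dots> \<le> cmod (finite_blaschke f (A - S) z - 1)"
    using A S z by (intro mult_left_le_one_le norm_finite_blaschke_le_1) auto
  also have "cmod (finite_blaschke f (A - S) z - 1) =
      cmod ((\<Prod>a\<in>A - S. ?b a ^ ?m a) - (\<Prod>a\<in>A - S. 1))"
    by (simp add: finite_blaschke_def)
  also have "\<dots> \<le> (\<Sum>a\<in>A - S. cmod (?b a ^ ?m a - 1))"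
    by (intro norm_prod_diff) (auto simp: norm_power intro!: power_le_one b1)
  also have "\<dots> \<le> (\<Sum>a\<in>A - S. real (?m a) * (2 / (1 - cmod z) * (1 - cmod a)))"
  proof (intro sum_mono)
    fix a assume a: "a \<in> A - S"
    have "cmod (?b a ^ ?m a - 1 ^ ?m a) \<le> real (?m a) * cmod (?b a - 1)"
      using b1 a by (intro norm_power_diff) auto
    also have "\<dots> \<le> real (?m a) * (2 / (1 - cmod z) * (1 - cmod a))"
      using norm_one_minus_blaschke_factor[of a z] A(2)[of a] a z
      by (intro mult_left_mono) (auto simp: norm_minus_commute)
    finally show "cmod (?b a ^ ?m a - 1) \<le> real (?m a) * (2 / (1 - cmod z) * (1 - cmod a))" by simp
  qed
  also have "\<dots> = 2 / (1 - cmod z) * (\<Sum>a\<in>A - S. real (?m a) * (1 - cmod a))"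
    by (simp only: sum_distrib_left mult.left_commute)
  finally show ?thesis .
qed

lemma finite_zeros_in_smaller_disk:
  assumes f: "f holomorphic_on ball 0 1" and f0: "f 0 \<noteq> 0" and r: "r < 1"
  shows "finite {a \<in> cball 0 r. f a = 0}"
proof (cases "f constant_on ball 0 1")
  case True
  then obtain c where c: "\<And>z. z \<in> ball 0 1 \<Longrightarrow> f z = c" by (auto simp: constant_on_def)
  then have "c \<noteq> 0" using f0 by force
  moreover have "cball 0 r \<subseteq> ball (0::complex) 1" using r by auto
  ultimately have "{a \<in> cball 0 r. f a = 0} = {}" using c by (auto dest: subsetD)
  then show ?thesis by (simp only: finite.emptyI)
next
  case False
  show ?thesis
    by (rule holomorphic_compact_finite_zeros[OF f _ _ _ _ False]) (use r in auto)
qed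

text \<open>
  Divide \<open>f\<close> by the finite products \<open>P\<^sub>n\<close> over its zeros in the disk of radius \<open>1 - 1 / (n + 2)\<close>.
  The quotients \<open>H\<^sub>n\<close> are bounded by \<open>M\<close>, so by Montel a subsequence converges to some \<open>G\<close>.
  Since \<open>\<bar>P\<^sub>n\<bar> \<le> 1\<close>, one has \<open>\<bar>f\<bar> \<le> \<bar>H\<^sub>n\<bar>\<close> and so \<open>\<bar>f\<bar> \<le> \<bar>G\<bar>\<close>, and \<open>G\<close> does not vanish where \<open>f\<close>
  does not; near a zero of \<open>f\<close> the \<open>H\<^sub>n\<close> are eventually zero-free, and Hurwitz applies.
  Along the subsequence the products tend to \<open>f / G\<close>; by the Blaschke condition the tails of the
  product are uniformly small, which upgrades this to the unconditional limit.
\<close>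

theorem blaschke_quotient:
  assumes f: "f holomorphic_on ball 0 1" and f0: "f 0 \<noteq> 0"
    and le: "\<And>z. cmod z < 1 \<Longrightarrow> cmod (f z) \<le> M"
  shows "\<exists>G. G holomorphic_on ball 0 1 \<and> (\<forall>z\<in>ball 0 1. G z \<noteq> 0 \<and> cmod (G z) \<le> M \<and>
           ((\<lambda>A. finite_blaschke f A z) \<longlongrightarrow> f z / G z) (finite_subsets_at_top {a \<in> ball 0 1. a \<noteq> 0 \<and> f a = 0}))"
proof -
  define Z where "Z = {a \<in> ball 0 1. a \<noteq> 0 \<and> f a = 0}"
  have Zd: "a \<noteq> 0 \<and> cmod a < 1" if "a \<in> Z" for a using that by (auto simp: Z_def)
  have nz: "\<exists>w\<in>ball 0 1. f w \<noteq> 0" using f0 by (intro bexI[of _ 0]) auto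
  define A where "A n = {a \<in> Z. cmod a \<le> 1 - 1 / real (n + 2)}" for n
  have A_fin: "finite (A n)" for n
    by (rule finite_subset[OF _ finite_zeros_in_smaller_disk[OF f f0, of "1 - 1 / real (n + 2)"]])
      (auto simp: A_def Z_def)
  have A_sub: "A n \<subseteq> Z" for n by (auto simp: A_def)
  have A_ev: "\<forall>\<^sub>F n in sequentially. a \<in> A n" if a: "a \<in> Z" for a
  proof -
    have "(\<lambda>n. 1 - 1 / real (n + 2)) \<longlonglongrightarrow> 1 - 0"
      by (intro tendsto_diff tendsto_const LIMSEQ_ignore_initial_segment[OF lim_1_over_n])
    then have "\<forall>\<^sub>F n in sequentially. cmod a < 1 - 1 / real (n + 2)"
      by (rule order_tendstoD) (use Zd[OF a] in simp)
    then show ?thesis by eventually_elim (use a in \<open>auto simp: A_def\<close>)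
  qed
  have A_ev': "\<forall>\<^sub>F n in sequentially. X \<subseteq> A n" if "finite X" "X \<subseteq> Z" for X
    unfolding subset_eq by (intro eventually_ball_finite that(1) ballI A_ev) (use that(2) in auto)
  have "\<forall>n. \<exists>G. G holomorphic_on ball 0 1 \<and> (\<forall>a\<in>A n. G a \<noteq> 0) \<and>
      (\<forall>z. cmod z < 1 \<longrightarrow> f z = finite_blaschke f (A n) z * G z \<and> cmod (G z) \<le> M)"
    using divide_by_finite_blaschke[OF f nz le A_fin] A_sub Zd by blast
  then obtain H where H: "\<And>n. H n holomorphic_on ball 0 1" "\<And>n a. a \<in> A n \<Longrightarrow> H n a \<noteq> 0"
     "\<And>n z. cmod z < 1 \<Longrightarrow> f z = finite_blaschke f (A n) z * H n z" "\<And>n z. cmod z < 1 \<Longrightarrow> cmod (H n z) \<le> M"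
    by metis
  obtain G r where G: "G holomorphic_on ball 0 1" and r: "strict_mono (r :: nat \<Rightarrow> nat)"
    and ptw: "\<And>x. x \<in> ball 0 1 \<Longrightarrow> (\<lambda>n. H (r n) x) \<longlonglongrightarrow> G x"
    and unif: "\<And>K. compact K \<Longrightarrow> K \<subseteq> ball 0 1 \<Longrightarrow> uniform_limit K (H \<circ> r) G sequentially"
  proof (rule Montel[of "ball 0 1" "range H" H])
    show "\<exists>B. \<forall>h\<in>range H. \<forall>z\<in>K. cmod (h z) \<le> B" if "compact K" "K \<subseteq> ball 0 1" for K
      using H(4) that by (intro exI[of _ M]) auto
  qed (use H(1) in auto)
  have evr: "\<forall>\<^sub>F n in sequentially. P (r n)" if "\<forall>\<^sub>F n in sequentially. P n" for P
    using eventually_subseq[OF r that] .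
  have G_le: "cmod (G z) \<le> M" if "cmod z < 1" for z
    using tendsto_norm[OF ptw[of z]] H(4) that by (intro LIMSEQ_le_const2[of "\<lambda>n. cmod (H (r n) z)"]) auto
  have G_ge: "cmod (f z) \<le> cmod (G z)" if z: "cmod z < 1" for z
  proof (rule LIMSEQ_le_const[OF tendsto_norm[OF ptw[of z]]])
    show "\<exists>N. \<forall>n\<ge>N. cmod (f z) \<le> cmod (H (r n) z)"
    proof (intro exI allI impI)
      fix n
      have "cmod (f z) = cmod (finite_blaschke f (A (r n)) z) * cmod (H (r n) z)"
        using H(3)[OF z] by (metis norm_mult)
      also have "\<dots> \<le> cmod (H (r n) z)"
        using Zd A_sub z by (intro mult_left_le_one_le norm_finite_blaschke_le_1) force+
      finally show "cmod (f z) \<le> cmod (H (r n) z)" .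
    qed
  qed (use z in auto)
  have G_nz: "G a \<noteq> 0" if a: "cmod a < 1" for a
  proof (cases "f a = 0")
    case False
    then show ?thesis using G_ge[OF a] by auto
  next
    case True
    then have aZ: "a \<in> Z" using a f0 by (auto simp: Z_def)
    have ab: "a \<in> ball 0 1" using a by simp
    from conjunct2[OF zorder_exist_zero[OF f open_ball connected_ball ab nz]] obtain s where s: "s > 0" "cball a s \<subseteq> ball 0 1"
      "\<And>w. w \<in> cball a s \<Longrightarrow> f w = zor_poly f a w * (w - a) ^ nat (zorder f a) \<and> zor_poly f a w \<noteq> 0"
      by blast
    have fnz: "f w \<noteq> 0" if "w \<in> ball a s" "w \<noteq> a" for w
      using s(3)[of w] that by auto
    have sub: "ball a s \<subseteq> ball 0 1" using s(2) ball_subset_cball by blast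
    obtain N where N: "\<And>n. n \<ge> N \<Longrightarrow> a \<in> A (r n)"
      using evr[OF A_ev[OF aZ]] by (auto simp: eventually_sequentially)
    show ?thesis
    proof (cases "G constant_on ball a s")
      case True
      define w where "w = a + of_real (s / 2)"
      have w: "w \<in> ball a s" "w \<noteq> a" using s(1) by (auto simp: w_def dist_norm)
      have "G a = G w" using True w(1) s(1) by (auto simp: constant_on_def)
      moreover have "cmod w < 1" using sub w(1) by auto
      ultimately show ?thesis using G_ge[of w] fnz[OF w] by auto
    next
      case False
      show ?thesis
      proof (rule Hurwitz_no_zeros[of "ball a s" "\<lambda>n. H (r (n + N))" G])
        show "H (r (n + N)) holomorphic_on ball a s" for n using H(1) sub by (rule holomorphic_on_subset)
        show "G holomorphic_on ball a s" using G sub by (rule holomorphic_on_subset)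
        show "uniform_limit K (\<lambda>n. H (r (n + N))) G sequentially" if K: "compact K" "K \<subseteq> ball a s" for K
        proof -
          have "uniform_limit K (H \<circ> r) G sequentially" using K sub by (intro unif) auto
          then show ?thesis
            by (intro filterlim_compose[of "H \<circ> r", unfolded o_def, OF _ filterlim_add_const_nat_at_top]) (simp add: o_def)
        qed
        show "H (r (n + N)) w \<noteq> 0" if w: "w \<in> ball a s" for n w
        proof (cases "w = a")
          case True
          then show ?thesis using H(2) N by simp
        next
          case False
          have "cmod w < 1" using sub w by auto
          then show ?thesis using H(3)[of w "r (n + N)"] fnz[OF w False] by auto
        qed
      qed (use False s(1) in auto)
    qed
  qed
  have lim: "((\<lambda>X. finite_blaschke f X z) \<longlongrightarrow> f z / G z) (finite_subsets_at_top Z)" if z: "cmod z < 1" for z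
  proof (rule tendstoI)
    fix e :: real assume e: "e > 0"
    define \<sigma> where "\<sigma> X = (\<Sum>a\<in>X. real (nat (zorder f a)) * (1 - cmod a))" for X
    define K where "K = 2 / (1 - cmod z)"
    have K: "K > 0" using z by (simp add: K_def)
    define F where "F = {X. finite X \<and> X \<subseteq> Z}"
    have bdd: "bdd_above (\<sigma> ` F)"
    proof (rule bdd_aboveI2)
      fix X assume X: "X \<in> F"
      then show "\<sigma> X \<le> ln (M / cmod (f 0))" unfolding \<sigma>_def
        by (intro blaschke_condition[OF f f0 le]) (use X Zd in \<open>auto simp: F_def\<close>)
    qed
    have ne: "{} \<in> F" by (simp add: F_def)
    \<comment> \<open>Two errors of size \<open>K d\<close> are added below.\<close>
    define d where "d = e / (3 * K)"
    have d: "d > 0" using e K by (simp add: d_def)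
    have "\<exists>S\<in>F. (SUP X\<in>F. \<sigma> X) - d < \<sigma> S"
      using bdd ne d by (subst less_cSUP_iff[symmetric]) auto
    then obtain S where S: "finite S" "S \<subseteq> Z" "(SUP X\<in>F. \<sigma> X) - d < \<sigma> S" by (auto simp: F_def)
    have close: "cmod (finite_blaschke f X z - finite_blaschke f S z) \<le> K * d"
      if X: "finite X" "X \<subseteq> Z" "S \<subseteq> X" for X
    proof -
      have "\<sigma> X = \<sigma> (X - S) + \<sigma> S" unfolding \<sigma>_def using X by (simp add: sum.subset_diff)
      moreover have "\<sigma> X \<le> (SUP X\<in>F. \<sigma> X)" using X bdd by (intro cSUP_upper) (auto simp: F_def)
      ultimately have "\<sigma> (X - S) \<le> d" using S(3) by linarith
      then have "K * \<sigma> (X - S) \<le> K * d" using K by (intro mult_left_mono) auto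
      moreover have "cmod (finite_blaschke f X z - finite_blaschke f S z) \<le> K * \<sigma> (X - S)"
        unfolding K_def \<sigma>_def using X Zd z by (intro finite_blaschke_diff) auto
      ultimately show ?thesis by linarith
    qed
    have "(\<lambda>n. finite_blaschke f (A (r n)) z) \<longlonglongrightarrow> f z / G z"
    proof (rule Lim_transform_eventually)
      show "(\<lambda>n. f z / H (r n) z) \<longlonglongrightarrow> f z / G z"
        using z G_nz[OF z] by (intro tendsto_intros ptw) auto
      have "\<forall>\<^sub>F n in sequentially. H (r n) z \<noteq> 0"
        using tendsto_imp_eventually_ne[OF ptw[of z] G_nz[OF z]] z by simp
      then show "\<forall>\<^sub>F n in sequentially. f z / H (r n) z = finite_blaschke f (A (r n)) z"
        by eventually_elim (use H(3)[OF z] in \<open>simp add: divide_eq_eq\<close>)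
    qed
    then have "(\<lambda>n. cmod (finite_blaschke f (A (r n)) z - finite_blaschke f S z)) \<longlonglongrightarrow> cmod (f z / G z - finite_blaschke f S z)"
      by (intro tendsto_intros)
    moreover have "\<forall>\<^sub>F n in sequentially. cmod (finite_blaschke f (A (r n)) z - finite_blaschke f S z) \<le> K * d"
      using evr[OF A_ev'[OF S(1,2)]] by eventually_elim (use close A_fin A_sub in blast)
    ultimately have Slim: "cmod (f z / G z - finite_blaschke f S z) \<le> K * d"
      by (rule tendsto_upperbound) auto
    show "\<forall>\<^sub>F X in finite_subsets_at_top Z. dist (finite_blaschke f X z) (f z / G z) < e"
      unfolding eventually_finite_subsets_at_top
    proof (intro exI[of _ S] conjI allI impI)
      fix X assume X: "finite X \<and> S \<subseteq> X \<and> X \<subseteq> Z"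
      have "dist (finite_blaschke f X z) (f z / G z) \<le>
          dist (finite_blaschke f X z) (finite_blaschke f S z) + dist (finite_blaschke f S z) (f z / G z)"
        by (rule dist_triangle)
      also have "\<dots> \<le> K * d + K * d"
        using close[of X] X Slim by (intro add_mono) (auto simp: dist_norm norm_minus_commute)
      also have "\<dots> < e" using K e by (simp add: d_def field_simps)
      finally show "dist (finite_blaschke f X z) (f z / G z) < e" .
    qed (use S in auto)
  qed
  show ?thesis
    using G G_nz G_le lim unfolding Z_def[symmetric] by (intro exI[of _ G]) auto
qed

text \<open>
  Dividing out the power of \<open>z\<close> changes neither the other zeros nor their orders, and reduces to a
  function that does not vanish at the origin.
\<close>

corollary blaschke_product_factorization:
  assumes f: "f holomorphic_on ball 0 1" and nz: "\<exists>w\<in>ball 0 1. f w \<noteq> 0"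
    and le: "\<And>z. cmod z < 1 \<Longrightarrow> cmod (f z) \<le> M"
  shows "\<exists>G. G holomorphic_on ball 0 1 \<and>
     (\<forall>z\<in>ball 0 1. G z \<noteq> 0 \<and> cmod (G z) \<le> M \<and> f z = blaschke_product f z * G z)"
proof -
  have z0: "(0::complex) \<in> ball 0 1" by simp
  define n where "n = nat (zorder f 0)"
  obtain h where h: "h holomorphic_on ball 0 1" "h 0 \<noteq> 0" "\<And>w. w \<in> ball 0 1 \<Longrightarrow> f w = (w - 0) ^ n * h w"
    unfolding n_def using factor_zero_at_point[OF f open_ball connected_ball z0 nz] by blast
  have h_le: "cmod (h z) \<le> M" if "cmod z < 1" for z
    by (rule norm_bound_of_unimodular_quotient[OF _ _ h(1) _ that, of "\<lambda>w. w ^ n"])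
      (use h(3) le in \<open>auto intro!: continuous_intros simp: norm_power\<close>)
  have nzh: "\<exists>w\<in>ball 0 1. h w \<noteq> 0" using h(2) z0 by blast
  have ord: "zorder h a = zorder f a" if a: "a \<in> ball 0 1" "a \<noteq> 0" for a
  proof -
    have "zorder h a = zorder (\<lambda>w. h w * w ^ n) a"
      by (rule zorder_mult_nonzero[symmetric, OF h(1) _ open_ball connected_ball a(1) nzh])
        (use a(2) in \<open>auto intro!: holomorphic_intros\<close>)
    also have "\<dots> = zorder f a"
    proof (rule zorder_cong)
      show "\<forall>\<^sub>F w in at a. h w * w ^ n = f w"
        using eventually_at_in_open'[OF open_ball a(1)] by eventually_elim (simp add: h(3))
    qed auto
    finally show ?thesis .
  qed
  let ?Z = "{a \<in> ball 0 1. a \<noteq> 0 \<and> f a = 0}"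
  have Z: "?Z = {a \<in> ball 0 1. a \<noteq> 0 \<and> h a = 0}" using h(3) by auto
  obtain G where G: "G holomorphic_on ball 0 1" "\<And>z. z \<in> ball 0 1 \<Longrightarrow> G z \<noteq> 0 \<and> cmod (G z) \<le> M \<and>
      ((\<lambda>A. finite_blaschke h A z) \<longlongrightarrow> h z / G z) (finite_subsets_at_top ?Z)"
    using blaschke_quotient[OF h(1,2) h_le] unfolding Z by blast
  have "f z = blaschke_product f z * G z" if z: "z \<in> ball 0 1" for z
  proof -
    have "((\<lambda>A. \<Prod>a\<in>A. blaschke_factor a z ^ nat (zorder f a)) \<longlongrightarrow> h z / G z) (finite_subsets_at_top ?Z)"
    proof (rule Lim_transform_eventually)
      show "((\<lambda>A. finite_blaschke h A z) \<longlongrightarrow> h z / G z) (finite_subsets_at_top ?Z)"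
        using G(2)[OF z] by blast
      show "\<forall>\<^sub>F A in finite_subsets_at_top ?Z.
          finite_blaschke h A z = (\<Prod>a\<in>A. blaschke_factor a z ^ nat (zorder f a))"
        unfolding finite_blaschke_def
        by (rule eventually_finite_subsets_at_top_weakI) (intro prod.cong refl, use ord in auto)
    qed
    then have "Lim (finite_subsets_at_top ?Z) (\<lambda>A. \<Prod>a\<in>A. blaschke_factor a z ^ nat (zorder f a)) = h z / G z"
      by (intro tendsto_Lim) (rule finite_subsets_at_top_neq_bot)
    then show ?thesis
      unfolding blaschke_product_def n_def[symmetric] using G(2)[OF z] h(3)[OF z] by simp
  qed
  with G show ?thesis by blast
qed

section \<open>The Herglotz representation\<close>

text \<open>
  Radii in \<open>]0, 1[\<close> that tend to 1; dilating by them makes a function on the disk holomorphic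
  beyond the closed disk.
\<close>

definition radius_seq :: "nat \<Rightarrow> real" where
  "radius_seq n = 1 - 1 / real (n + 2)"

lemma radius_seq: "0 < radius_seq n" "radius_seq n < 1"
  by (simp_all add: radius_seq_def)

lemma radius_seq_tendsto: "radius_seq \<longlonglongrightarrow> 1"
proof -
  have "(\<lambda>n. 1 - 1 / real (n + 2)) \<longlonglongrightarrow> 1 - 0"
    by (intro tendsto_diff tendsto_const LIMSEQ_ignore_initial_segment[OF lim_1_over_n])
  then show ?thesis by (simp add: radius_seq_def[abs_def])
qed

lemma dilation_holomorphic:
  assumes "f holomorphic_on ball 0 1" "0 < r"
  shows "(\<lambda>z. f (of_real r * z)) holomorphic_on ball 0 (1 / r)"
  by (rule holomorphic_on_compose_gen[OF _ assms(1), unfolded o_def])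
    (use assms(2) in \<open>auto intro!: holomorphic_intros simp: norm_mult field_simps\<close>)

lemma dilation_tendsto:
  assumes f: "f holomorphic_on ball 0 1" and s: "strict_mono s" and z: "cmod z < 1"
  shows "(\<lambda>n. f (of_real (radius_seq (s n)) * z)) \<longlonglongrightarrow> f z"
proof -
  have "(\<lambda>n. radius_seq (s n)) \<longlonglongrightarrow> 1"
    using LIMSEQ_subseq_LIMSEQ[OF radius_seq_tendsto s] by (simp add: o_def)
  then have "(\<lambda>n. of_real (radius_seq (s n)) * z) \<longlonglongrightarrow> of_real 1 * z"
    by (intro tendsto_intros)
  moreover have "isCont f z"
    using f z by (metis continuous_on_eq_continuous_at holomorphic_on_imp_continuous_on mem_ball_0 open_ball)
  ultimately show ?thesis by (intro isCont_tendsto_compose[of z f]) auto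
qed

lemma herglotz_kernel_bounded: "cmod z < 1 \<Longrightarrow> bounded (range (herglotz_kernel z))"
  using norm_herglotz_kernel_le by (auto simp: bounded_iff)

text \<open>
  On each dilate the Herglotz formula represents \<open>f\<close> by the density \<open>Re f\<close>, whose mass is constant,
  namely \<open>2 \<pi> Re (f 0)\<close>, by the mean value property. Pass to a weak limit; the kernel is itself a
  bounded continuous test function.
\<close>

lemma herglotz_representation:
  assumes f: "f holomorphic_on ball 0 1" and pos: "\<And>z. cmod z < 1 \<Longrightarrow> 0 \<le> Re (f z)"
  obtains \<mu> :: "real measure" where "finite_measure \<mu>" "sets \<mu> = sets borel" "emeasure \<mu> (- {0..2*pi}) = 0"
    "\<And>z. cmod z < 1 \<Longrightarrow> (LINT t|\<mu>. herglotz_kernel z t) = 2 * pi * (f z - \<i> * Im (f 0))"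
proof -
  define F where "F n z = f (of_real (radius_seq n) * z)" for n z
  define w where "w n t = Re (F n (cis t))" for n t
  have R: "1 / radius_seq n > 1" for n using radius_seq[of n] by simp
  have F: "F n holomorphic_on ball 0 (1 / radius_seq n)" for n
    unfolding F_def using dilation_holomorphic[OF f radius_seq(1)] .
  have eq: "(LINT t:{0..2*pi}|lborel. w n t *\<^sub>R herglotz_kernel z t) = 2 * pi * (F n z - \<i> * Im (f 0))"
    if "cmod z < 1" for n z
    using herglotz_formula[OF F R that, of n] by (simp add: w_def scaleR_conv_of_real mult.commute F_def)
  have cont: "continuous_on {0..2*pi} (w n)" for n
    unfolding w_def by (intro continuous_intros continuous_on_circle[OF F R])
  have w0: "0 \<le> w n t" for n t
    unfolding w_def F_def using radius_seq[of n] by (intro pos) (simp add: norm_mult)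
  have mass: "(LINT t:{0..2*pi}|lborel. w n t) = 2 * pi * Re (f 0)" for n
  proof -
    have k0: "herglotz_kernel 0 t = 1" for t by (simp add: herglotz_kernel_def)
    have "(LINT t:{0..2*pi}|lborel. complex_of_real (w n t)) = 2 * pi * (f 0 - \<i> * Im (f 0))"
      using eq[of 0 n] by (simp add: k0 F_def scaleR_conv_of_real)
    moreover have "f 0 - \<i> * Im (f 0) = of_real (Re (f 0))"
      by (simp add: complex_eq_iff)
    moreover have "(LINT t:{0..2*pi}|lborel. complex_of_real (w n t)) = of_real (LINT t:{0..2*pi}|lborel. w n t)"
      by (rule set_integral_complex_of_real)
    ultimately have "complex_of_real (LINT t:{0..2*pi}|lborel. w n t) = of_real (2 * pi * Re (f 0))"
      by simp
    then show ?thesis by (simp only: of_real_eq_iff)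
  qed
  obtain s \<mu> where s: "strict_mono s" and weak: "arc_weak_limit (\<lambda>n. w (s n)) \<mu>"
    using arc_measure_weak_limit[of w "2 * pi * Re (f 0)", OF arc_set_integrable[OF cont] w0] mass by auto
  then have \<mu>: "finite_measure \<mu>" "sets \<mu> = sets borel" "emeasure \<mu> (- {0..2*pi}) = 0"
    and lim: "\<And>\<phi> :: real \<Rightarrow> complex. (\<And>x. isCont \<phi> x) \<Longrightarrow> bounded (range \<phi>) \<Longrightarrow>
       (\<lambda>n. LINT t:{0..2*pi}|lborel. w (s n) t *\<^sub>R \<phi> t) \<longlonglongrightarrow> (LINT t|\<mu>. \<phi> t)"
    unfolding arc_weak_limit_def by simp_all
  have "(LINT t|\<mu>. herglotz_kernel z t) = 2 * pi * (f z - \<i> * Im (f 0))" if z: "cmod z < 1" for z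
  proof (rule LIMSEQ_unique)
    show "(\<lambda>n. LINT t:{0..2*pi}|lborel. w (s n) t *\<^sub>R herglotz_kernel z t) \<longlonglongrightarrow> (LINT t|\<mu>. herglotz_kernel z t)"
      by (rule lim[OF continuous_herglotz_kernel[OF z] herglotz_kernel_bounded[OF z]])
    show "(\<lambda>n. LINT t:{0..2*pi}|lborel. w (s n) t *\<^sub>R herglotz_kernel z t) \<longlonglongrightarrow> 2 * pi * (f z - \<i> * Im (f 0))"
      unfolding eq[OF z] F_def by (intro tendsto_intros dilation_tendsto[OF f s z])
  qed
  with \<mu> show thesis by (rule that)
qed

section \<open>Outer functions\<close>

text \<open>
  Outer functions are the exponentials of these integrals, with \<open>u = ln k\<close>. Adding and negating
  densities is the multiplicative structure of outer functions.
\<close>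

definition outer_exponent :: "(real \<Rightarrow> real) \<Rightarrow> complex \<Rightarrow> complex" where
  "outer_exponent u z = (LINT t:{0..2*pi}|lborel. herglotz_kernel z t * of_real (u t)) / (2 * pi)"

lemma set_integrable_herglotz:
  assumes u: "set_integrable lborel {0..2*pi} u" and z: "cmod z < 1"
  shows "set_integrable lborel {0..2*pi} (\<lambda>t. herglotz_kernel z t * complex_of_real (u t))"
proof -
  have [measurable]: "(\<lambda>t. indicator {0..2*pi} t *\<^sub>R u t) \<in> borel_measurable borel"
    using u by (auto simp: set_integrable_def)
  have [measurable]: "herglotz_kernel z \<in> borel_measurable borel" using z by simp
  have "integrable lborel (\<lambda>t. herglotz_kernel z t * complex_of_real (indicator {0..2*pi} t *\<^sub>R u t))"
  proof (rule Bochner_Integration.integrable_bound)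
    show "integrable lborel (\<lambda>t. (1 + cmod z) / (1 - cmod z) * (indicator {0..2*pi} t *\<^sub>R u t))"
      using u by (simp add: set_integrable_def)
    show "AE t in lborel. norm (herglotz_kernel z t * complex_of_real (indicator {0..2*pi} t *\<^sub>R u t))
        \<le> norm ((1 + cmod z) / (1 - cmod z) * (indicator {0..2*pi} t *\<^sub>R u t))"
    proof (intro AE_I2)
      fix t
      let ?x = "indicator {0..2*pi} t *\<^sub>R u t" and ?K = "(1 + cmod z) / (1 - cmod z)"
      have "norm (herglotz_kernel z t * complex_of_real ?x) = cmod (herglotz_kernel z t) * \<bar>?x\<bar>"
        by (simp only: norm_mult norm_of_real)
      also have "\<dots> \<le> ?K * \<bar>?x\<bar>"
        by (intro mult_right_mono norm_herglotz_kernel_le[OF z]) simp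
      also have "\<dots> = norm (?K * ?x)"
      proof -
        have K0: "0 \<le> ?K" using z by simp
        show ?thesis by (simp only: real_norm_def abs_mult abs_of_nonneg[OF K0])
      qed
      finally show "norm (herglotz_kernel z t * complex_of_real ?x) \<le> norm (?K * ?x)" .
    qed
  qed measurable
  moreover have "(\<lambda>t. herglotz_kernel z t * complex_of_real (indicator {0..2*pi} t *\<^sub>R u t)) =
      (\<lambda>t. indicator {0..2*pi} t *\<^sub>R (herglotz_kernel z t * complex_of_real (u t)))"
    by (auto simp: scaleR_conv_of_real)
  ultimately show ?thesis unfolding set_integrable_def by (simp only:)
qed

lemma outer_exponent_add:
  assumes "set_integrable lborel {0..2*pi} u" "set_integrable lborel {0..2*pi} v" "cmod z < 1"
  shows "outer_exponent (\<lambda>t. u t + v t) z = outer_exponent u z + outer_exponent v z"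
proof -
  have "(LINT t:{0..2*pi}|lborel. herglotz_kernel z t * of_real (u t + v t)) =
      (LINT t:{0..2*pi}|lborel. herglotz_kernel z t * of_real (u t) + herglotz_kernel z t * of_real (v t))"
    by (simp only: of_real_add distrib_left)
  also have "\<dots> = (LINT t:{0..2*pi}|lborel. herglotz_kernel z t * of_real (u t)) +
      (LINT t:{0..2*pi}|lborel. herglotz_kernel z t * of_real (v t))"
    using assms by (intro set_integral_add set_integrable_herglotz)
  finally show ?thesis by (simp add: outer_exponent_def add_divide_distrib)
qed

lemma outer_exponent_minus: "outer_exponent (\<lambda>t. - u t) z = - outer_exponent u z"
  by (simp add: outer_exponent_def set_lebesgue_integral_def)

lemma outer_exponent_const: "cmod z < 1 \<Longrightarrow> outer_exponent (\<lambda>_. c) z = of_real c"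
  using integral_herglotz_kernel[of z] by (simp add: outer_exponent_def)

lemma Re_outer_exponent:
  assumes "set_integrable lborel {0..2*pi} u" "cmod z < 1"
  shows "Re (outer_exponent u z) = (LINT t:{0..2*pi}|lborel. Re (herglotz_kernel z t) * u t) / (2 * pi)"
proof -
  have "Re (LINT t:{0..2*pi}|lborel. herglotz_kernel z t * of_real (u t)) =
      (LINT t:{0..2*pi}|lborel. Re (herglotz_kernel z t) * u t)"
    using set_integrable_herglotz[OF assms]
    unfolding set_lebesgue_integral_def set_integrable_def by (subst integral_Re [symmetric]) auto
  moreover have "Re (outer_exponent u z) = Re (LINT t:{0..2*pi}|lborel. herglotz_kernel z t * of_real (u t)) / (2 * pi)"
    unfolding outer_exponent_def by (rule Re_divide_of_real)
  ultimately show ?thesis by simp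
qed

lemma Re_outer_exponent_nonneg:
  assumes "set_integrable lborel {0..2*pi} u" "cmod z < 1" "\<And>t. 0 \<le> u t"
  shows "0 \<le> Re (outer_exponent u z)"
  unfolding Re_outer_exponent[OF assms(1,2)] set_lebesgue_integral_def
  using assms(3) Re_herglotz_kernel_pos[OF assms(2)]
  by (intro divide_nonneg_pos Bochner_Integration.integral_nonneg) (auto simp: less_imp_le)

lemma holomorphic_outer_exponent:
  assumes "set_integrable lborel {0..2*pi} u"
  shows "outer_exponent u holomorphic_on ball 0 1"
proof -
  have "integrable lborel (\<lambda>t. complex_of_real (indicator {0..2*pi} t *\<^sub>R u t))"
    by (rule integrable_of_real[OF assms[unfolded set_integrable_def]])
  then have "(\<lambda>z. LINT t|lborel. herglotz_kernel z t * complex_of_real (indicator {0..2*pi} t *\<^sub>R u t)) holomorphic_on ball 0 1"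
    by (rule holomorphic_herglotz_integral) simp
  moreover have "(LINT t|lborel. herglotz_kernel z t * complex_of_real (indicator {0..2*pi} t *\<^sub>R u t)) =
      (LINT t:{0..2*pi}|lborel. herglotz_kernel z t * of_real (u t))" for z
    unfolding set_lebesgue_integral_def
    by (intro Bochner_Integration.integral_cong refl) (simp add: scaleR_conv_of_real mult_ac)
  ultimately show ?thesis unfolding outer_exponent_def by (auto intro!: holomorphic_intros)
qed

lemma outer_iff:
  "outer F \<longleftrightarrow> (\<exists>u \<omega>. cmod \<omega> = 1 \<and> set_integrable lborel {0..2*pi} u \<and>
      (\<forall>z\<in>ball 0 1. F z = \<omega> * exp (outer_exponent u z)))"
proof
  assume "outer F"
  then obtain k \<omega> where "cmod \<omega> = 1" "set_integrable lborel {0..2*pi} (\<lambda>t. ln (k t))"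
    "\<forall>z\<in>ball 0 1. F z = \<omega> * exp (outer_exponent (\<lambda>t. ln (k t)) z)"
    unfolding outer_def outer_exponent_def by blast
  then show "\<exists>u \<omega>. cmod \<omega> = 1 \<and> set_integrable lborel {0..2*pi} u \<and>
      (\<forall>z\<in>ball 0 1. F z = \<omega> * exp (outer_exponent u z))" by blast
next
  assume "\<exists>u \<omega>. cmod \<omega> = 1 \<and> set_integrable lborel {0..2*pi} u \<and>
      (\<forall>z\<in>ball 0 1. F z = \<omega> * exp (outer_exponent u z))"
  then obtain u \<omega> where "cmod \<omega> = 1" "set_integrable lborel {0..2*pi} u"
      "\<forall>z\<in>ball 0 1. F z = \<omega> * exp (outer_exponent u z)" by blast
  then show "outer F" unfolding outer_def outer_exponent_def
    by (intro exI[of _ "\<lambda>t. exp (u t)"] exI[of _ \<omega>]) simp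
qed

lemma outer_holomorphic: "outer F \<Longrightarrow> F holomorphic_on ball 0 1"
proof -
  assume "outer F"
  then obtain u \<omega> where u: "set_integrable lborel {0..2*pi} u" "\<forall>z\<in>ball 0 1. F z = \<omega> * exp (outer_exponent u z)"
    unfolding outer_iff by blast
  have "(\<lambda>z. \<omega> * exp (outer_exponent u z)) holomorphic_on ball 0 1"
    by (intro holomorphic_intros holomorphic_outer_exponent u(1))
  then show ?thesis by (rule holomorphic_transform) (use u(2) in simp)
qed

lemma outer_nonzero: "outer F \<Longrightarrow> z \<in> ball 0 1 \<Longrightarrow> F z \<noteq> 0"
  unfolding outer_iff by force

lemma outer_cong: "outer F \<Longrightarrow> (\<And>z. z \<in> ball 0 1 \<Longrightarrow> F z = G z) \<Longrightarrow> outer G"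
  unfolding outer_iff by (metis (no_types, lifting))

lemma outer_one: "outer (\<lambda>_. 1)"
  unfolding outer_iff by (intro exI[of _ "\<lambda>_. 0"] exI[of _ 1]) (auto simp: outer_exponent_const intro!: arc_set_integrable)

lemma outer_mult:
  assumes "outer F" "outer G" shows "outer (\<lambda>z. F z * G z)"
proof -
  obtain u \<omega> where u: "cmod \<omega> = 1" "set_integrable lborel {0..2*pi} u"
    "\<forall>z\<in>ball 0 1. F z = \<omega> * exp (outer_exponent u z)" using assms(1) unfolding outer_iff by blast
  obtain v \<eta> where v: "cmod \<eta> = 1" "set_integrable lborel {0..2*pi} v"
    "\<forall>z\<in>ball 0 1. G z = \<eta> * exp (outer_exponent v z)" using assms(2) unfolding outer_iff by blast
  show ?thesis
    unfolding outer_iff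
  proof (intro exI conjI ballI)
    show "cmod (\<omega> * \<eta>) = 1" using u v by (simp add: norm_mult)
    show "set_integrable lborel {0..2*pi} (\<lambda>t. u t + v t)" using u v by (intro set_integral_add)
    show "F z * G z = \<omega> * \<eta> * exp (outer_exponent (\<lambda>t. u t + v t) z)" if "z \<in> ball 0 1" for z
      using u v that by (simp add: outer_exponent_add exp_add)
  qed
qed

section \<open>The canonical factorization\<close>

text \<open>
  Write \<open>G = M exp (- f)\<close>; then \<open>Re f \<ge> 0\<close> and \<open>f\<close> is given by a measure \<open>\<mu>\<close>. Its singular part
  is the measure of \<open>S\<close>. The absolutely continuous part has a density \<open>v \<ge> 0\<close>, and \<open>F\<close> is the
  outer function with \<open>ln k = ln M - v\<close>; since \<open>v\<close> is nonnegative, so is its Poisson integral,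
  and \<open>F\<close> inherits the bound \<open>M\<close> without any appeal to boundary values.
\<close>

lemma zero_free_factorization:
  assumes G: "G holomorphic_on ball 0 1" and nz: "\<And>z. z \<in> ball 0 1 \<Longrightarrow> G z \<noteq> 0"
    and le: "\<And>z. z \<in> ball 0 1 \<Longrightarrow> cmod (G z) \<le> M"
  shows "\<exists>S F. singular_inner S \<and> outer F \<and> (\<forall>z\<in>ball 0 1. G z = S z * F z \<and> cmod (F z) \<le> M)"
proof -
  have "0 < cmod (G 0)" using nz[of 0] by simp
  also have "\<dots> \<le> M" using le[of 0] by simp
  finally have M: "M > 0" .
  obtain \<psi> where \<psi>: "\<psi> holomorphic_on ball 0 1" "\<And>z. z \<in> ball 0 1 \<Longrightarrow> exp (\<psi> z) = G z"
    using holomorphic_logarithm_exists[OF convex_ball open_ball G nz, of 0] by (auto simp: dist_norm)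
  define f where "f z = of_real (ln M) - \<psi> z" for z
  have f: "f holomorphic_on ball 0 1" unfolding f_def by (intro holomorphic_intros \<psi>)
  have eM: "exp (complex_of_real (ln M)) = of_real M"
    using M by (simp add: exp_of_real)
  have Gf: "G z = of_real M * exp (- f z)" if "z \<in> ball 0 1" for z
    using \<psi>(2)[OF that] M by (simp add: f_def exp_diff eM)
  have pos: "0 \<le> Re (f z)" if "cmod z < 1" for z
  proof -
    have "exp (Re (\<psi> z)) \<le> exp (ln M)" using le[of z] \<psi>(2)[of z] that M by (metis mem_ball_0 exp_ln norm_exp_eq_Re)
    then show ?thesis by (simp add: f_def)
  qed
  obtain \<mu> where \<mu>: "finite_measure \<mu>" "sets \<mu> = sets borel" "emeasure \<mu> (- {0..2*pi}) = 0"
    and rep: "\<And>z. cmod z < 1 \<Longrightarrow> (LINT t|\<mu>. herglotz_kernel z t) = 2 * pi * (f z - \<i> * Im (f 0))"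
    using herglotz_representation[OF f pos] by blast
  interpret finite_measure \<mu> by fact
  note [measurable_cong] = \<mu>(2)
  have space_\<mu>: "space \<mu> = UNIV" using sets_eq_imp_space_eq[OF \<mu>(2)] by simp
  obtain N where N: "N \<in> null_sets lborel" "absolutely_continuous lborel (density \<mu> (indicator (- N)))"
    using lebesgue_decomposition_null_set[OF \<mu>(1,2)] by blast
  have Nb [measurable]: "N \<in> sets borel" using N(1) by auto
  have fin_ind: "finite_measure (density \<mu> (\<lambda>t. ennreal (c * indicator E t)))"
    if [measurable]: "E \<in> sets borel" and "0 \<le> c" for E and c :: real
  proof (rule finite_measureI)
    have "emeasure (density \<mu> (\<lambda>t. ennreal (c * indicator E t))) UNIV = (\<integral>\<^sup>+t. ennreal (c * indicator E t) \<partial>\<mu>)"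
      by (subst emeasure_density) (auto simp: sets_eq_imp_space_eq[OF \<mu>(2)])
    also have "\<dots> \<le> (\<integral>\<^sup>+t. ennreal c \<partial>\<mu>)"
      using that(2) by (intro nn_integral_mono ennreal_leI) (auto simp: indicator_def)
    also have "\<dots> < \<infinity>" by (simp add: ennreal_mult_eq_top_iff less_top[symmetric])
    finally show "emeasure (density \<mu> (\<lambda>t. ennreal (c * indicator E t))) (space (density \<mu> (\<lambda>t. ennreal (c * indicator E t)))) \<noteq> \<infinity>"
      by (simp add: space_\<mu>)
  qed
  have int_ind: "(LINT t|density \<mu> (\<lambda>t. ennreal (c * indicator E t)). \<phi> t) = (LINT t|\<mu>. (c * indicator E t) *\<^sub>R \<phi> t)"
    if [measurable]: "E \<in> sets borel" "\<phi> \<in> borel_measurable borel" and "0 \<le> c" for E c and \<phi> :: "real \<Rightarrow> complex"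
    using that(3) by (subst integral_density) auto
  define \<mu>a where "\<mu>a = density \<mu> (\<lambda>t. ennreal (1 * indicator (- N) t))"
  have \<mu>a: "finite_measure \<mu>a" "sets \<mu>a = sets borel" "absolutely_continuous lborel \<mu>a"
    unfolding \<mu>a_def using fin_ind[of "- N" 1] N(2) \<mu>(2) by (auto simp: ennreal_indicator)
  have \<mu>a_supp: "emeasure \<mu>a (- {0..2*pi}) = 0"
  proof -
    have "emeasure \<mu>a (- {0..2*pi}) = (\<integral>\<^sup>+t. ennreal (1 * indicator (- N) t) * indicator (- {0..2*pi}) t \<partial>\<mu>)"
      unfolding \<mu>a_def by (rule emeasure_density) auto
    also have "\<dots> \<le> (\<integral>\<^sup>+t. indicator (- {0..2*pi}) t \<partial>\<mu>)"
      by (intro nn_integral_mono) (auto simp: indicator_def)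
    also have "\<dots> = 0" using \<mu>(2,3) by simp
    finally show ?thesis by simp
  qed
  obtain v where v: "\<And>t. 0 \<le> v t" "set_integrable lborel {0..2*pi} v"
    and v_int: "\<And>\<phi> :: real \<Rightarrow> complex. \<phi> \<in> borel_measurable borel \<Longrightarrow>
       (LINT t|\<mu>a. \<phi> t) = (LINT t:{0..2*pi}|lborel. \<phi> t * of_real (v t))"
    using arc_density[OF \<mu>a \<mu>a_supp] by blast
  \<comment> \<open>The factor \<open>1 / (2 * pi)\<close> matches the normalisations of \<open>herglotz_representation\<close> and \<open>singular_inner\<close>.\<close>
  define \<mu>s where "\<mu>s = density \<mu> (\<lambda>t. ennreal (1 / (2*pi) * indicator N t))"
  define S where "S z = exp (- (LINT t|\<mu>s. herglotz_kernel z t))" for z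
  have "singular_inner S"
    unfolding singular_inner_def
  proof (intro exI[of _ \<mu>s] conjI bexI[of _ "N \<inter> {0..2*pi}"] ballI)
    show "finite_measure \<mu>s" unfolding \<mu>s_def by (rule fin_ind) auto
    show "sets \<mu>s = sets borel" by (simp add: \<mu>s_def \<mu>(2))
    show "emeasure lborel (N \<inter> {0..2*pi}) = 0"
      using null_setsD1[OF null_set_Int2[OF N(1), of "{0..2*pi}"]] by simp
    have "emeasure \<mu>s (- (N \<inter> {0..2*pi})) =
        (\<integral>\<^sup>+t. ennreal (1 / (2*pi) * indicator N t) * indicator (- (N \<inter> {0..2*pi})) t \<partial>\<mu>)"
      unfolding \<mu>s_def by (rule emeasure_density) auto
    also have "\<dots> = (\<integral>\<^sup>+t. 0 \<partial>\<mu>)"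
    proof (rule nn_integral_cong_AE)
      have "AE t in \<mu>. t \<in> {0..2*pi}"
        by (rule AE_I[where N = "- {0..2*pi}"]) (use \<mu> in auto)
      then show "AE t in \<mu>. ennreal (1 / (2*pi) * indicator N t) * indicator (- (N \<inter> {0..2*pi})) t = 0"
        by eventually_elim (auto simp: indicator_def)
    qed
    finally show "emeasure \<mu>s (- (N \<inter> {0..2*pi})) = 0" by simp
  qed (auto simp: S_def)
  \<comment> \<open>The unimodular constant absorbs the imaginary part of \<open>f 0\<close>, which the measure does not see.\<close>
  define F where "F z = exp (- \<i> * Im (f 0)) * exp (outer_exponent (\<lambda>t. ln M - v t) z)" for z
  have u_int: "set_integrable lborel {0..2*pi} (\<lambda>t. ln M - v t)"
    by (rule set_integral_diff(1)[OF arc_set_integrable[OF continuous_on_const] v(2)])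
  have "outer F"
    unfolding outer_iff
    by (intro exI[of _ "\<lambda>t. ln M - v t"] exI[of _ "exp (- \<i> * Im (f 0))"])
      (use u_int in \<open>simp add: F_def\<close>)
  have exponent: "outer_exponent (\<lambda>t. ln M - v t) z = of_real (ln M) - outer_exponent v z" if "cmod z < 1" for z
  proof -
    have "set_integrable lborel {0..2*pi} (\<lambda>t. - v t)" using v(2) by (simp add: set_integrable_def)
    moreover have "set_integrable lborel {0..2*pi} (\<lambda>_::real. ln M)"
      by (intro arc_set_integrable continuous_intros)
    ultimately have "outer_exponent (\<lambda>t. ln M + - v t) z = outer_exponent (\<lambda>_. ln M) z + outer_exponent (\<lambda>t. - v t) z"
      using that by (intro outer_exponent_add)
    then show ?thesis using that by (simp add: outer_exponent_minus outer_exponent_const)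
  qed
  have "G z = S z * F z \<and> cmod (F z) \<le> M" if "z \<in> ball 0 1" for z
  proof
    have z: "cmod z < 1" using that by simp
    have [measurable]: "herglotz_kernel z \<in> borel_measurable borel" using z by simp
    have int: "integrable \<mu> (\<lambda>t. (c * indicator E t) *\<^sub>R herglotz_kernel z t)"
      if [measurable]: "E \<in> sets borel" for c :: real and E
    proof (rule integrable_const_bound[where B="\<bar>c\<bar> * ((1 + cmod z) / (1 - cmod z))"])
      show "AE t in \<mu>. norm ((c * indicator E t) *\<^sub>R herglotz_kernel z t) \<le> \<bar>c\<bar> * ((1 + cmod z) / (1 - cmod z))"
      proof (intro AE_I2)
        fix t
        have "\<bar>c * indicator E t\<bar> \<le> \<bar>c\<bar>" by (auto simp: indicator_def)
        then show "norm ((c * indicator E t) *\<^sub>R herglotz_kernel z t) \<le> \<bar>c\<bar> * ((1 + cmod z) / (1 - cmod z))"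
          unfolding norm_scaleR by (intro mult_mono norm_herglotz_kernel_le[OF z]) auto
      qed
    qed measurable
    have "(LINT t|\<mu>. herglotz_kernel z t) =
        (LINT t|\<mu>. (1 * indicator N t) *\<^sub>R herglotz_kernel z t + (1 * indicator (- N) t) *\<^sub>R herglotz_kernel z t)"
      by (intro Bochner_Integration.integral_cong refl) (auto simp: indicator_def)
    also have "\<dots> = (LINT t|\<mu>. (1 * indicator N t) *\<^sub>R herglotz_kernel z t) +
        (LINT t|\<mu>. (1 * indicator (- N) t) *\<^sub>R herglotz_kernel z t)"
      by (intro Bochner_Integration.integral_add int) auto
    also have "(LINT t|\<mu>. (1 * indicator N t) *\<^sub>R herglotz_kernel z t) = 2 * pi * (LINT t|\<mu>s. herglotz_kernel z t)"
    proof -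
      have "(LINT t|\<mu>s. herglotz_kernel z t) = (LINT t|\<mu>. (1 / (2*pi) * indicator N t) *\<^sub>R herglotz_kernel z t)"
        unfolding \<mu>s_def by (rule int_ind) auto
      also have "\<dots> = (LINT t|\<mu>. (1 / (2*pi)) *\<^sub>R ((1 * indicator N t) *\<^sub>R herglotz_kernel z t))"
        by (simp only: scaleR_scaleR mult_1_left)
      also have "\<dots> = (1 / (2*pi)) *\<^sub>R (LINT t|\<mu>. (1 * indicator N t) *\<^sub>R herglotz_kernel z t)"
        by (rule Bochner_Integration.integral_scaleR_right)
      finally show ?thesis by (simp add: scaleR_conv_of_real)
    qed
    also have "(LINT t|\<mu>. (1 * indicator (- N) t) *\<^sub>R herglotz_kernel z t) = 2 * pi * outer_exponent v z"
      using v_int[of "herglotz_kernel z"] int_ind[of "- N" "herglotz_kernel z" 1]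
      by (simp add: \<mu>a_def outer_exponent_def)
    finally have "2 * pi * (f z - \<i> * Im (f 0)) = 2 * pi * ((LINT t|\<mu>s. herglotz_kernel z t) + outer_exponent v z)"
      using rep[OF z] by (simp add: distrib_left)
    then have "f z - \<i> * Im (f 0) = (LINT t|\<mu>s. herglotz_kernel z t) + outer_exponent v z"
      by (subst (asm) mult_left_cancel) simp_all
    then have "f z = \<i> * Im (f 0) + (LINT t|\<mu>s. herglotz_kernel z t) + outer_exponent v z"
      by (simp add: algebra_simps)
    then have "of_real (ln M) - f z = - (LINT t|\<mu>s. herglotz_kernel z t) + (- \<i> * Im (f 0) + outer_exponent (\<lambda>t. ln M - v t) z)"
      using exponent[OF z] by (simp add: algebra_simps)
    then have "exp (of_real (ln M) - f z) = S z * F z"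
      unfolding S_def F_def exp_add[symmetric] by (simp only:)
    moreover have "exp (of_real (ln M) - f z) = G z"
      using Gf[OF that] M by (simp add: exp_diff exp_minus eM divide_inverse)
    ultimately show "G z = S z * F z" by simp
    have "cmod (F z) = exp (ln M - Re (outer_exponent v z))"
      using exponent[OF z] by (simp add: F_def norm_mult)
    also have "\<dots> \<le> exp (ln M)" using Re_outer_exponent_nonneg[OF v(2) z v(1)] by simp
    finally show "cmod (F z) \<le> M" using M by simp
  qed
  then show ?thesis using \<open>singular_inner S\<close> \<open>outer F\<close> by blast
qed

theorem canonical_factorization_exists:
  assumes f: "f holomorphic_on ball 0 1" and nz: "\<exists>w\<in>ball 0 1. f w \<noteq> 0"
    and le: "\<And>z. z \<in> ball 0 1 \<Longrightarrow> cmod (f z) \<le> M"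
  shows "\<exists>S F. canonical_factorization f (blaschke_product f) S F \<and> (\<forall>z\<in>ball 0 1. cmod (F z) \<le> M)"
proof -
  obtain G where G: "G holomorphic_on ball 0 1"
    "\<And>z. z \<in> ball 0 1 \<Longrightarrow> G z \<noteq> 0 \<and> cmod (G z) \<le> M \<and> f z = blaschke_product f z * G z"
    using blaschke_product_factorization[OF f nz, of M] le by auto
  obtain S F where "singular_inner S" "outer F" "\<And>z. z \<in> ball 0 1 \<Longrightarrow> G z = S z * F z \<and> cmod (F z) \<le> M"
    using zero_free_factorization[OF G(1), of M] G(2) by blast
  then show ?thesis
    unfolding canonical_factorization_def using G(2) by (intro exI[of _ S] exI[of _ F]) (auto simp: mult.assoc)
qed

text \<open>
  The Blaschke product depends only on the zeros in the disk and their orders. The function \<open>h\<close> is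
  constrained only on the disk, because elements of the rings take a default value outside it.
\<close>

lemma blaschke_product_mult_nonvanishing:
  assumes f: "f holomorphic_on ball 0 1" and g: "g holomorphic_on ball 0 1"
    and nz: "\<exists>w\<in>ball 0 1. f w \<noteq> 0" and gnz: "\<And>z. z \<in> ball 0 1 \<Longrightarrow> g z \<noteq> 0"
    and h: "\<And>z. z \<in> ball 0 1 \<Longrightarrow> h z = f z * g z"
  shows "blaschke_product h = blaschke_product f"
proof
  fix z
  have ord: "zorder h a = zorder f a" if a: "a \<in> ball 0 1" for a
  proof -
    have "zorder h a = zorder (\<lambda>z. f z * g z) a"
    proof (rule zorder_cong)
      show "\<forall>\<^sub>F z in at a. h z = f z * g z"
        using eventually_at_in_open'[OF open_ball a] by eventually_elim (rule h)
    qed simp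
    also have "\<dots> = zorder f a"
      using a gnz by (intro zorder_mult_nonzero[OF f g open_ball connected_ball _ nz]) auto
    finally show ?thesis .
  qed
  have Z: "{a \<in> ball 0 1. a \<noteq> 0 \<and> h a = 0} = {a \<in> ball 0 1. a \<noteq> 0 \<and> f a = 0}"
    using gnz h by auto
  have "Lim (finite_subsets_at_top {a \<in> ball 0 1. a \<noteq> 0 \<and> f a = 0})
       (\<lambda>A. \<Prod>a\<in>A. blaschke_factor a z ^ nat (zorder h a)) =
     Lim (finite_subsets_at_top {a \<in> ball 0 1. a \<noteq> 0 \<and> f a = 0})
       (\<lambda>A. \<Prod>a\<in>A. blaschke_factor a z ^ nat (zorder f a))"
  proof (rule Lim_cong)
    show "\<forall>\<^sub>F A in finite_subsets_at_top {a \<in> ball 0 1. a \<noteq> 0 \<and> f a = 0}.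
        (\<Prod>a\<in>A. blaschke_factor a z ^ nat (zorder h a)) =
        (\<Prod>a\<in>A. blaschke_factor a z ^ nat (zorder f a))"
      by (rule eventually_finite_subsets_at_top_weakI) (intro prod.cong refl, use ord in auto)
  qed simp
  then show "blaschke_product h z = blaschke_product f z"
    unfolding blaschke_product_def Z using ord[of 0] by simp
qed

section \<open>Outer denominators for functions with bounded logarithmic means\<close>

lemma continuous_on_log_plus [continuous_intros]:
  assumes "continuous_on A f" "\<And>x. x \<in> A \<Longrightarrow> 0 \<le> f x"
  shows "continuous_on A (\<lambda>x. log_plus (f x))"
proof -
  have "log_plus x = ln (max x 1)" if "0 \<le> x" for x
    using that by (auto simp: log_plus_def max_def not_le)
  then have "continuous_on A (\<lambda>x. log_plus (f x)) \<longleftrightarrow> continuous_on A (\<lambda>x. ln (max (f x) 1))"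
    using assms(2) by (intro continuous_on_cong refl) auto
  also have \<dots> using assms(1) by (intro continuous_intros) auto
  finally show ?thesis .
qed

lemma log_plus_nonneg: "0 \<le> log_plus x"
  by (simp add: log_plus_def)

lemma le_exp_log_plus: "0 \<le> x \<Longrightarrow> x \<le> exp (log_plus x)"
  by (cases "x = 0") (auto simp: log_plus_def max_def)

text \<open>
  Let \<open>w\<^sub>n\<close> be \<open>log\<^sup>+ \<bar>g\<bar>\<close> on the circle of radius \<open>r\<^sub>n\<close> and \<open>v\<close> the density of a weak limit
  of these. In the limit, the Poisson majorant for the dilates of \<open>g\<close> becomes
  \<open>log \<bar>g\<bar> \<le> P[v]\<close>. The bound on \<open>p\<close>-th means with \<open>p > 1\<close> is what excludes a singular part of
  the limit measure; such a part would put a singular inner function into the denominator.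
\<close>

theorem bounded_outer_denominator:
  assumes g: "g holomorphic_on ball 0 1" and p: "1 < p"
    and bdd: "\<And>r. 0 < r \<Longrightarrow> r < 1 \<Longrightarrow>
       (LINT t:{0..2*pi}|lborel. log_plus (cmod (g (of_real r * cis t))) powr p) \<le> C"
  shows "\<exists>b. outer b \<and> (\<forall>z\<in>ball 0 1. cmod (b z) \<le> 1 \<and> cmod (b z * g z) \<le> 1)"
proof -
  define F where "F n z = g (of_real (radius_seq n) * z)" for n z
  define w where "w n t = log_plus (cmod (F n (cis t)))" for n t
  have R: "1 / radius_seq n > 1" for n using radius_seq[of n] by simp
  have F: "F n holomorphic_on ball 0 (1 / radius_seq n)" for n
    unfolding F_def using dilation_holomorphic[OF g radius_seq(1)] .
  have cont: "continuous_on {0..2*pi} (w n)" for n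
    unfolding w_def by (intro continuous_intros continuous_on_circle[OF F R]) auto
  have w0: "0 \<le> w n t" for n t by (simp add: w_def log_plus_nonneg)
  have bdd': "(LINT t:{0..2*pi}|lborel. w n t powr p) \<le> C" for n
    unfolding w_def F_def using bdd radius_seq by blast
  have mass: "(LINT t:{0..2*pi}|lborel. w n t) \<le> 2 * pi + C" for n
  proof -
    have cp: "continuous_on {0..2*pi} (\<lambda>t. w n t powr p)"
      using p w0 by (intro continuous_on_powr' cont continuous_intros) auto
    have "(LINT t:{0..2*pi}|lborel. w n t) \<le> (LINT t:{0..2*pi}|lborel. 1 + w n t powr p)"
      using le_add_powr_divide[OF w0 zero_less_one p]
      by (intro set_integral_mono arc_set_integrable cont continuous_intros cp) auto
    also have "\<dots> = (LINT t:{0..2*pi}|lborel. 1) + (LINT t:{0..2*pi}|lborel. w n t powr p)"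
      by (intro set_integral_add arc_set_integrable cp continuous_intros)
    also have "(LINT t:{0..2*pi}|lborel. (1::real)) = 2 * pi"
      by (simp add: set_lebesgue_integral_def)
    finally show ?thesis using bdd'[of n] by linarith
  qed
  obtain s \<mu> where s: "strict_mono s" and weak: "arc_weak_limit (\<lambda>n. w (s n)) \<mu>"
    using arc_measure_weak_limit[of w "2 * pi + C", OF arc_set_integrable[OF cont] w0] mass by auto
  then have \<mu>: "finite_measure \<mu>" "sets \<mu> = sets borel" "emeasure \<mu> (- {0..2*pi}) = 0"
    and lim: "\<And>\<phi> :: real \<Rightarrow> complex. (\<And>x. isCont \<phi> x) \<Longrightarrow> bounded (range \<phi>) \<Longrightarrow>
       (\<lambda>n. LINT t:{0..2*pi}|lborel. w (s n) t *\<^sub>R \<phi> t) \<longlonglongrightarrow> (LINT t|\<mu>. \<phi> t)"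
    unfolding arc_weak_limit_def by simp_all
  have ac: "absolutely_continuous lborel \<mu>"
    by (rule weak_limit_absolutely_continuous[of "\<lambda>n. w (s n)", OF cont w0 p bdd' weak])
  obtain v where v: "\<And>t. 0 \<le> v t" "set_integrable lborel {0..2*pi} v"
    and v_int: "\<And>\<phi> :: real \<Rightarrow> complex. \<phi> \<in> borel_measurable borel \<Longrightarrow>
       (LINT t|\<mu>. \<phi> t) = (LINT t:{0..2*pi}|lborel. \<phi> t * of_real (v t))"
    using arc_density[OF \<mu>(1,2) ac \<mu>(3)] by blast
  define b where "b z = exp (- outer_exponent v z)" for z
  have "outer b"
    unfolding outer_iff
    by (intro exI[of _ "\<lambda>t. - v t"] exI[of _ 1])
      (use v(2) in \<open>simp add: b_def outer_exponent_minus set_integrable_def\<close>)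
  moreover have "cmod (b z) \<le> 1 \<and> cmod (b z * g z) \<le> 1" if "z \<in> ball 0 1" for z
  proof -
    have z: "cmod z < 1" using that by simp
    have "(\<lambda>n. LINT t:{0..2*pi}|lborel. w (s n) t *\<^sub>R herglotz_kernel z t) \<longlonglongrightarrow> (LINT t|\<mu>. herglotz_kernel z t)"
      by (rule lim[OF continuous_herglotz_kernel[OF z] herglotz_kernel_bounded[OF z]])
    moreover have "(LINT t|\<mu>. herglotz_kernel z t) = 2 * pi * outer_exponent v z"
      using v_int[of "herglotz_kernel z"] z by (simp add: outer_exponent_def)
    moreover have "(LINT t:{0..2*pi}|lborel. w n t *\<^sub>R herglotz_kernel z t) = 2 * pi * outer_exponent (w n) z" for n
      by (simp add: outer_exponent_def scaleR_conv_of_real mult.commute)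
    ultimately have "(\<lambda>n. 2 * pi * outer_exponent (w (s n)) z / (2 * pi)) \<longlonglongrightarrow> 2 * pi * outer_exponent v z / (2 * pi)"
      by (intro tendsto_divide tendsto_const) simp_all
    then have "(\<lambda>n. outer_exponent (w (s n)) z) \<longlonglongrightarrow> outer_exponent v z" by simp
    then have "(\<lambda>n. exp (Re (outer_exponent (w (s n)) z))) \<longlonglongrightarrow> exp (Re (outer_exponent v z))"
      by (intro tendsto_intros)
    moreover have "(\<lambda>n. cmod (F (s n) z)) \<longlonglongrightarrow> cmod (g z)"
      unfolding F_def by (intro tendsto_norm dilation_tendsto[OF g s z])
    moreover have "cmod (F n z) \<le> exp (Re (outer_exponent (w n) z))" for n
    proof -
      have "cball 0 1 \<subseteq> ball (0::complex) (1 / radius_seq n)" "ball 0 1 \<subseteq> ball (0::complex) (1 / radius_seq n)"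
        using R[of n] by auto
      then have F1: "continuous_on (cball 0 1) (F n)" "F n holomorphic_on ball 0 1"
        using F[of n] by (auto intro: holomorphic_on_imp_continuous_on holomorphic_on_subset)
      have U: "continuous_on (sphere 0 1) (\<lambda>\<zeta>. log_plus (cmod (F n \<zeta>)))"
        by (intro continuous_intros continuous_on_subset[OF F1(1)]) auto
      have "cmod (F n z) \<le> exp ((LINT t:{0..2*pi}|lborel. Re (herglotz_kernel z t) * log_plus (cmod (F n (cis t)))) / (2*pi))"
        by (rule poisson_majorant[OF F1 U _ z]) (simp add: le_exp_log_plus)
      then show ?thesis
        using Re_outer_exponent[OF arc_set_integrable[OF cont] z] by (simp add: w_def)
    qed
    ultimately have "cmod (g z) \<le> exp (Re (outer_exponent v z))"
      by (intro LIMSEQ_le) auto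
    then have "cmod (g z) / exp (Re (outer_exponent v z)) \<le> 1" by simp
    then have "cmod (b z * g z) \<le> 1"
      by (simp add: b_def norm_mult exp_minus norm_inverse divide_inverse mult.commute)
    moreover have "cmod (b z) \<le> 1"
      using Re_outer_exponent_nonneg[OF v(2) z v(1)] unfolding b_def norm_exp_eq_Re by simp
    ultimately show ?thesis by blast
  qed
  ultimately show ?thesis by blast
qed

section \<open>The rings of functions on the disk\<close>

lemma pointwise_ring_simps [simp]:
  "carrier (pointwise_ring A) = A"
  "f \<otimes>\<^bsub>pointwise_ring A\<^esub> g = (\<lambda>z\<in>ball 0 1. f z * g z)"
  "f \<oplus>\<^bsub>pointwise_ring A\<^esub> g = (\<lambda>z\<in>ball 0 1. f z + g z)"
  "\<zero>\<^bsub>pointwise_ring A\<^esub> = (\<lambda>z\<in>ball 0 1. 0)"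
  "\<one>\<^bsub>pointwise_ring A\<^esub> = (\<lambda>z\<in>ball 0 1. 1)"
  by (simp_all add: pointwise_ring_def)

lemma cring_pointwise_ring:
  assumes ext: "A \<subseteq> extensional (ball 0 1)"
    and zero: "(\<lambda>z\<in>ball 0 1. 0) \<in> A" and one: "(\<lambda>z\<in>ball 0 1. 1) \<in> A"
    and add: "\<And>f g. f \<in> A \<Longrightarrow> g \<in> A \<Longrightarrow> (\<lambda>z\<in>ball 0 1. f z + g z) \<in> A"
    and mult: "\<And>f g. f \<in> A \<Longrightarrow> g \<in> A \<Longrightarrow> (\<lambda>z\<in>ball 0 1. f z * g z) \<in> A"
    and neg: "\<And>f. f \<in> A \<Longrightarrow> (\<lambda>z\<in>ball 0 1. - f z) \<in> A"
  shows "cring (pointwise_ring A)"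
proof (rule cringI)
  have restr: "(\<lambda>z\<in>ball 0 1. f z) = f" if "f \<in> A" for f
    using that ext by (intro extensional_restrict) auto
  show "abelian_group (pointwise_ring A)"
  proof (rule abelian_groupI)
    fix f assume f: "f \<in> carrier (pointwise_ring A)"
    then show "\<exists>g\<in>carrier (pointwise_ring A). g \<oplus>\<^bsub>pointwise_ring A\<^esub> f = \<zero>\<^bsub>pointwise_ring A\<^esub>"
      by (intro bexI[of _ "\<lambda>z\<in>ball 0 1. - f z"]) (auto intro: neg)
    show "\<zero>\<^bsub>pointwise_ring A\<^esub> \<oplus>\<^bsub>pointwise_ring A\<^esub> f = f"
      using restr[of f] f by (simp cong: restrict_cong)
  qed (auto simp: zero add algebra_simps)
  show "comm_monoid (pointwise_ring A)"
  proof (rule comm_monoidI)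
    fix f assume f: "f \<in> carrier (pointwise_ring A)"
    show "\<one>\<^bsub>pointwise_ring A\<^esub> \<otimes>\<^bsub>pointwise_ring A\<^esub> f = f"
      using restr[of f] f by (simp cong: restrict_cong)
  qed (auto simp: one mult algebra_simps)
qed (auto simp: algebra_simps)

lemma carrier_Hinf:
  "f \<in> carrier Hinf \<longleftrightarrow> f \<in> extensional (ball 0 1) \<and> f holomorphic_on ball 0 1 \<and> bounded (f ` ball 0 1)"
  by (simp add: Hinf_def)

lemma restrict_in_Hinf:
  assumes "f holomorphic_on ball 0 1" "\<And>z. z \<in> ball 0 1 \<Longrightarrow> cmod (f z) \<le> M"
  shows "(\<lambda>z\<in>ball 0 1. f z) \<in> carrier Hinf"
  unfolding carrier_Hinf
proof (intro conjI)
  show "(\<lambda>z\<in>ball 0 1. f z) holomorphic_on ball 0 1"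
    by (rule holomorphic_transform[OF assms(1)]) simp
  show "bounded ((\<lambda>z\<in>ball 0 1. f z) ` ball 0 1)"
    using assms(2) by (intro boundedI[of _ M]) auto
qed simp

lemma Hinf_bound:
  assumes "f \<in> carrier Hinf"
  shows "\<exists>M. \<forall>z\<in>ball 0 1. cmod (f z) \<le> M"
  using assms unfolding carrier_Hinf bounded_iff by blast

lemma Hinf_mult_closed:
  assumes "f \<in> carrier Hinf" "g \<in> carrier Hinf"
  shows "(\<lambda>z\<in>ball 0 1. f z * g z) \<in> carrier Hinf"
proof -
  obtain M where M: "\<forall>z\<in>ball 0 1. cmod (f z) \<le> M" using Hinf_bound[OF assms(1)] by blast
  obtain N where N: "\<forall>z\<in>ball 0 1. cmod (g z) \<le> N" using Hinf_bound[OF assms(2)] by blast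
  show ?thesis
  proof (rule restrict_in_Hinf)
    show "(\<lambda>z. f z * g z) holomorphic_on ball 0 1"
      using assms by (intro holomorphic_intros) (auto simp: carrier_Hinf)
    show "cmod (f z * g z) \<le> M * N" if "z \<in> ball 0 1" for z
      using bspec[OF M that] bspec[OF N that] unfolding norm_mult
      by (intro mult_mono) (auto intro: order_trans[OF norm_ge_zero])
  qed
qed

text \<open>
  The defining condition of \<open>N\<^sup>p\<close> as a plain bound, without the factor \<open>1 / (2 \<pi>)\<close>.
\<close>

definition log_mean_bounded :: "real \<Rightarrow> (complex \<Rightarrow> complex) \<Rightarrow> bool" where
  "log_mean_bounded p f \<longleftrightarrow> (\<exists>C. \<forall>r. 0 < r \<longrightarrow> r < 1 \<longrightarrow>
     (LINT t:{0..2*pi}|lborel. log_plus (cmod (f (of_real r * cis t))) powr p) \<le> C)"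

lemma carrier_Np:
  "f \<in> carrier (Np p) \<longleftrightarrow> f \<in> extensional (ball 0 1) \<and> f holomorphic_on ball 0 1 \<and> log_mean_bounded p f"
proof -
  let ?L = "\<lambda>r. LINT t:{0..2*pi}|lborel. log_plus (cmod (f (of_real r * cis t))) powr p"
  have "bdd_above ((\<lambda>r. ?L r / (2*pi)) ` {0<..<1}) \<longleftrightarrow> log_mean_bounded p f"
  proof
    assume "bdd_above ((\<lambda>r. ?L r / (2*pi)) ` {0<..<1})"
    then obtain M where "\<forall>x\<in>(\<lambda>r. ?L r / (2*pi)) ` {0<..<1}. x \<le> M" unfolding bdd_above_def by blast
    then have "?L r / (2*pi) \<le> M" if "0 < r" "r < 1" for r using that by simp
    then have "\<forall>r. 0 < r \<longrightarrow> r < 1 \<longrightarrow> ?L r \<le> M * (2*pi)" by (simp add: pos_divide_le_eq)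
    then show "log_mean_bounded p f" unfolding log_mean_bounded_def by blast
  next
    assume "log_mean_bounded p f"
    then obtain C where C: "\<And>r. 0 < r \<Longrightarrow> r < 1 \<Longrightarrow> ?L r \<le> C" unfolding log_mean_bounded_def by blast
    show "bdd_above ((\<lambda>r. ?L r / (2*pi)) ` {0<..<1})"
      by (rule bdd_aboveI2[of _ _ "C / (2*pi)"]) (auto intro!: divide_right_mono C)
  qed
  then show ?thesis by (simp add: Np_def)
qed

lemma powr_sum3_le:
  fixes a b c p :: real
  assumes "0 \<le> a" "0 \<le> b" "0 \<le> c" "0 < p"
  shows "(a + b + c) powr p \<le> 3 powr p * (a powr p + b powr p + c powr p)"
proof -
  define m where "m = max a (max b c)"
  have "(a + b + c) powr p \<le> (3 * m) powr p"
    using assms by (intro powr_mono2) (auto simp: m_def)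
  also have "\<dots> = 3 powr p * m powr p" using assms by (simp add: powr_mult m_def)
  also have "m powr p \<le> a powr p + b powr p + c powr p"
    using assms by (auto simp: m_def max_def)
  finally show ?thesis by simp
qed

text \<open>
  Sums, products and constants all obey an estimate of this shape, so this is the only closure
  property that needs an integral.
\<close>

lemma log_mean_bounded_dominated:
  assumes f: "f holomorphic_on ball 0 1" "log_mean_bounded p f"
    and g: "g holomorphic_on ball 0 1" "log_mean_bounded p g"
    and h: "h holomorphic_on ball 0 1" and p: "0 < p" and c: "0 \<le> c"
    and le: "\<And>z. z \<in> ball 0 1 \<Longrightarrow> log_plus (cmod (h z)) \<le> log_plus (cmod (f z)) + log_plus (cmod (g z)) + c"
  shows "log_mean_bounded p h"
proof -
  let ?L = "\<lambda>f r t. log_plus (cmod (f (of_real r * cis t)))"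
  obtain A B where A: "\<And>r. 0 < r \<Longrightarrow> r < 1 \<Longrightarrow> (LINT t:{0..2*pi}|lborel. ?L f r t powr p) \<le> A"
    and B: "\<And>r. 0 < r \<Longrightarrow> r < 1 \<Longrightarrow> (LINT t:{0..2*pi}|lborel. ?L g r t powr p) \<le> B"
    using f(2) g(2) unfolding log_mean_bounded_def by blast
  show ?thesis
    unfolding log_mean_bounded_def
  proof (intro exI allI impI)
    fix r :: real assume r: "0 < r" "r < 1"
    have inD: "of_real r * cis t \<in> ball 0 1" for t using r by (simp add: norm_mult)
    have cont: "continuous_on {0..2*pi} (\<lambda>t. ?L k r t powr p)" if k: "k holomorphic_on ball 0 1" for k
      by (intro continuous_on_powr' continuous_intros continuous_on_compose2[OF holomorphic_on_imp_continuous_on[OF k]])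
        (use inD p in \<open>auto simp: log_plus_nonneg\<close>)
    have i: "set_integrable lborel {0..2*pi} (\<lambda>t. ?L k r t powr p)" if "k holomorphic_on ball 0 1" for k
      by (rule arc_set_integrable[OF cont[OF that]])
    have ic: "set_integrable lborel {0..2*pi} (\<lambda>_. c powr p)"
      by (rule arc_set_integrable[OF continuous_on_const])
    have "(LINT t:{0..2*pi}|lborel. ?L h r t powr p) \<le>
        (LINT t:{0..2*pi}|lborel. 3 powr p * (?L f r t powr p + ?L g r t powr p + c powr p))"
    proof (rule set_integral_mono)
      show "?L h r t powr p \<le> 3 powr p * (?L f r t powr p + ?L g r t powr p + c powr p)" for t
      proof -
        have "?L h r t powr p \<le> (?L f r t + ?L g r t + c) powr p"
          using le[OF inD[of t]] p by (intro powr_mono2) (auto simp: log_plus_nonneg)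
        also have "\<dots> \<le> 3 powr p * (?L f r t powr p + ?L g r t powr p + c powr p)"
          by (rule powr_sum3_le) (use p c in \<open>auto simp: log_plus_nonneg\<close>)
        finally show ?thesis .
      qed
      show "set_integrable lborel {0..2*pi} (\<lambda>t. 3 powr p * (?L f r t powr p + ?L g r t powr p + c powr p))"
        by (intro set_integrable_mult_right set_integral_add i f(1) g(1) ic)
    qed (rule i[OF h])
    also have "\<dots> = 3 powr p * ((LINT t:{0..2*pi}|lborel. ?L f r t powr p) +
        (LINT t:{0..2*pi}|lborel. ?L g r t powr p) + (LINT t:{0..2*pi}|lborel. c powr p))"
      by (simp add: set_integral_add i f(1) g(1) ic)
    also have "\<dots> \<le> 3 powr p * (A + B + (LINT t:{0..2*pi}|lborel. c powr p))"
      using A[OF r] B[OF r] by (intro mult_left_mono add_mono) auto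
    finally show "(LINT t:{0..2*pi}|lborel. ?L h r t powr p) \<le> 3 powr p * (A + B + (LINT t:{0..2*pi}|lborel. c powr p))" .
  qed
qed

lemma log_mean_bounded_zero: "0 < p \<Longrightarrow> log_mean_bounded p (\<lambda>_. 0)"
  unfolding log_mean_bounded_def
  by (intro exI[of _ 0]) (simp add: log_plus_def set_lebesgue_integral_def)

lemma log_plus_mono: "0 \<le> x \<Longrightarrow> x \<le> y \<Longrightarrow> log_plus x \<le> log_plus y"
  by (auto simp: log_plus_def max_def)

lemma log_plus_mult:
  assumes "0 \<le> x" "0 \<le> y" shows "log_plus (x * y) \<le> log_plus x + log_plus y"
proof (cases "x = 0 \<or> y = 0")
  case True
  then have "log_plus (x * y) = 0" by (auto simp: log_plus_def)
  then show ?thesis by (simp add: log_plus_nonneg)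
next
  case False
  have "max (a + b) 0 \<le> max a 0 + max b (0::real)" for a b by (auto simp: max_def)
  then show ?thesis using assms False by (simp add: log_plus_def ln_mult)
qed

lemma log_plus_add:
  assumes "0 \<le> x" "0 \<le> y" shows "log_plus (x + y) \<le> log_plus x + log_plus y + ln 2"
proof -
  have "log_plus (x + y) \<le> log_plus (2 * max x y)"
    using assms by (intro log_plus_mono) auto
  also have "\<dots> \<le> log_plus 2 + log_plus (max x y)" using assms by (intro log_plus_mult) auto
  also have "log_plus 2 = ln 2" by (simp add: log_plus_def)
  also have "log_plus (max x y) \<le> log_plus x + log_plus y"
    using log_plus_nonneg[of x] log_plus_nonneg[of y] by (auto simp: max_def)
  finally show ?thesis by simp
qed

lemma Hinf_subset_Np:
  assumes p: "0 < p" shows "carrier Hinf \<subseteq> carrier (Np p)"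
proof
  fix f assume f: "f \<in> carrier Hinf"
  obtain M where M: "\<forall>z\<in>ball 0 1. cmod (f z) \<le> M" using Hinf_bound[OF f] by blast
  have "log_mean_bounded p f"
  proof (rule log_mean_bounded_dominated[of "\<lambda>_. 0" p "\<lambda>_. 0" f "log_plus M"])
    show "f holomorphic_on ball 0 1" using f by (simp add: carrier_Hinf)
    show "log_plus (cmod (f z)) \<le> log_plus (cmod 0) + log_plus (cmod 0) + log_plus M" if "z \<in> ball 0 1" for z
    proof -
      have "log_plus (cmod (f z)) \<le> log_plus M" using bspec[OF M that] by (intro log_plus_mono) simp_all
      then show ?thesis by (simp add: log_plus_def)
    qed
  qed (simp_all add: p log_plus_nonneg log_mean_bounded_zero)
  then show "f \<in> carrier (Np p)" using f by (simp add: carrier_Np carrier_Hinf)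
qed

lemma restrict_in_Np:
  assumes "f \<in> carrier (Np p)" "g \<in> carrier (Np p)" "h holomorphic_on ball 0 1" "0 < p" "0 \<le> c"
    "\<And>z. z \<in> ball 0 1 \<Longrightarrow> log_plus (cmod (h z)) \<le> log_plus (cmod (f z)) + log_plus (cmod (g z)) + c"
  shows "(\<lambda>z\<in>ball 0 1. h z) \<in> carrier (Np p)"
  unfolding carrier_Np
proof (intro conjI)
  show hol: "(\<lambda>z\<in>ball 0 1. h z) holomorphic_on ball 0 1"
    by (rule holomorphic_transform[OF assms(3)]) simp
  show "log_mean_bounded p (\<lambda>z\<in>ball 0 1. h z)"
    by (rule log_mean_bounded_dominated[of f p g _ c]) (use assms hol in \<open>auto simp: carrier_Np\<close>)
qed simp

lemma cring_Np:
  assumes p: "0 < p" shows "cring (Np p)"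
proof -
  have eq: "Np p = pointwise_ring (carrier (Np p))" by (simp add: Np_def)
  note Hinf_Np = subsetD[OF Hinf_subset_Np[OF p]]
  have holN: "f holomorphic_on ball 0 1" if "f \<in> carrier (Np p)" for f using that by (simp add: carrier_Np)
  have "cring (pointwise_ring (carrier (Np p)))"
  proof (rule cring_pointwise_ring)
    show "carrier (Np p) \<subseteq> extensional (ball 0 1)" by (auto simp: carrier_Np)
    show "(\<lambda>z\<in>ball 0 1. 0) \<in> carrier (Np p)" "(\<lambda>z\<in>ball 0 1. 1) \<in> carrier (Np p)"
      by (intro Hinf_Np restrict_in_Hinf[of _ 1]; simp)+
    fix f assume f: "f \<in> carrier (Np p)"
    show "(\<lambda>z\<in>ball 0 1. - f z) \<in> carrier (Np p)"
      by (rule restrict_in_Np[OF f f holomorphic_on_minus[OF holN[OF f]] p order_refl])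
        (simp add: log_plus_nonneg)
    fix g assume g: "g \<in> carrier (Np p)"
    show "(\<lambda>z\<in>ball 0 1. f z * g z) \<in> carrier (Np p)"
      by (rule restrict_in_Np[OF f g holomorphic_on_mult[OF holN[OF f] holN[OF g]] p order_refl])
        (simp add: norm_mult log_plus_mult)
    show "(\<lambda>z\<in>ball 0 1. f z + g z) \<in> carrier (Np p)"
    proof (rule restrict_in_Np[OF f g _ p, of _ "ln 2"])
      show "(\<lambda>z. f z + g z) holomorphic_on ball 0 1" by (rule holomorphic_on_add[OF holN[OF f] holN[OF g]])
      show "log_plus (cmod (f z + g z)) \<le> log_plus (cmod (f z)) + log_plus (cmod (g z)) + ln 2" for z
        using log_plus_mono[OF norm_ge_zero norm_triangle_ineq[of "f z" "g z"]]
          log_plus_add[of "cmod (f z)" "cmod (g z)"] by simp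
    qed simp
  qed
  then show ?thesis by (simp flip: eq)
qed

text \<open>
  The form in which the quotient enters the ideal argument: numerator and denominator are elements
  of the ring \<open>H\<^sup>\<infinity>\<close>, hence restricted to the disk.
\<close>

lemma Np_quotient:
  assumes p: "1 < p" and g: "g \<in> carrier (Np p)"
  shows "\<exists>b. outer b \<and> b \<in> carrier Hinf \<and> (\<lambda>z\<in>ball 0 1. b z * g z) \<in> carrier Hinf"
proof -
  obtain C where C: "\<And>r. 0 < r \<Longrightarrow> r < 1 \<Longrightarrow>
      (LINT t:{0..2*pi}|lborel. log_plus (cmod (g (of_real r * cis t))) powr p) \<le> C"
    using g unfolding carrier_Np log_mean_bounded_def by blast
  have hg: "g holomorphic_on ball 0 1" using g by (simp add: carrier_Np)
  obtain b where b: "outer b" "\<And>z. z \<in> ball 0 1 \<Longrightarrow> cmod (b z) \<le> 1 \<and> cmod (b z * g z) \<le> 1"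
    using bounded_outer_denominator[OF hg p C] by blast
  show ?thesis
  proof (intro exI conjI)
    show "outer (\<lambda>z\<in>ball 0 1. b z)" by (rule outer_cong[OF b(1)]) simp
    show "(\<lambda>z\<in>ball 0 1. b z) \<in> carrier Hinf"
      using b by (intro restrict_in_Hinf[of _ 1] outer_holomorphic) auto
    have "(\<lambda>z\<in>ball 0 1. (\<lambda>z\<in>ball 0 1. b z) z * g z) = (\<lambda>z\<in>ball 0 1. b z * g z)"
      by (rule restrict_ext) simp
    also have "\<dots> \<in> carrier Hinf"
      using b(2) by (intro restrict_in_Hinf[of _ 1] holomorphic_on_mult[OF outer_holomorphic[OF b(1)] hg]) auto
    finally show "(\<lambda>z\<in>ball 0 1. (\<lambda>z\<in>ball 0 1. b z) z * g z) \<in> carrier Hinf" .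
  qed
qed

section \<open>The trace of the generated ideal\<close>

text \<open>
  An outer factor has no zeros and is absorbed by the outer part of the canonical factorization,
  so \<open>h\<close> and \<open>b h\<close> share the inner factor \<open>u\<close>. As \<open>u \<in> I\<close> and the outer factor of \<open>h\<close> is bounded,
  \<open>h\<close> is an \<open>H\<^sup>\<infinity>\<close>-multiple of \<open>u\<close>.
\<close>

lemma cancel_outer_factor:
  assumes I: "ideal I Hinf"
    and inner: "\<And>f g. f \<in> I \<Longrightarrow> f \<noteq> \<zero>\<^bsub>Hinf\<^esub> \<Longrightarrow> is_inner_factor g f \<Longrightarrow> g \<in> I"
    and h: "h \<in> carrier Hinf" and b: "outer b" and bh: "(\<lambda>z\<in>ball 0 1. b z * h z) \<in> I"
  shows "h \<in> I"
proof -
  interpret I: ideal I Hinf by (rule I)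
  have hh: "h \<in> extensional (ball 0 1)" "h holomorphic_on ball 0 1" using h by (auto simp: carrier_Hinf)
  show ?thesis
  proof (cases "\<exists>w\<in>ball 0 1. h w \<noteq> 0")
    case False
    then have "h = (\<lambda>z\<in>ball 0 1. 0)" using hh(1) by (auto simp: fun_eq_iff extensional_def)
    then show ?thesis using additive_subgroup.zero_closed[OF I.is_additive_subgroup] by (simp add: Hinf_def)
  next
    case True
    obtain M where M: "\<forall>z\<in>ball 0 1. cmod (h z) \<le> M" using Hinf_bound[OF h] by blast
    obtain S F where SF: "canonical_factorization h (blaschke_product h) S F" "\<forall>z\<in>ball 0 1. cmod (F z) \<le> M"
      using canonical_factorization_exists[OF hh(2) True bspec[OF M]] by blast
    define f where "f = (\<lambda>z\<in>ball 0 1. b z * h z)"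
    define u where "u = (\<lambda>z\<in>ball 0 1. blaschke_product h z * S z)"
    have "blaschke_product f = blaschke_product h"
      by (rule blaschke_product_mult_nonvanishing[OF hh(2) outer_holomorphic[OF b] True outer_nonzero[OF b]])
        (simp_all add: f_def)
    then have "canonical_factorization f (blaschke_product h) S (\<lambda>z. F z * b z)"
      using SF(1) outer_mult[OF _ b] unfolding canonical_factorization_def by (auto simp: f_def)
    then have "is_inner_factor u f" unfolding is_inner_factor_def u_def by blast
    moreover have "f \<noteq> \<zero>\<^bsub>Hinf\<^esub>"
    proof
      assume f0: "f = \<zero>\<^bsub>Hinf\<^esub>"
      have "b z * h z = 0" if "z \<in> ball 0 1" for z
      proof -
        have "b z * h z = f z" using that by (simp add: f_def)
        also have "\<dots> = 0" unfolding f0 using that by (simp add: Hinf_def)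
        finally show ?thesis .
      qed
      then show False using True outer_nonzero[OF b] by auto
    qed
    ultimately have "u \<in> I" using inner bh unfolding f_def by blast
    moreover have "(\<lambda>z\<in>ball 0 1. F z) \<in> carrier Hinf"
      using SF by (intro restrict_in_Hinf[of _ M] outer_holomorphic) (auto simp: canonical_factorization_def)
    ultimately have "(\<lambda>z\<in>ball 0 1. F z) \<otimes>\<^bsub>Hinf\<^esub> u \<in> I" by (rule I.I_l_closed)
    moreover have "(\<lambda>z\<in>ball 0 1. F z) \<otimes>\<^bsub>Hinf\<^esub> u = h"
    proof (rule extensionalityI[OF _ hh(1)])
      show "((\<lambda>z\<in>ball 0 1. F z) \<otimes>\<^bsub>Hinf\<^esub> u) z = h z" if "z \<in> ball 0 1" for z
        using SF(1) that by (simp add: Hinf_def u_def canonical_factorization_def)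
    qed (simp add: Hinf_def)
    ultimately show ?thesis by simp
  qed
qed

text \<open>
  Common denominators: products of bounded outer functions are bounded and outer. Closure under
  multiplication by \<open>x \<in> N\<^sup>p\<close> writes \<open>x\<close> as a quotient and moves its denominator into \<open>b\<close>.
\<close>

lemma ideal_of_outer_fractions:
  assumes p: "1 < p" and I: "ideal I Hinf"
  shows "ideal {h \<in> carrier (Np p). \<exists>b. outer b \<and> b \<in> carrier Hinf \<and> (\<lambda>z\<in>ball 0 1. b z * h z) \<in> I} (Np p)"
    (is "ideal ?K _")
proof -
  have p0: "0 < p" using p by simp
  interpret R: cring "Np p" by (rule cring_Np[OF p0])
  interpret I: ideal I Hinf by (rule I)
  have ops: "f \<otimes>\<^bsub>Np p\<^esub> g = (\<lambda>z\<in>ball 0 1. f z * g z)" "f \<oplus>\<^bsub>Np p\<^esub> g = (\<lambda>z\<in>ball 0 1. f z + g z)"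
      "\<zero>\<^bsub>Np p\<^esub> = (\<lambda>z\<in>ball 0 1. 0)" for f g by (simp_all add: Np_def)
  have I_mult: "(\<lambda>z\<in>ball 0 1. x z * a z) \<in> I" if "x \<in> carrier Hinf" "a \<in> I" for x a
    using I.I_l_closed[OF that(2,1)] by (simp add: Hinf_def)
  have I_add: "(\<lambda>z\<in>ball 0 1. a z + a' z) \<in> I" if "a \<in> I" "a' \<in> I" for a a'
    using additive_subgroup.a_closed[OF I.is_additive_subgroup that] by (simp add: Hinf_def)
  have mult_K: "x \<otimes>\<^bsub>Np p\<^esub> h \<in> ?K" if h: "h \<in> ?K" and x: "x \<in> carrier (Np p)" for x h
  proof -
    obtain b where b: "outer b" "b \<in> carrier Hinf" "(\<lambda>z\<in>ball 0 1. b z * h z) \<in> I" using h by blast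
    obtain d where d: "outer d" "d \<in> carrier Hinf" "(\<lambda>z\<in>ball 0 1. d z * x z) \<in> carrier Hinf"
      using Np_quotient[OF p x] by blast
    have "(\<lambda>z\<in>ball 0 1. (\<lambda>z\<in>ball 0 1. d z * x z) z * (\<lambda>z\<in>ball 0 1. b z * h z) z) \<in> I"
      by (rule I_mult[OF d(3) b(3)])
    moreover have "(\<lambda>z\<in>ball 0 1. (\<lambda>z\<in>ball 0 1. d z * x z) z * (\<lambda>z\<in>ball 0 1. b z * h z) z) =
        (\<lambda>z\<in>ball 0 1. (\<lambda>z\<in>ball 0 1. d z * b z) z * (x \<otimes>\<^bsub>Np p\<^esub> h) z)"
      by (rule restrict_ext) (simp add: ops)
    moreover have "outer (\<lambda>z\<in>ball 0 1. d z * b z)"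
      by (rule outer_cong[OF outer_mult[OF d(1) b(1)]]) simp
    ultimately show ?thesis
      using R.m_closed[OF x, of h] h Hinf_mult_closed[OF d(2) b(2)] by auto
  qed
  have add_K: "h \<oplus>\<^bsub>Np p\<^esub> k \<in> ?K" if h: "h \<in> ?K" and k: "k \<in> ?K" for h k
  proof -
    obtain b where b: "outer b" "b \<in> carrier Hinf" "(\<lambda>z\<in>ball 0 1. b z * h z) \<in> I" using h by blast
    obtain d where d: "outer d" "d \<in> carrier Hinf" "(\<lambda>z\<in>ball 0 1. d z * k z) \<in> I" using k by blast
    have "(\<lambda>z\<in>ball 0 1. (\<lambda>z\<in>ball 0 1. d z * (\<lambda>z\<in>ball 0 1. b z * h z) z) z +
        (\<lambda>z\<in>ball 0 1. b z * (\<lambda>z\<in>ball 0 1. d z * k z) z) z) \<in> I"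
      by (intro I_add I_mult b d)
    moreover have "(\<lambda>z\<in>ball 0 1. (\<lambda>z\<in>ball 0 1. d z * (\<lambda>z\<in>ball 0 1. b z * h z) z) z +
        (\<lambda>z\<in>ball 0 1. b z * (\<lambda>z\<in>ball 0 1. d z * k z) z) z) =
        (\<lambda>z\<in>ball 0 1. (\<lambda>z\<in>ball 0 1. d z * b z) z * (h \<oplus>\<^bsub>Np p\<^esub> k) z)"
      by (rule restrict_ext) (simp add: ops algebra_simps)
    moreover have "outer (\<lambda>z\<in>ball 0 1. d z * b z)"
      by (rule outer_cong[OF outer_mult[OF d(1) b(1)]]) simp
    ultimately show ?thesis
      using R.a_closed[of h k] h k Hinf_mult_closed[OF d(2) b(2)] by auto
  qed
  have one: "outer (\<lambda>z\<in>ball 0 1. 1)" "(\<lambda>z\<in>ball 0 1. 1) \<in> carrier Hinf"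
    by (rule outer_cong[OF outer_one], simp) (rule restrict_in_Hinf[of _ 1], auto)
  show ?thesis
  proof (rule idealI[OF R.ring_axioms])
    show "subgroup ?K (add_monoid (Np p))"
    proof (rule subgroup.intro)
      have "(\<lambda>z\<in>ball 0 1. (\<lambda>z\<in>ball 0 1. 1) z * \<zero>\<^bsub>Np p\<^esub> z) = \<zero>\<^bsub>Hinf\<^esub>"
        by (simp add: ops Hinf_def cong: restrict_cong)
      then have "\<zero>\<^bsub>Np p\<^esub> \<in> ?K" using one additive_subgroup.zero_closed[OF I.is_additive_subgroup] R.zero_closed by fastforce
      then show "\<one>\<^bsub>add_monoid (Np p)\<^esub> \<in> ?K" by simp
      show "x \<otimes>\<^bsub>add_monoid (Np p)\<^esub> y \<in> ?K" if "x \<in> ?K" "y \<in> ?K" for x y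
        using add_K[OF that] by simp
      show "inv\<^bsub>add_monoid (Np p)\<^esub> x \<in> ?K" if x: "x \<in> ?K" for x
      proof -
        have xc: "x \<in> carrier (Np p)" using x by blast
        have "(\<ominus>\<^bsub>Np p\<^esub> \<one>\<^bsub>Np p\<^esub>) \<otimes>\<^bsub>Np p\<^esub> x \<in> ?K" by (rule mult_K[OF x]) simp
        moreover have "(\<ominus>\<^bsub>Np p\<^esub> \<one>\<^bsub>Np p\<^esub>) \<otimes>\<^bsub>Np p\<^esub> x = inv\<^bsub>add_monoid (Np p)\<^esub> x"
        proof -
          have "(\<ominus>\<^bsub>Np p\<^esub> \<one>\<^bsub>Np p\<^esub>) \<otimes>\<^bsub>Np p\<^esub> x = \<ominus>\<^bsub>Np p\<^esub> x"
            using xc by (simp add: R.l_minus)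
          also have "\<dots> = inv\<^bsub>add_monoid (Np p)\<^esub> x" unfolding a_inv_def by (rule refl)
          finally show ?thesis .
        qed
        ultimately show ?thesis by (simp only:)
      qed
    qed auto
    show "x \<otimes>\<^bsub>Np p\<^esub> a \<in> ?K" if "a \<in> ?K" "x \<in> carrier (Np p)" for a x
      by (rule mult_K[OF that])
    show "a \<otimes>\<^bsub>Np p\<^esub> x \<in> ?K" if "a \<in> ?K" "x \<in> carrier (Np p)" for a x
      using mult_K[OF that] R.m_comm[of a x] that by auto
  qed
qed

text \<open>
  The ideal generated by \<open>I\<close> lies in the ideal of outer fractions, and an outer fraction that
  already belongs to \<open>H\<^sup>\<infinity>\<close> lies in \<open>I\<close> by cancellation.
\<close>

theorem theorem2:
  fixes p :: real and I :: "(complex \<Rightarrow> complex) set"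
  assumes "1 < p"
    and "ideal I Hinf"
    and "\<And>f g. f \<in> I \<Longrightarrow> f \<noteq> \<zero>\<^bsub>Hinf\<^esub> \<Longrightarrow> is_inner_factor g f \<Longrightarrow> g \<in> I"
  shows "\<exists>J. ideal J (Np p) \<and> I = J \<inter> carrier Hinf \<and> J = Idl\<^bsub>Np p\<^esub> I"
proof -
  have p: "0 < p" using assms(1) by simp
  interpret R: cring "Np p" by (rule cring_Np[OF p])
  interpret I: ideal I Hinf by (rule assms(2))
  let ?J = "Idl\<^bsub>Np p\<^esub> I"
  let ?K = "{h \<in> carrier (Np p). \<exists>b. outer b \<and> b \<in> carrier Hinf \<and> (\<lambda>z\<in>ball 0 1. b z * h z) \<in> I}"
  have IN: "I \<subseteq> carrier (Np p)" using I.a_subset Hinf_subset_Np[OF p] by blast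
  have one: "outer (\<lambda>z\<in>ball 0 1. 1)" "(\<lambda>z\<in>ball 0 1. 1) \<in> carrier Hinf"
    by (rule outer_cong[OF outer_one], simp) (rule restrict_in_Hinf[of _ 1], auto)
  have "I \<subseteq> ?K"
  proof
    fix f assume f: "f \<in> I"
    then have "f \<in> extensional (ball 0 1)" using I.a_subset by (auto simp: carrier_Hinf)
    then have "(\<lambda>z\<in>ball 0 1. (\<lambda>z\<in>ball 0 1. 1) z * f z) = f"
      by (simp add: extensional_restrict cong: restrict_cong)
    then show "f \<in> ?K" using f IN one by auto
  qed
  then have JK: "?J \<subseteq> ?K" by (intro R.genideal_minimal ideal_of_outer_fractions assms)
  have "?J \<inter> carrier Hinf \<subseteq> I"
  proof
    fix h assume h: "h \<in> ?J \<inter> carrier Hinf"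
    then obtain b where b: "outer b" "(\<lambda>z\<in>ball 0 1. b z * h z) \<in> I" using JK by blast
    show "h \<in> I"
    proof (rule cancel_outer_factor[OF assms(2) _ _ b])
      show "g \<in> I" if "f \<in> I" "f \<noteq> \<zero>\<^bsub>Hinf\<^esub>" "is_inner_factor g f" for f g
        by (rule assms(3)[OF that])
    qed (use h in blast)
  qed
  moreover have "I \<subseteq> ?J \<inter> carrier Hinf" using R.genideal_self[OF IN] I.a_subset by blast
  ultimately show ?thesis using R.genideal_ideal[OF IN] by blast
qed

end
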